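(* Let $N\geq 3$ and $1\leq m\leq N-2$ be integers, let $0<a<b<\infty$, and let \[ \Omega:=\{x=(y,z)\in\mathbb{R}^{m+1}\times\mathbb{R}^{N-m-1}: a<|y|<b\}. \] Let $2<p<\frac{2N}{N-2}$. Write $y=(y^1,y^2)\in\mathbb{R}^2\times\mathbb{R}^{m-1}$ and identify $\mathbb{R}^2$ with $\mathbb{C}$. For $k\geq 3$ let $G_k\subset O(2)$ be the subgroup generated by $\alpha,\beta$, where $\alpha y^1:=e^{2\pi i/k}y^1$ and $\beta y^1:=e^{2\pi i/k}\overline{y^1}$, and let $G_k$ act on $\mathbb{R}^N$ by $gx:=(gy^1,y^2,z)$ for $x=(y^1,y^2,z)$. Then for each $k\geq 3$ the problem \[ -\Delta u=|u|^{p-2}u \text{ in }\Omega,\qquad u=0 \text{ on }\partial\Omega,\qquad |\nabla u|^2,\ |u|^p\in L^1(\Omega), \] has a solution $u_k$ satisfying \[ u_k(x)=\det(g)\,u_k(g^{-1}x)\quad\text{for all } g\in G_k,\ x\in\Omega, \] and $u_k\neq u_j$ whenever $k\neq j$.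
   Context: Here $\det(g)$ is the determinant of $g$ viewed as an orthogonal $2\times2$ matrix ($\alpha$ is the rotation by $2\pi/k$, $\beta$ a reflection). Solutions are understood as (weak) solutions $u\in H^1_0(\Omega)$. *)

theory Defs
  imports "HOL-Analysis.Analysis"
begin

definition pderiv_dir :: "'n::finite \<Rightarrow> (real^'n \<Rightarrow> real) \<Rightarrow> real^'n \<Rightarrow> real" where
  "pderiv_dir i f x = deriv (\<lambda>t. f (x + t *\<^sub>R axis i 1)) 0"

fun pderivs :: "'n::finite list \<Rightarrow> (real^'n \<Rightarrow> real) \<Rightarrow> real^'n \<Rightarrow> real" where
  "pderivs [] f = f"
| "pderivs (i # is) f = pderiv_dir i (pderivs is f)"

definition smooth_fun :: "(real^'n::finite \<Rightarrow> real) \<Rightarrow> bool" where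
  "smooth_fun f \<longleftrightarrow>
     (\<forall>is. continuous_on UNIV (pderivs is f) \<and>
        (\<forall>i x. (\<lambda>t. pderivs is f (x + t *\<^sub>R axis i 1)) field_differentiable (at 0)))"

definition grad :: "(real^'n::finite \<Rightarrow> real) \<Rightarrow> real^'n \<Rightarrow> real^'n" where
  "grad f x = (\<chi> i. pderiv_dir i f x)"

definition test_fun :: "(real^'n::finite) set \<Rightarrow> (real^'n \<Rightarrow> real) \<Rightarrow> bool" where
  "test_fun \<Omega> \<phi> \<longleftrightarrow> smooth_fun \<phi> \<and> compact (closure {x. \<phi> x \<noteq> 0})
      \<and> closure {x. \<phi> x \<noteq> 0} \<subseteq> \<Omega>"

text \<open>u belongs to H^1_0(Omega) with weak gradient w: u, w are in L^2 and u is the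
  H^1-limit of test functions (H^1_0 = closure of C_c^infinity in H^1).\<close>
definition H10 :: "(real^'n::finite) set \<Rightarrow> (real^'n \<Rightarrow> real) \<Rightarrow> (real^'n \<Rightarrow> real^'n) \<Rightarrow> bool" where
  "H10 \<Omega> u w \<longleftrightarrow>
     u \<in> borel_measurable lebesgue \<and> w \<in> borel_measurable lebesgue \<and>
     (\<integral>\<^sup>+ x. ennreal ((u x)\<^sup>2) \<partial>lebesgue) < \<infinity> \<and>
     (\<integral>\<^sup>+ x. ennreal ((norm (w x))\<^sup>2) \<partial>lebesgue) < \<infinity> \<and>
     (\<exists>\<phi>. (\<forall>k::nat. test_fun \<Omega> (\<phi> k)) \<and>
        (\<lambda>k. \<integral>\<^sup>+ x. ennreal ((\<phi> k x - u x)\<^sup>2) \<partial>lebesgue) \<longlonglongrightarrow> 0 \<and>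
        (\<lambda>k. \<integral>\<^sup>+ x. ennreal ((norm (grad (\<phi> k) x - w x))\<^sup>2) \<partial>lebesgue) \<longlonglongrightarrow> 0)"

definition weak_solution :: "(real^'n::finite) set \<Rightarrow> real \<Rightarrow> (real^'n \<Rightarrow> real) \<Rightarrow> bool" where
  "weak_solution \<Omega> p u \<longleftrightarrow>
     (\<exists>w. H10 \<Omega> u w \<and>
        integrable lebesgue (\<lambda>x. (norm (w x))\<^sup>2) \<and>
        integrable lebesgue (\<lambda>x. \<bar>u x\<bar> powr p) \<and>
        (\<forall>\<phi>. test_fun \<Omega> \<phi> \<longrightarrow>
           (\<integral>x. w x \<bullet> grad \<phi> x \<partial>lebesgue) =
           (\<integral>x. \<bar>u x\<bar> powr (p - 2) * u x * \<phi> x \<partial>lebesgue)))"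

text \<open>Coordinates of x are labelled by e 0, ..., e (N-1); y = (x_{e 0},...,x_{e m}),
  y^1 = (x_{e 0}, x_{e 1}).\<close>
definition annular_dom :: "(nat \<Rightarrow> 'n::finite) \<Rightarrow> nat \<Rightarrow> real \<Rightarrow> real \<Rightarrow> (real^'n) set" where
  "annular_dom e m a b =
     {x. a < sqrt (\<Sum>i\<le>m. (x $ e i)\<^sup>2) \<and> sqrt (\<Sum>i\<le>m. (x $ e i)\<^sup>2) < b}"

definition rot_k :: "nat \<Rightarrow> real^2^2" where
  "rot_k k = (let \<theta> = 2 * pi / real k in
     vector [vector [cos \<theta>, - sin \<theta>], vector [sin \<theta>, cos \<theta>]])"

definition refl_k :: "nat \<Rightarrow> real^2^2" where
  "refl_k k = (let \<theta> = 2 * pi / real k in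
     vector [vector [cos \<theta>, sin \<theta>], vector [sin \<theta>, - cos \<theta>]])"

inductive_set Gk :: "nat \<Rightarrow> (real^2^2) set" for k where
  gen_id: "mat 1 \<in> Gk k"
| gen_alpha: "rot_k k \<in> Gk k"
| gen_beta: "refl_k k \<in> Gk k"
| gen_mult: "g \<in> Gk k \<Longrightarrow> h \<in> Gk k \<Longrightarrow> g ** h \<in> Gk k"
| gen_inv: "g \<in> Gk k \<Longrightarrow> matrix_inv g \<in> Gk k"

definition act :: "(nat \<Rightarrow> 'n::finite) \<Rightarrow> real^2^2 \<Rightarrow> real^'n \<Rightarrow> real^'n" where
  "act e g x = (let v = g *v (vector [x $ e 0, x $ e 1] :: real^2) in
     (\<chi> j. if j = e 0 then v $ 1 else if j = e 1 then v $ 2 else x $ j))"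

end

theory Submission
  imports Defs "HOL-Complex_Analysis.Great_Picard"
begin

text \<open>
  The reflections in \<open>G\<^sub>k\<close> cut \<open>\<Omega>\<close> into \<open>2 k\<close> congruent sectors. On one sector \<open>D\<close> a least
  energy solution is obtained by minimizing the Dirichlet integral under \<open>\<integral>|u|^p = 1\<close>. Since \<open>D\<close> is
  bounded in \<open>y\<close> and invariant under translations in \<open>z\<close>, mass can only be lost in the \<open>z\<close>-directions;
  strict concavity of \<open>t \<mapsto> t powr (2 / p)\<close> forbids a splitting of the mass, so that minimizing
  sequences, centered at medians, are tight, hence Cauchy in \<open>L^p\<close> by local compactness, and then
  Cauchy in \<open>H^1\<close> by the parallelogram identity. The subcritical Sobolev inequality comes from comparing a
  function with its averages over grids of cubes.

  The odd reflection of the minimizer across the walls is a solution on \<open>\<Omega>\<close>: an antisymmetrized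
  test function vanishes on the walls, hence may be cut off near them. The energy of this solution is
  \<open>2 k\<close> times the energy on one sector, which does not decrease when the sector shrinks; so
  different \<open>k\<close> give different energies.
\<close>

section \<open>Smooth functions\<close>

text \<open>Integrability is gained in small steps: control of the \<open>L^q\<close> mass gives
  every exponent below \<open>2 + 2 * q / N\<close>, and the map
  \<open>q \<mapsto> 2 + 2 * q / N\<close> has the critical exponent \<open>2 * N / (N - 2)\<close>
  as its fixed point, so every subcritical exponent is reached. No weak compactness is used. Strong
  \<open>L^p\<close> convergence keeps the constraint in the limit, and the midpoint of two late
  terms still has nearly full mass, hence nearly minimal energy at least; this leaves little energy
  for the difference. Minimizing on one sector, rather than over antisymmetric functions on the
  annulus, makes different \<open>k\<close> comparable: sectors are nested, so levels are monotone,
  and the \<open>p\<close>-mass \<open>2 * k * level powr (p / (p - 2))\<close> of the solution is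
  strictly increasing in \<open>k\<close>. The price is that the minimizer is tested only with
  functions supported inside the open sector. Cutting off at distance \<open>1 / n\<close> from a
  wall costs gradients of size \<open>n\<close>, but a test function vanishing on the wall is of
  size \<open>1 / n\<close> there, so the products stay bounded and dominated convergence
  applies.\<close>

lemma pderivs_append: "pderivs (is @ js) f = pderivs is (pderivs js f)"
  by (induction "is") auto

lemma smooth_fun_pderiv:
  assumes "smooth_fun f" shows "smooth_fun (pderiv_dir i f)"
proof -
  have "pderivs is (pderiv_dir i f) = pderivs (is @ [i]) f" for "is"
    by (simp add: pderivs_append)
  then show ?thesis using assms unfolding smooth_fun_def by metis
qed

lemma smooth_fun_continuous: "smooth_fun f \<Longrightarrow> continuous_on A f"
  unfolding smooth_fun_def by (metis pderivs.simps(1) continuous_on_subset subset_UNIV)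

lemma smooth_fun_has_pderiv:
  assumes "smooth_fun f"
  shows "((\<lambda>t. f (x + t *\<^sub>R axis i 1)) has_real_derivative pderiv_dir i f x) (at 0)"
proof -
  have "(\<lambda>t. f (x + t *\<^sub>R axis i 1)) field_differentiable (at 0)"
    using assms unfolding smooth_fun_def by (metis pderivs.simps(1))
  then show ?thesis
    unfolding pderiv_dir_def by (simp add: DERIV_deriv_iff_field_differentiable)
qed

text \<open>The coordinate derivative is unique, so if every member of \<open>S\<close> has its
  derivatives in \<open>S\<close>, all iterated \<open>pderivs\<close> of \<open>f\<close> stay in
  \<open>S\<close>; continuity and differentiability are then read off from membership. Each closure
  property below amounts to finding a set stable under the relevant differentiation rule.\<close>

lemma smooth_fun_coinduct:
  assumes "f \<in> S" and cont: "\<And>f. f \<in> S \<Longrightarrow> continuous_on UNIV f"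
    and der: "\<And>f i. f \<in> S \<Longrightarrow>
       \<exists>g\<in>S. \<forall>x. ((\<lambda>t. f (x + t *\<^sub>R axis i 1)) has_real_derivative g x) (at 0)"
  shows "smooth_fun f"
proof -
  have "pderivs is f \<in> S" for "is"
  proof (induction "is")
    case (Cons i "is")
    obtain g where g: "g \<in> S"
      "\<And>x. ((\<lambda>t. pderivs is f (x + t *\<^sub>R axis i 1)) has_real_derivative g x) (at 0)"
      using der[OF Cons] by blast
    have "pderivs (i # is) f = g"
      using g(2) by (auto simp: pderiv_dir_def fun_eq_iff intro: DERIV_imp_deriv)
    then show ?case using g(1) by simp
  qed (simp add: assms(1))
  then show ?thesis
    unfolding smooth_fun_def using cont der field_differentiable_def by meson
qed

lemma has_real_derivative_along_line:
  fixes f :: "real^'n::finite \<Rightarrow> real"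
  assumes "\<And>x. ((\<lambda>t. f (x + t *\<^sub>R v)) has_real_derivative g x) (at 0)"
  shows "((\<lambda>t. f (x + t *\<^sub>R v)) has_real_derivative g (x + t *\<^sub>R v)) (at t)"
proof -
  have "((\<lambda>s. f ((x + t *\<^sub>R v) + s *\<^sub>R v)) has_real_derivative g (x + t *\<^sub>R v)) (at (t - t))"
    using assms by simp
  then have "((\<lambda>s. f ((x + t *\<^sub>R v) + (s - t) *\<^sub>R v)) has_real_derivative g (x + t *\<^sub>R v)) (at t)"
    using DERIV_shift[of "\<lambda>s. f ((x + t *\<^sub>R v) + s *\<^sub>R v)" "g (x + t *\<^sub>R v)" t "-t"] by simp
  then show ?thesis by (simp add: algebra_simps)
qed

lemma smooth_fun_const: "smooth_fun (\<lambda>x. c)"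
proof (rule smooth_fun_coinduct[where S = "range (\<lambda>c x. c)"])
  fix f :: "real^'n \<Rightarrow> real" and i assume "f \<in> range (\<lambda>c x. c)"
  then show "\<exists>g\<in>range (\<lambda>c x. c). \<forall>x. ((\<lambda>t. f (x + t *\<^sub>R axis i 1)) has_real_derivative g x) (at 0)"
    by (intro bexI[of _ "\<lambda>x. 0"]) auto
qed auto

lemma smooth_fun_add:
  assumes "smooth_fun f" "smooth_fun g" shows "smooth_fun (\<lambda>x. f x + g x)"
proof (rule smooth_fun_coinduct[where S = "{\<lambda>x. f x + g x | f g. smooth_fun f \<and> smooth_fun g}"])
  fix h :: "real^'n \<Rightarrow> real" and i
  assume "h \<in> {\<lambda>x. f x + g x | f g. smooth_fun f \<and> smooth_fun g}"
  then obtain f g where h: "h = (\<lambda>x. f x + g x)" "smooth_fun f" "smooth_fun g" by blast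
  show "\<exists>k\<in>{\<lambda>x. f x + g x | f g. smooth_fun f \<and> smooth_fun g}.
      \<forall>x. ((\<lambda>t. h (x + t *\<^sub>R axis i 1)) has_real_derivative k x) (at 0)"
  proof (intro bexI[of _ "\<lambda>x. pderiv_dir i f x + pderiv_dir i g x"] allI)
    show "((\<lambda>t. h (x + t *\<^sub>R axis i 1)) has_real_derivative pderiv_dir i f x + pderiv_dir i g x) (at 0)" for x
      unfolding h(1) by (intro DERIV_add smooth_fun_has_pderiv h)
  qed (use h smooth_fun_pderiv in blast)
qed (use assms in \<open>auto simp: continuous_on_add smooth_fun_continuous\<close>)

text \<open>A derivative of one product is a sum of two products, so products alone are not stable
  under differentiation; their finite sums are.\<close>

inductive_set product_span :: "(real^'n::finite \<Rightarrow> real) set" where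
  "smooth_fun f \<Longrightarrow> smooth_fun g \<Longrightarrow> (\<lambda>x. f x * g x) \<in> product_span"
| "f \<in> product_span \<Longrightarrow> g \<in> product_span \<Longrightarrow> (\<lambda>x. f x + g x) \<in> product_span"

lemma smooth_fun_mult:
  assumes "smooth_fun f" "smooth_fun g" shows "smooth_fun (\<lambda>x. f x * g x)"
proof (rule smooth_fun_coinduct[where S = product_span])
  fix h :: "real^'n \<Rightarrow> real" assume "h \<in> product_span"
  then show "continuous_on UNIV h"
    by induction (auto simp: continuous_on_add continuous_on_mult smooth_fun_continuous)
next
  fix h :: "real^'n \<Rightarrow> real" and i assume "h \<in> product_span"
  then show "\<exists>k\<in>product_span. \<forall>x. ((\<lambda>t. h (x + t *\<^sub>R axis i 1)) has_real_derivative k x) (at 0)"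
  proof induction
    case (1 f g)
    have "((\<lambda>t. f (x + t *\<^sub>R axis i 1) * g (x + t *\<^sub>R axis i 1)) has_real_derivative
        pderiv_dir i f x * g x + f x * pderiv_dir i g x) (at 0)" for x
      using DERIV_mult[OF smooth_fun_has_pderiv[OF 1(1)] smooth_fun_has_pderiv[OF 1(2)], of x i x i]
      by (simp add: mult.commute)
    moreover have "(\<lambda>x. pderiv_dir i f x * g x + f x * pderiv_dir i g x) \<in> product_span"
      using 1 by (intro product_span.intros smooth_fun_pderiv)
    ultimately show ?case by (intro bexI[of _ "\<lambda>x. pderiv_dir i f x * g x + f x * pderiv_dir i g x"]) auto
  next
    case (2 f g)
    then obtain f' g' where "f' \<in> product_span" "g' \<in> product_span"
      "\<And>x. ((\<lambda>t. f (x + t *\<^sub>R axis i 1)) has_real_derivative f' x) (at 0)"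
      "\<And>x. ((\<lambda>t. g (x + t *\<^sub>R axis i 1)) has_real_derivative g' x) (at 0)" by blast
    then show ?case
      by (intro bexI[of _ "\<lambda>x. f' x + g' x"]) (auto intro!: DERIV_add product_span.intros)
  qed
qed (use assms in \<open>auto intro: product_span.intros\<close>)

lemma smooth_fun_cmult: "smooth_fun f \<Longrightarrow> smooth_fun (\<lambda>x. c * f x)"
  by (intro smooth_fun_mult smooth_fun_const)

lemma smooth_fun_diff: "smooth_fun f \<Longrightarrow> smooth_fun g \<Longrightarrow> smooth_fun (\<lambda>x. f x - g x)"
  using smooth_fun_add[of f "\<lambda>x. (-1) * g x"] smooth_fun_cmult[of g "-1"] by simp

lemma smooth_fun_sum:
  assumes "\<And>i. i \<in> I \<Longrightarrow> smooth_fun (f i)" shows "smooth_fun (\<lambda>x. \<Sum>i\<in>I. f i x)"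
  using assms by (induction I rule: infinite_finite_induct) (auto intro: smooth_fun_const smooth_fun_add)

lemma smooth_fun_prod:
  assumes "\<And>i. i \<in> I \<Longrightarrow> smooth_fun (f i)" shows "smooth_fun (\<lambda>x. \<Prod>i\<in>I. f i x)"
  using assms by (induction I rule: infinite_finite_induct) (auto intro: smooth_fun_const smooth_fun_mult)

text \<open>The power \<open>n\<close> is arbitrary because the quotient rule raises it: a
  derivative of \<open>f / g ^ n\<close> is again of this form, with denominator
  \<open>g ^ Suc n\<close>. Only the family of all powers is stable.\<close>

lemma smooth_fun_divide_power:
  assumes "smooth_fun f" "smooth_fun g" and pos: "\<And>x. g x > 0"
  shows "smooth_fun (\<lambda>x. f x / g x ^ n)"
proof (rule smooth_fun_coinduct[where S = "{\<lambda>x. f x / g x ^ n | f n. smooth_fun f}"])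
  fix h :: "real^'a \<Rightarrow> real" assume "h \<in> {\<lambda>x. f x / g x ^ n | f n. smooth_fun f}"
  then show "continuous_on UNIV h"
    using assms(2) less_imp_neq[OF pos, symmetric]
    by (auto simp: continuous_on_divide continuous_on_power smooth_fun_continuous)
next
  fix h :: "real^'a \<Rightarrow> real" and i assume "h \<in> {\<lambda>x. f x / g x ^ n | f n. smooth_fun f}"
  then obtain f n where h: "h = (\<lambda>x. f x / g x ^ n)" and f: "smooth_fun f" by blast
  let ?k = "\<lambda>x. (pderiv_dir i f x * g x - real n * (f x * pderiv_dir i g x)) / g x ^ Suc n"
  have "((\<lambda>t. h (x + t *\<^sub>R axis i 1)) has_real_derivative ?k x) (at 0)" for x
  proof -
    have *: "g x \<noteq> 0" using pos[of x] by simp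
    have "((\<lambda>t. h (x + t *\<^sub>R axis i 1)) has_real_derivative
        (pderiv_dir i f x * g x ^ n - f x * (real n * (pderiv_dir i g x * g x ^ (n - Suc 0)))) / (g x ^ n * g x ^ n)) (at 0)"
      unfolding h
      using DERIV_divide[OF smooth_fun_has_pderiv[OF f, of x i] DERIV_power[OF smooth_fun_has_pderiv[OF assms(2), of x i], of n]] *
      by simp
    moreover have "(pderiv_dir i f x * g x ^ n - f x * (real n * (pderiv_dir i g x * g x ^ (n - Suc 0)))) / (g x ^ n * g x ^ n) = ?k x"
      using * by (cases n) (simp_all add: field_simps)
    ultimately show ?thesis by simp
  qed
  moreover have "?k \<in> {\<lambda>x. f x / g x ^ n | f n. smooth_fun f}"
    by (intro CollectI exI[of _ "\<lambda>x. pderiv_dir i f x * g x - real n * (f x * pderiv_dir i g x)"]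
        exI[of _ "Suc n"] conjI refl smooth_fun_diff smooth_fun_mult smooth_fun_cmult smooth_fun_pderiv f assms(2))
  ultimately show "\<exists>k\<in>{\<lambda>x. f x / g x ^ n | f n. smooth_fun f}.
      \<forall>x. ((\<lambda>t. h (x + t *\<^sub>R axis i 1)) has_real_derivative k x) (at 0)"
    by (intro bexI[of _ ?k]) auto
qed (use assms in blast)

lemma smooth_fun_comp_linear_form:
  fixes v :: "real^'n::finite"
  assumes "h \<in> S" and der: "\<And>h. h \<in> S \<Longrightarrow> \<exists>h'\<in>S. \<forall>t. (h has_real_derivative h' t) (at t)"
  shows "smooth_fun (\<lambda>x. h (c + v \<bullet> x))"
proof (rule smooth_fun_coinduct[where S = "{\<lambda>x. \<kappa> * h (c + v \<bullet> x) | \<kappa> h. h \<in> S}"])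
  show "(\<lambda>x. h (c + v \<bullet> x)) \<in> {\<lambda>x. \<kappa> * h (c + v \<bullet> x) | \<kappa> h. h \<in> S}"
    using assms(1) by (auto intro!: exI[of _ 1] exI[of _ h])
next
  fix f assume "f \<in> {\<lambda>x. \<kappa> * h (c + v \<bullet> x) | \<kappa> h. h \<in> S}"
  then obtain \<kappa> h where h: "f = (\<lambda>x. \<kappa> * h (c + v \<bullet> x))" "h \<in> S" by blast
  have "continuous_on UNIV h"
    using der[OF h(2)] by (meson DERIV_isCont continuous_at_imp_continuous_on)
  then have "continuous_on UNIV (h \<circ> (\<lambda>x. c + v \<bullet> x))"
    by (intro continuous_on_compose continuous_intros) (auto intro: continuous_on_subset)
  then show "continuous_on UNIV f" unfolding h by (auto intro!: continuous_intros simp: o_def)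
next
  fix f and i :: 'n assume "f \<in> {\<lambda>x. \<kappa> * h (c + v \<bullet> x) | \<kappa> h. h \<in> S}"
  then obtain \<kappa> h where h: "f = (\<lambda>x. \<kappa> * h (c + v \<bullet> x))" "h \<in> S" by blast
  obtain h' where h': "h' \<in> S" "\<And>t. (h has_real_derivative h' t) (at t)" using der[OF h(2)] by blast
  have "((\<lambda>t. f (x + t *\<^sub>R axis i 1)) has_real_derivative (\<kappa> * v $ i) * h' (c + v \<bullet> x)) (at 0)" for x
  proof -
    have "((\<lambda>t. c + v \<bullet> x + t * v $ i) has_real_derivative v $ i) (at 0)"
      by (auto intro!: derivative_eq_intros)
    then have "((\<lambda>t. h (c + v \<bullet> x + t * v $ i)) has_real_derivative h' (c + v \<bullet> x) * v $ i) (at 0)"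
      using DERIV_chain2[of h "h' (c + v \<bullet> x)" "\<lambda>t. c + v \<bullet> x + t * v $ i" 0 "v $ i" UNIV] h'(2) by simp
    then show ?thesis
      unfolding h by (auto intro!: derivative_eq_intros simp: inner_add_right inner_axis algebra_simps)
  qed
  then show "\<exists>g\<in>{\<lambda>x. \<kappa> * h (c + v \<bullet> x) | \<kappa> h. h \<in> S}.
      \<forall>x. ((\<lambda>t. f (x + t *\<^sub>R axis i 1)) has_real_derivative g x) (at 0)"
    using h'(1) by (intro bexI[of _ "\<lambda>x. (\<kappa> * v $ i) * h' (c + v \<bullet> x)"]) auto
qed

subsection \<open>Gradients\<close>

lemma grad_nth: "grad f x $ i = pderiv_dir i f x"
  by (simp add: grad_def)

lemma continuous_on_grad: "smooth_fun f \<Longrightarrow> continuous_on A (grad f)"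
  unfolding grad_def using smooth_fun_continuous smooth_fun_pderiv
  by (intro continuous_on_vec_lambda) blast

text \<open>Continuous partial derivatives imply differentiability: the increment is switched on one
  coordinate at a time, each switch being a mean value step along an axis.\<close>

lemma smooth_fun_has_derivative:
  fixes f :: "real^'n::finite \<Rightarrow> real"
  assumes f: "smooth_fun f"
  shows "(f has_derivative (\<lambda>h. grad f x \<bullet> h)) (at x)"
proof -
  \<comment> \<open>\<open>R A h\<close> keeps only the coordinates of \<open>h\<close> in
    \<open>A\<close>, so that the induction runs over the set of coordinates already moved, with one
    error \<open>e * norm h\<close> for each.\<close>
  define R :: "'n set \<Rightarrow> real^'n \<Rightarrow> real^'n" where "R A h = (\<chi> j. if j \<in> A then h $ j else 0)" for A h
  have normR: "norm (R A h) \<le> norm h" for A h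
    unfolding R_def by (rule norm_le_componentwise_cart) auto
  have step: "\<exists>\<delta>>0. \<forall>h. norm h < \<delta> \<longrightarrow>
     \<bar>f (x + R A h) - f x - (\<Sum>i\<in>A. grad f x $ i * h $ i)\<bar> \<le> real (card A) * e * norm h"
    if "e > 0" "finite A" for e and A :: "'n set"
    using that(2)
  proof induction
    case empty
    have "R {} h = 0" for h by (simp add: R_def vec_eq_iff)
    then show ?case by (auto intro: exI[of _ 1])
  next
    case (insert i A)
    then obtain d1 where d1: "d1 > 0" "\<And>h. norm h < d1 \<Longrightarrow>
     \<bar>f (x + R A h) - f x - (\<Sum>i\<in>A. grad f x $ i * h $ i)\<bar> \<le> real (card A) * e * norm h" by blast
    have "isCont (pderiv_dir i f) x"
      using smooth_fun_continuous[OF smooth_fun_pderiv[OF f], of UNIV i]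
      by (simp add: continuous_on_eq_continuous_at)
    then obtain d2 where d2: "d2 > 0" "\<And>y. dist y x < d2 \<Longrightarrow> dist (pderiv_dir i f y) (pderiv_dir i f x) < e"
      unfolding continuous_at_eps_delta using \<open>e > 0\<close> by blast
    \<comment> \<open>Both \<open>R A h\<close> and the displacement to the intermediate point have
      norm at most \<open>norm h\<close>, which explains the \<open>d2 / 2\<close>.\<close>
    have "\<bar>f (x + R (insert i A) h) - f x - (\<Sum>i\<in>insert i A. grad f x $ i * h $ i)\<bar>
       \<le> real (card (insert i A)) * e * norm h" if h: "norm h < min d1 (d2 / 2)" for h
    proof -
      define y where "y = x + R A h"
      have Ri: "R (insert i A) h = R A h + (h $ i) *\<^sub>R axis i 1"
        using insert.hyps by (auto simp: R_def vec_eq_iff axis_def)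
      have hi: "\<bar>h $ i\<bar> \<le> norm h" by (rule component_le_norm_cart)
      have D: "\<And>t. ((\<lambda>t. f (y + t *\<^sub>R axis i 1)) has_real_derivative pderiv_dir i f (y + t *\<^sub>R axis i 1)) (at t)"
        by (rule has_real_derivative_along_line) (rule smooth_fun_has_pderiv[OF f])
      have "\<exists>\<xi>. \<bar>\<xi>\<bar> \<le> \<bar>h $ i\<bar> \<and> f (y + (h $ i) *\<^sub>R axis i 1) - f y = h $ i * pderiv_dir i f (y + \<xi> *\<^sub>R axis i 1)"
      proof (cases "h $ i" "0::real" rule: linorder_cases)
        case less
        have "\<exists>z>h $ i. z < 0 \<and> f (y + 0 *\<^sub>R axis i 1) - f (y + (h $ i) *\<^sub>R axis i 1)
            = (0 - h $ i) * pderiv_dir i f (y + z *\<^sub>R axis i 1)"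
          by (rule MVT2[OF less]) (rule D)
        then obtain \<xi> where \<xi>: "\<xi> > h $ i" "\<xi> < 0" "f (y + 0 *\<^sub>R axis i 1) - f (y + (h $ i) *\<^sub>R axis i 1)
            = (0 - h $ i) * pderiv_dir i f (y + \<xi> *\<^sub>R axis i 1)" by (elim exE conjE)
        show ?thesis using \<xi> by (intro exI[of _ \<xi>] conjI) (simp, simp add: algebra_simps)
      next
        case greater
        have "\<exists>z>0. z < h $ i \<and> f (y + (h $ i) *\<^sub>R axis i 1) - f (y + 0 *\<^sub>R axis i 1)
            = (h $ i - 0) * pderiv_dir i f (y + z *\<^sub>R axis i 1)"
          by (rule MVT2[OF greater]) (rule D)
        then obtain \<xi> where \<xi>: "\<xi> > 0" "\<xi> < h $ i" "f (y + (h $ i) *\<^sub>R axis i 1) - f (y + 0 *\<^sub>R axis i 1)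
            = (h $ i - 0) * pderiv_dir i f (y + \<xi> *\<^sub>R axis i 1)" by (elim exE conjE)
        show ?thesis using \<xi> by (intro exI[of _ \<xi>] conjI) (simp, simp add: algebra_simps)
      qed (simp add: exI[of _ 0])
      then obtain \<xi> where xi: "\<bar>\<xi>\<bar> \<le> \<bar>h $ i\<bar>"
        "f (y + (h $ i) *\<^sub>R axis i 1) - f y = h $ i * pderiv_dir i f (y + \<xi> *\<^sub>R axis i 1)" by blast
      have "dist (y + \<xi> *\<^sub>R axis i 1) x \<le> norm (R A h) + norm (\<xi> *\<^sub>R axis i 1 :: real^'n)"
        using norm_triangle_ineq[of "R A h" "\<xi> *\<^sub>R axis i 1"]
        unfolding y_def dist_norm by (metis add.assoc add_diff_cancel_left')
      also have "\<dots> \<le> norm h + norm h"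
        using normR[of A h] xi(1) hi by (simp add: norm_axis_1)
      also have "\<dots> < d2" using h by simp
      finally have "\<bar>pderiv_dir i f (y + \<xi> *\<^sub>R axis i 1) - pderiv_dir i f x\<bar> \<le> e"
        using d2(2) by (force simp: dist_real_def)
      then have "\<bar>h $ i * pderiv_dir i f (y + \<xi> *\<^sub>R axis i 1) - h $ i * pderiv_dir i f x\<bar> \<le> norm h * e"
        unfolding right_diff_distrib[symmetric] abs_mult using hi by (intro mult_mono) auto
      moreover have "\<bar>f y - f x - (\<Sum>i\<in>A. grad f x $ i * h $ i)\<bar> \<le> real (card A) * e * norm h"
        unfolding y_def using d1(2) h by simp
      moreover have "f (x + R (insert i A) h) - f x - (\<Sum>i\<in>insert i A. grad f x $ i * h $ i)
         = (f y - f x - (\<Sum>i\<in>A. grad f x $ i * h $ i))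
           + (h $ i * pderiv_dir i f (y + \<xi> *\<^sub>R axis i 1) - h $ i * pderiv_dir i f x)"
        using insert.hyps xi(2) unfolding Ri by (simp add: y_def add.assoc grad_nth)
      ultimately show ?thesis
        using insert.hyps by (simp add: algebra_simps abs_le_iff)
    qed
    then show ?case using d1(1) d2(1) by (intro exI[of _ "min d1 (d2/2)"]) auto
  qed
  show ?thesis
    unfolding has_derivative_at_alt
  proof (intro conjI allI impI)
    show "bounded_linear (\<lambda>h. grad f x \<bullet> h)" by (rule bounded_linear_inner_right)
    fix e :: real assume "e > 0"
    \<comment> \<open>One share of \<open>e\<close> for each of the \<open>CARD('n)\<close>
      coordinate steps.\<close>
    define e' where "e' = e / real (CARD('n))"
    have "e' > 0" using \<open>e > 0\<close> by (simp add: e'_def)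
    then obtain \<delta> where d: "\<delta> > 0" "\<And>h. norm h < \<delta> \<Longrightarrow>
     \<bar>f (x + R UNIV h) - f x - (\<Sum>i\<in>UNIV. grad f x $ i * h $ i)\<bar> \<le> real (CARD('n)) * e' * norm h"
      using step[of e' UNIV] by auto
    have "R UNIV h = h" for h by (simp add: R_def vec_eq_iff)
    then have "norm (f y - f x - grad f x \<bullet> (y - x)) \<le> e * norm (y - x)" if "norm (y - x) < \<delta>" for y
      using d(2)[OF that] by (simp add: inner_vec_def e'_def)
    then show "\<exists>d>0. \<forall>y. norm (y - x) < d \<longrightarrow> norm (f y - f x - grad f x \<bullet> (y - x)) \<le> e * norm (y - x)"
      using d(1) by blast
  qed
qed

lemma smooth_fun_has_directional_derivative:
  assumes "smooth_fun f"
  shows "((\<lambda>t. f (x + t *\<^sub>R h)) has_real_derivative grad f (x + t *\<^sub>R h) \<bullet> h) (at t)"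
proof -
  have "((\<lambda>t. x + t *\<^sub>R h) has_vector_derivative h) (at t)"
    by (auto intro!: derivative_eq_intros)
  from vector_derivative_diff_chain_within[OF this, of f "\<lambda>k. grad f (x + t *\<^sub>R h) \<bullet> k"]
  have "(f \<circ> (\<lambda>t. x + t *\<^sub>R h) has_vector_derivative grad f (x + t *\<^sub>R h) \<bullet> h) (at t)"
    using smooth_fun_has_derivative[OF assms] has_derivative_at_withinI by blast
  then show ?thesis
    by (simp add: has_real_derivative_iff_has_vector_derivative o_def)
qed

lemma grad_eqI:
  assumes "\<And>i. ((\<lambda>t. f (x + t *\<^sub>R axis i 1)) has_real_derivative v $ i) (at 0)"
  shows "grad f x = v"
  using assms by (simp add: vec_eq_iff grad_nth pderiv_dir_def DERIV_imp_deriv)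

lemma grad_add:
  assumes "smooth_fun f" "smooth_fun g"
  shows "grad (\<lambda>x. f x + g x) x = grad f x + grad g x"
  by (intro grad_eqI) (auto simp: grad_nth intro!: DERIV_add smooth_fun_has_pderiv assms)

lemma grad_mult:
  assumes "smooth_fun f" "smooth_fun g"
  shows "grad (\<lambda>x. f x * g x) x = f x *\<^sub>R grad g x + g x *\<^sub>R grad f x"
proof (intro grad_eqI)
  fix i
  show "((\<lambda>t. f (x + t *\<^sub>R axis i 1) * g (x + t *\<^sub>R axis i 1)) has_real_derivative
      (f x *\<^sub>R grad g x + g x *\<^sub>R grad f x) $ i) (at 0)"
    using DERIV_mult[OF smooth_fun_has_pderiv[OF assms(1), of x i] smooth_fun_has_pderiv[OF assms(2), of x i]]
    by (simp add: grad_nth algebra_simps)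
qed

lemma grad_const: "grad (\<lambda>x. c) x = 0"
  by (intro grad_eqI) auto

lemma grad_cmult: "smooth_fun f \<Longrightarrow> grad (\<lambda>x. c * f x) x = c *\<^sub>R grad f x"
  using grad_mult[OF smooth_fun_const, of f c x] by (simp add: grad_const)

lemma grad_diff:
  "smooth_fun f \<Longrightarrow> smooth_fun g \<Longrightarrow> grad (\<lambda>x. f x - g x) x = grad f x - grad g x"
  using grad_add[of f "\<lambda>x. (-1) * g x" x] grad_cmult[of g "-1" x] smooth_fun_cmult[of g "-1"] by simp

lemma grad_sum:
  assumes "\<And>i. i \<in> I \<Longrightarrow> smooth_fun (f i)"
  shows "grad (\<lambda>x. \<Sum>i\<in>I. f i x) x = (\<Sum>i\<in>I. grad (f i) x)"
  using assms
  by (induction I rule: infinite_finite_induct) (auto simp: grad_const grad_add smooth_fun_sum)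

lemma grad_comp_linear_form:
  assumes "\<And>t. (h has_real_derivative h' t) (at t)"
  shows "grad (\<lambda>x. h (c + v \<bullet> x)) x = h' (c + v \<bullet> x) *\<^sub>R v"
proof (intro grad_eqI)
  fix i
  have "((\<lambda>t. c + v \<bullet> x + t * v $ i) has_real_derivative v $ i) (at 0)"
    by (auto intro!: derivative_eq_intros)
  then have "((\<lambda>t. h (c + v \<bullet> x + t * v $ i)) has_real_derivative h' (c + v \<bullet> x) * v $ i) (at 0)"
    using DERIV_chain2[of h "h' (c + v \<bullet> x)" "\<lambda>t. c + v \<bullet> x + t * v $ i" 0 "v $ i" UNIV] assms by simp
  then show "((\<lambda>t. h (c + v \<bullet> (x + t *\<^sub>R axis i 1))) has_real_derivative (h' (c + v \<bullet> x) *\<^sub>R v) $ i) (at 0)"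
    by (simp add: inner_add_right inner_axis algebra_simps)
qed

text \<open>The chain rule turns one composition into a linear combination of compositions with the
  partial derivatives, so factors and sums are built in to make the set stable under
  differentiation.\<close>

inductive_set affine_span :: "real^'n::finite \<Rightarrow> (real^'m::finite \<Rightarrow> real^'n) \<Rightarrow> (real^'m \<Rightarrow> real) set" for c T where
  "smooth_fun f \<Longrightarrow> (\<lambda>x. \<kappa> * f (c + T x)) \<in> affine_span c T"
| "f \<in> affine_span c T \<Longrightarrow> g \<in> affine_span c T \<Longrightarrow> (\<lambda>x. f x + g x) \<in> affine_span c T"

lemma has_pderiv_comp_affine:
  assumes "smooth_fun f" "linear T"
  shows "((\<lambda>t. f (c + T (x + t *\<^sub>R axis i 1))) has_real_derivative
     grad f (c + T x) \<bullet> T (axis i 1)) (at 0)"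
  using smooth_fun_has_directional_derivative[OF assms(1), of "c + T x" "T (axis i 1)" 0]
  by (simp add: linear_add[OF assms(2)] linear_scale[OF assms(2)] add.assoc)

lemma smooth_fun_comp_affine:
  fixes T :: "real^'m::finite \<Rightarrow> real^'n::finite"
  assumes "smooth_fun f" and T: "linear T"
  shows "smooth_fun (\<lambda>x. f (c + T x))"
proof (rule smooth_fun_coinduct[where S = "affine_span c T"])
  show "(\<lambda>x. f (c + T x)) \<in> affine_span c T"
    using affine_span.intros(1)[OF assms(1), of 1 c T] by simp
next
  fix h assume "h \<in> affine_span c T"
  then show "continuous_on UNIV h"
  proof induction
    case (1 f \<kappa>)
    have "continuous_on UNIV (f \<circ> (\<lambda>x. c + T x))"
      using T by (intro continuous_on_compose continuous_intros smooth_fun_continuous 1)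
        (auto simp: linear_continuous_on linear_conv_bounded_linear)
    then show ?case by (auto intro!: continuous_intros simp: o_def)
  qed (auto intro!: continuous_intros)
next
  fix h and i :: 'm assume "h \<in> affine_span c T"
  then show "\<exists>k\<in>affine_span c T. \<forall>x. ((\<lambda>t. h (x + t *\<^sub>R axis i 1)) has_real_derivative k x) (at 0)"
  proof induction
    case (1 f \<kappa>)
    \<comment> \<open>The chain-rule sum over all coordinates is assembled by induction on a finite
      set of them, since \<open>affine_span\<close> only offers binary sums.\<close>
    have "(\<lambda>x. \<Sum>j\<in>A. (\<kappa> * T (axis i 1) $ j) * pderiv_dir j f (c + T x)) \<in> affine_span c T" if "finite A" for A
      using that
    proof induction
      case empty
      show ?case using affine_span.intros(1)[OF 1, of 0 c T] by simp
    next
      case (insert j A)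
      then show ?case
        using affine_span.intros(1)[OF smooth_fun_pderiv[OF 1], of "\<kappa> * T (axis i 1) $ j" j c T]
          affine_span.intros(2) by fastforce
    qed
    from this[of UNIV]
    have "(\<lambda>x. \<kappa> * (grad f (c + T x) \<bullet> T (axis i 1))) \<in> affine_span c T"
      by (simp add: inner_vec_def grad_nth sum_distrib_left mult.assoc mult.commute mult.left_commute)
    moreover have "((\<lambda>t. \<kappa> * f (c + T (x + t *\<^sub>R axis i 1))) has_real_derivative
       \<kappa> * (grad f (c + T x) \<bullet> T (axis i 1))) (at 0)" for x
      by (intro DERIV_cmult has_pderiv_comp_affine 1 T)
    ultimately show ?case by (intro bexI[of _ "\<lambda>x. \<kappa> * (grad f (c + T x) \<bullet> T (axis i 1))"]) auto
  next
    case (2 f g)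
    then obtain f' g' where "f' \<in> affine_span c T" "g' \<in> affine_span c T"
      "\<And>x. ((\<lambda>t. f (x + t *\<^sub>R axis i 1)) has_real_derivative f' x) (at 0)"
      "\<And>x. ((\<lambda>t. g (x + t *\<^sub>R axis i 1)) has_real_derivative g' x) (at 0)" by blast
    then show ?case
      by (intro bexI[of _ "\<lambda>x. f' x + g' x"]) (auto intro!: DERIV_add affine_span.intros)
  qed
qed

lemma smooth_fun_translate: "smooth_fun f \<Longrightarrow> smooth_fun (\<lambda>x. f (c + x))"
  using smooth_fun_comp_affine[of f "\<lambda>x. x" c] by (simp add: linear_iff)

lemma grad_translate: "smooth_fun f \<Longrightarrow> grad (\<lambda>x. f (c + x)) x = grad f (c + x)"
  using has_pderiv_comp_affine[of f "\<lambda>x. x" c x]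
  by (intro grad_eqI) (simp add: linear_iff inner_axis)

text \<open>Testing with \<open>v\<close> avoids the adjoint of \<open>T\<close>; it suffices to
  expand \<open>T v\<close> over the axes.\<close>

lemma grad_comp_linear_inner:
  assumes "smooth_fun f" "linear T"
  shows "grad (\<lambda>x. f (T x)) x \<bullet> v = grad f (T x) \<bullet> T v"
proof -
  have i: "grad (\<lambda>x. f (T x)) x $ i = grad f (T x) \<bullet> T (axis i 1)" for i
    using has_pderiv_comp_affine[OF assms, of 0 x i]
    by (simp add: grad_nth pderiv_dir_def DERIV_imp_deriv)
  have "v = (\<Sum>i\<in>UNIV. v $ i *\<^sub>R axis i 1)"
    by (simp add: vec_eq_iff axis_def if_distrib cong: if_cong)
  then have "T v = (\<Sum>i\<in>UNIV. v $ i *\<^sub>R T (axis i 1))"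
    by (metis (no_types, lifting) assms(2) linear_scale linear_sum sum.cong)
  then show ?thesis
    by (simp add: inner_vec_def[of "grad _ x"] i inner_sum_right mult.commute)
qed

subsection \<open>A smooth step\<close>

text \<open>The function \<open>exp (- (1 / t))\<close> for \<open>t > 0\<close>, extended by 0,
  with a polynomial factor in \<open>1 / t\<close>. The factor makes the family closed under
  differentiation; \<open>P = 1\<close> is the classical flat function.\<close>

definition exp_rec :: "real poly \<Rightarrow> real \<Rightarrow> real" where
  "exp_rec P t = (if t > 0 then poly P (1 / t) * exp (- (1 / t)) else 0)"

lemma poly_times_exp_neg_tendsto_0: "((\<lambda>s. poly P s * exp (- s)) \<longlongrightarrow> (0::real)) at_top"
proof -
  have "((\<lambda>s. \<Sum>i\<le>degree P. coeff P i * (s ^ i / exp s)) \<longlongrightarrow> (\<Sum>i\<le>degree P. coeff P i * 0)) at_top"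
    by (intro tendsto_intros tendsto_power_div_exp_0)
  then show ?thesis
    by (simp add: poly_altdef sum_distrib_right exp_minus divide_inverse mult.assoc)
qed

text \<open>With \<open>s = 1 / t\<close>, the derivative of \<open>P(s) exp(-s)\<close> in
  \<open>t\<close> is \<open>s^2 (P(s) - P'(s)) exp(-s)\<close>, which explains the polynomial. At
  \<open>t = 0\<close> the exponential beats every polynomial.\<close>

lemma exp_rec_has_derivative:
  "(exp_rec P has_real_derivative exp_rec ([:0, 0, 1:] * (P - pderiv P)) t) (at t)"
proof (cases t "0::real" rule: linorder_cases)
  case less
  have "((\<lambda>t. 0) has_real_derivative 0) (at t)" by simp
  then have "(exp_rec P has_real_derivative 0) (at t)"
    by (rule has_field_derivative_transform_within[where d = "-t"])
      (use less in \<open>auto simp: exp_rec_def dist_real_def abs_if split: if_splits\<close>)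
  then show ?thesis using less by (simp add: exp_rec_def)
next
  case equal
  \<comment> \<open>The difference quotient at \<open>h > 0\<close> is
    \<open>s * P(s) * exp (- s)\<close> with \<open>s = 1 / h\<close>, hence the factor
    \<open>pCons 0 P\<close>.\<close>
  have "((\<lambda>s. poly (pCons 0 P) s * exp (- s)) \<longlongrightarrow> 0) at_top"
    by (rule poly_times_exp_neg_tendsto_0)
  then have "((\<lambda>h. poly (pCons 0 P) (inverse h) * exp (- inverse h)) \<longlongrightarrow> 0) (at_right 0)"
    by (rule filterlim_compose[OF _ filterlim_inverse_at_top_right])
  then have R: "((\<lambda>h. (exp_rec P (0 + h) - exp_rec P 0) / h) \<longlongrightarrow> 0) (at_right 0)"
    by (rule Lim_transform_eventually)
      (auto simp: exp_rec_def eventually_at_filter field_simps)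
  have L: "((\<lambda>h. (exp_rec P (0 + h) - exp_rec P 0) / h) \<longlongrightarrow> 0) (at_left 0)"
    by (rule Lim_transform_eventually[OF tendsto_const])
      (auto simp: exp_rec_def eventually_at_filter)
  have "((\<lambda>h. (exp_rec P (0 + h) - exp_rec P 0) / h) \<longlongrightarrow> 0) (at 0)"
    using L R by (rule filterlim_split_at)
  then show ?thesis
    unfolding DERIV_def using equal by (simp add: exp_rec_def)
next
  case greater
  have "((\<lambda>t. poly P (1 / t) * exp (- (1 / t))) has_real_derivative
      exp_rec ([:0, 0, 1:] * (P - pderiv P)) t) (at t)"
    using greater
    by (auto intro!: derivative_eq_intros simp: exp_rec_def field_simps power2_eq_square)
  then show ?thesis
    by (rule has_field_derivative_transform_within[where d = t])
      (use greater in \<open>auto simp: exp_rec_def dist_real_def abs_if split: if_splits\<close>)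
qed

definition smooth_step :: "real \<Rightarrow> real" where
  "smooth_step t = exp_rec 1 t / (exp_rec 1 t + exp_rec 1 (1 - t))"

lemma exp_rec_1_nonneg: "exp_rec 1 t \<ge> 0"
  by (simp add: exp_rec_def)

text \<open>\<open>t\<close> and \<open>1 - t\<close> are never both nonpositive, so at least one
  summand is positive.\<close>

lemma smooth_step_denominator_pos: "exp_rec 1 t + exp_rec 1 (1 - t) > 0"
  by (cases "t > 0") (auto simp: exp_rec_def add_pos_pos)

lemma smooth_step_eq_0: "t \<le> 0 \<Longrightarrow> smooth_step t = 0"
  by (simp add: smooth_step_def exp_rec_def)

lemma smooth_step_eq_1: "t \<ge> 1 \<Longrightarrow> smooth_step t = 1"
  using smooth_step_denominator_pos[of t] by (simp add: smooth_step_def exp_rec_def)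

lemma smooth_step_bounds: "0 \<le> smooth_step t" "smooth_step t \<le> 1"
  using smooth_step_denominator_pos[of t] exp_rec_1_nonneg[of t] exp_rec_1_nonneg[of "1 - t"]
  by (auto simp: smooth_step_def)

text \<open>The derivative given by the quotient rule is continuous and vanishes off the open unit
  interval, so compactness of \<open>{0..1}\<close> yields one bound \<open>B\<close>. This bound
  later measures the cost of cutting functions off.\<close>

lemma smooth_step_has_derivative:
  obtains d B where "\<And>t. (smooth_step has_real_derivative d t) (at t)" "\<And>t. \<bar>d t\<bar> \<le> B"
    "\<And>t. t \<notin> {0<..<1} \<Longrightarrow> d t = 0"
proof -
  define q where "q = ([:0, 0, 1:] * (1 - pderiv 1) :: real poly)"
  define D where "D t = exp_rec 1 t + exp_rec 1 (1 - t)" for t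
  define d where "d t = (exp_rec q t * D t - exp_rec 1 t * (exp_rec q t - exp_rec q (1 - t))) / (D t * D t)" for t
  have D1: "(D has_real_derivative exp_rec q t - exp_rec q (1 - t)) (at t)" for t
  proof -
    have "((\<lambda>t. exp_rec 1 (1 - t)) has_real_derivative exp_rec q (1 - t) * (-1)) (at t)"
      unfolding q_def by (rule DERIV_chain2[OF exp_rec_has_derivative]) (auto intro!: derivative_eq_intros)
    from DERIV_add[OF exp_rec_has_derivative[of 1 t] this] show ?thesis
      unfolding D_def by (simp add: q_def)
  qed
  have E1: "(exp_rec 1 has_real_derivative exp_rec q t) (at t)" for t
    unfolding q_def by (rule exp_rec_has_derivative)
  have Dpos: "D t > 0" for t unfolding D_def by (rule smooth_step_denominator_pos)
  have der: "(smooth_step has_real_derivative d t) (at t)" for t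
  proof -
    have "((\<lambda>t. exp_rec 1 t / D t) has_real_derivative d t) (at t)"
      unfolding d_def using Dpos[of t] by (intro DERIV_divide E1 D1) auto
    then show ?thesis by (simp add: smooth_step_def[abs_def] D_def)
  qed
  have cont: "continuous_on A (exp_rec P)" for A P
    using exp_rec_has_derivative by (meson DERIV_isCont continuous_at_imp_continuous_on)
  have cont': "continuous_on A (\<lambda>t. exp_rec P (1 - t))" for A P
    by (intro continuous_on_compose2[OF cont[of UNIV]] continuous_intros) auto
  have "continuous_on {0..1} d"
    unfolding d_def D_def using smooth_step_denominator_pos
    by (intro continuous_intros cont cont') (simp add: less_imp_neq[symmetric])
  then have "bounded (d ` {0..1})"
    by (intro compact_imp_bounded compact_continuous_image) auto
  then obtain B where B: "\<And>t. t \<in> {0..1} \<Longrightarrow> \<bar>d t\<bar> \<le> B"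
    unfolding bounded_iff by (force simp: real_norm_def)
  have out: "d t = 0" if "t \<notin> {0<..<1}" for t
  proof -
    consider "t \<le> 0" | "t = 1" | "t > 1" using \<open>t \<notin> {0<..<1}\<close> by fastforce
    then show ?thesis by cases (auto simp: d_def D_def exp_rec_def)
  qed
  have "\<bar>d t\<bar> \<le> max B 0" for t using B[of t] out[of t] by (cases "t \<in> {0<..<1}") auto
  with der out show ?thesis using that by blast
qed

lemma smooth_fun_exp_rec: "smooth_fun (\<lambda>x. exp_rec P (c + v \<bullet> x))"
  by (rule smooth_fun_comp_linear_form[where S = "range exp_rec"])
    (use exp_rec_has_derivative in \<open>auto\<close>)

lemma smooth_fun_step: "smooth_fun (\<lambda>x. smooth_step (c + v \<bullet> x))"
proof -
  have "smooth_fun (\<lambda>x. exp_rec 1 ((1 - c) + (- v) \<bullet> x))" by (rule smooth_fun_exp_rec)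
  then have 2: "smooth_fun (\<lambda>x. exp_rec 1 (1 - (c + v \<bullet> x)))"
    by (simp add: algebra_simps)
  have "smooth_fun (\<lambda>x. exp_rec 1 (c + v \<bullet> x) / (exp_rec 1 (c + v \<bullet> x) + exp_rec 1 (1 - (c + v \<bullet> x))) ^ 1)"
    by (intro smooth_fun_divide_power smooth_fun_add smooth_fun_exp_rec 2 smooth_step_denominator_pos)
  then show ?thesis by (simp add: smooth_step_def)
qed

subsection \<open>Test functions\<close>

lemma test_fun_smooth: "test_fun \<Omega> \<phi> \<Longrightarrow> smooth_fun \<phi>"
  by (simp add: test_fun_def)

lemma test_funI:
  assumes "smooth_fun \<phi>" "compact K" "K \<subseteq> \<Omega>" "\<And>x. x \<notin> K \<Longrightarrow> \<phi> x = 0"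
  shows "test_fun \<Omega> \<phi>"
proof -
  have "closure {x. \<phi> x \<noteq> 0} \<subseteq> K"
    using assms by (intro closure_minimal compact_imp_closed) auto
  moreover from this have "compact (closure {x. \<phi> x \<noteq> 0})"
    using assms(2) compact_Int_closed[of K "closure {x. \<phi> x \<noteq> 0}"] by (simp add: inf.absorb2)
  ultimately show ?thesis
    unfolding test_fun_def using assms(1,3) by blast
qed

lemma grad_eq_0_outside:
  assumes "closed K" "\<And>x. x \<notin> K \<Longrightarrow> f x = 0" "x \<notin> K"
  shows "grad f x = 0"
proof (rule grad_eqI)
  fix i
  have "open (- K)" using assms(1) by auto
  then obtain d where d: "d > 0" "ball x d \<subseteq> - K"
    using assms(3) open_contains_ball by blast
  have 0: "0 = f (x + t *\<^sub>R axis i 1)" if "dist t 0 < d" for t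
    using that d by (intro assms(2)[symmetric]) (auto simp: dist_norm subset_eq)
  have "((\<lambda>t. 0) has_real_derivative (0::real^'a) $ i) (at 0)" by simp
  then show "((\<lambda>t. f (x + t *\<^sub>R axis i 1)) has_real_derivative (0::real^'a) $ i) (at 0)"
    by (rule has_field_derivative_transform_within[OF _ d(1) UNIV_I 0])
qed

lemma test_fun_support:
  assumes "test_fun \<Omega> \<phi>"
  obtains K where "compact K" "K \<subseteq> \<Omega>" "\<And>x. x \<notin> K \<Longrightarrow> \<phi> x = 0" "\<And>x. x \<notin> K \<Longrightarrow> grad \<phi> x = 0"
proof -
  define K where "K = closure {x. \<phi> x \<noteq> 0}"
  have K: "compact K" "K \<subseteq> \<Omega>" using assms by (auto simp: test_fun_def K_def)
  have 0: "\<phi> x = 0" if "x \<notin> K" for x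
    using that closure_subset[of "{x. \<phi> x \<noteq> 0}"] unfolding K_def by blast
  have "grad \<phi> x = 0" if "x \<notin> K" for x
    using compact_imp_closed[OF K(1)] 0 that by (rule grad_eq_0_outside)
  with K 0 show ?thesis by (rule that)
qed

lemma test_fun_mono: "test_fun A \<phi> \<Longrightarrow> A \<subseteq> B \<Longrightarrow> test_fun B \<phi>"
  by (auto simp: test_fun_def)

lemma test_fun_zero: "test_fun \<Omega> (\<lambda>x. 0)"
  by (rule test_funI[of _ "{}"]) (auto intro: smooth_fun_const)

lemma test_fun_smooth_mult:
  assumes "smooth_fun h" "test_fun \<Omega> \<phi>" shows "test_fun \<Omega> (\<lambda>x. h x * \<phi> x)"
proof -
  obtain K where "compact K" "K \<subseteq> \<Omega>" "\<And>x. x \<notin> K \<Longrightarrow> \<phi> x = 0" using test_fun_support[OF assms(2)] by metis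
  then show ?thesis
    by (intro test_funI[of _ K] smooth_fun_mult assms test_fun_smooth[OF assms(2)]) auto
qed

lemma test_fun_cmult: "test_fun \<Omega> \<phi> \<Longrightarrow> test_fun \<Omega> (\<lambda>x. c * \<phi> x)"
  by (intro test_fun_smooth_mult smooth_fun_const)

lemma test_fun_add:
  assumes "test_fun \<Omega> f" "test_fun \<Omega> g" shows "test_fun \<Omega> (\<lambda>x. f x + g x)"
proof -
  obtain K L where "compact K" "K \<subseteq> \<Omega>" "\<And>x. x \<notin> K \<Longrightarrow> f x = 0"
    "compact L" "L \<subseteq> \<Omega>" "\<And>x. x \<notin> L \<Longrightarrow> g x = 0"
    using test_fun_support assms by metis
  then show ?thesis
    by (intro test_funI[of _ "K \<union> L"] smooth_fun_add assms[THEN test_fun_smooth] compact_Un) auto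
qed

lemma test_fun_diff:
  "test_fun \<Omega> f \<Longrightarrow> test_fun \<Omega> g \<Longrightarrow> test_fun \<Omega> (\<lambda>x. f x - g x)"
  using test_fun_add[of \<Omega> f "\<lambda>x. (-1) * g x"] test_fun_cmult[of \<Omega> g "-1"] by simp

lemma test_fun_sum:
  assumes "\<And>i. i \<in> I \<Longrightarrow> test_fun \<Omega> (f i)" shows "test_fun \<Omega> (\<lambda>x. \<Sum>i\<in>I. f i x)"
  using assms by (induction I rule: infinite_finite_induct) (auto intro: test_fun_zero test_fun_add)

lemma test_fun_translate:
  assumes "test_fun \<Omega> f" "\<And>x. h + x \<in> \<Omega> \<Longrightarrow> x \<in> \<Omega>"
  shows "test_fun \<Omega> (\<lambda>x. f (h + x))"
proof -
  obtain K where K: "compact K" "K \<subseteq> \<Omega>" "\<And>x. x \<notin> K \<Longrightarrow> f x = 0"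
    using test_fun_support[OF assms(1)] by metis
  show ?thesis
  proof (rule test_funI[of _ "(+) (- h) ` K"])
    show "smooth_fun (\<lambda>x. f (h + x))"
      by (intro smooth_fun_translate test_fun_smooth[OF assms(1)])
    show "compact ((+) (- h) ` K)" using K(1) by (rule compact_translation)
    show "(+) (- h) ` K \<subseteq> \<Omega>" using K(2) assms(2) by auto
    show "f (h + x) = 0" if "x \<notin> (+) (- h) ` K" for x
    proof (rule K(3))
      have "x = - h + (h + x)" by simp
      then show "h + x \<notin> K" using that by blast
    qed
  qed
qed

lemma test_fun_borel_measurable:
  assumes "test_fun \<Omega> \<phi>" shows "\<phi> \<in> borel_measurable borel" "grad \<phi> \<in> borel_measurable borel"
  using smooth_fun_continuous continuous_on_grad test_fun_smooth[OF assms]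
  by (blast intro: borel_measurable_continuous_onI)+

lemma integrable_compact_support:
  fixes f :: "'a::euclidean_space \<Rightarrow> real"
  assumes "continuous_on UNIV f" "compact K" "\<And>x. x \<notin> K \<Longrightarrow> f x = 0"
  shows "integrable lborel f"
proof -
  have "integrable lborel (\<lambda>x. indicator K x *\<^sub>R f x)"
    using assms by (intro borel_integrable_compact) (auto intro: continuous_on_subset)
  moreover have "(\<lambda>x. indicator K x *\<^sub>R f x) = f"
  proof
    show "indicator K x *\<^sub>R f x = f x" for x using assms(3)[of x] by (cases "x \<in> K") auto
  qed
  ultimately show ?thesis by simp
qed

lemma continuous_on_abs_powr:
  fixes f :: "'a::topological_space \<Rightarrow> real"
  assumes "continuous_on A f" "p > 0" shows "continuous_on A (\<lambda>x. \<bar>f x\<bar> powr p)"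
  using assms by (intro continuous_on_powr' continuous_intros) auto

lemma test_fun_integrable:
  assumes "test_fun \<Omega> \<phi>"
  shows "integrable lborel (\<lambda>x. (\<phi> x)\<^sup>2)" "integrable lborel (\<lambda>x. (norm (grad \<phi> x))\<^sup>2)"
    "p > 0 \<Longrightarrow> integrable lborel (\<lambda>x. \<bar>\<phi> x\<bar> powr p)"
proof -
  obtain K where K: "compact K" "\<And>x. x \<notin> K \<Longrightarrow> \<phi> x = 0" "\<And>x. x \<notin> K \<Longrightarrow> grad \<phi> x = 0"
    using test_fun_support[OF assms] by metis
  have c: "continuous_on UNIV \<phi>" "continuous_on UNIV (grad \<phi>)"
    using smooth_fun_continuous continuous_on_grad test_fun_smooth[OF assms] by blast+
  show "integrable lborel (\<lambda>x. (\<phi> x)\<^sup>2)" "integrable lborel (\<lambda>x. (norm (grad \<phi> x))\<^sup>2)"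
    using K by (auto intro!: integrable_compact_support[OF _ K(1)] continuous_intros c)
  show "integrable lborel (\<lambda>x. \<bar>\<phi> x\<bar> powr p)" if "p > 0"
    using K that by (auto intro!: integrable_compact_support[OF _ K(1)] continuous_on_abs_powr c)
qed

lemma test_fun_bounded:
  assumes "test_fun \<Omega> \<phi>"
  obtains C where "C > 0" "\<And>x. \<bar>\<phi> x\<bar> \<le> C" "\<And>x. norm (grad \<phi> x) \<le> C"
proof -
  obtain K where K: "compact K" "\<And>x. x \<notin> K \<Longrightarrow> \<phi> x = 0" "\<And>x. x \<notin> K \<Longrightarrow> grad \<phi> x = 0"
    using test_fun_support[OF assms] by metis
  have "continuous_on K \<phi>" "continuous_on K (grad \<phi>)"
    using smooth_fun_continuous continuous_on_grad test_fun_smooth[OF assms] by blast+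
  then have "bounded (\<phi> ` K)" "bounded (grad \<phi> ` K)"
    using K(1) by (auto intro!: compact_imp_bounded compact_continuous_image)
  then obtain B1 B2 where B: "\<And>x. x \<in> K \<Longrightarrow> \<bar>\<phi> x\<bar> \<le> B1" "\<And>x. x \<in> K \<Longrightarrow> norm (grad \<phi> x) \<le> B2"
    unfolding bounded_iff by (force simp: real_norm_def)
  show ?thesis
  proof (rule that[of "max (max B1 B2) 1"])
    show "\<bar>\<phi> x\<bar> \<le> max (max B1 B2) 1" "norm (grad \<phi> x) \<le> max (max B1 B2) 1" for x
      using B[of x] K(2,3)[of x] by (cases "x \<in> K"; simp add: le_max_iff_disj)+
  qed simp
qed

text \<open>The bump is a product over the coordinates of an increasing and a decreasing step, hence
  supported in a cube around \<open>c\<close>.\<close>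

lemma test_fun_exists:
  fixes \<Omega> :: "(real^'n::finite) set"
  assumes "open \<Omega>" "c \<in> \<Omega>"
  obtains \<phi> where "test_fun \<Omega> \<phi>" "\<phi> c > 0"
proof -
  obtain r where r: "r > 0" "cball c r \<subseteq> \<Omega>" using assms open_contains_cball by blast
  \<comment> \<open>A cube of half-width \<open>d\<close> lies in the ball of radius
    \<open>r\<close>, because the norm is at most the sum of the absolute values of the
    coordinates.\<close>
  define d where "d = r / real CARD('n)"
  have d: "d > 0" using r by (simp add: d_def)
  define \<phi> where "\<phi> x = (\<Prod>i\<in>UNIV. smooth_step (1 - (c $ i) / d + ((1 / d) *\<^sub>R axis i 1) \<bullet> x)
      * smooth_step (1 + (c $ i) / d + (- (1 / d) *\<^sub>R axis i 1) \<bullet> x))" for x :: "real^'n"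
  have eq: "\<phi> x = (\<Prod>i\<in>UNIV. smooth_step (1 + (x $ i - c $ i) / d) * smooth_step (1 - (x $ i - c $ i) / d))" for x
    unfolding \<phi>_def using d by (intro prod.cong) (auto simp: inner_axis' diff_divide_distrib algebra_simps)
  have "test_fun \<Omega> \<phi>"
  proof (rule test_funI)
    show "smooth_fun \<phi>" unfolding \<phi>_def[abs_def]
      by (intro smooth_fun_prod smooth_fun_mult smooth_fun_step)
    show "\<phi> x = 0" if "x \<notin> cball c r" for x
    proof -
      have "\<not> (\<forall>i. \<bar>(x - c) $ i\<bar> \<le> d)"
      proof
        assume "\<forall>i. \<bar>(x - c) $ i\<bar> \<le> d"
        then have "norm (x - c) \<le> (\<Sum>i\<in>(UNIV::'n set). d)"
          using norm_le_l1_cart[of "x - c"] by (meson sum_mono order_trans)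
        then show False using that by (simp add: d_def dist_norm norm_minus_commute)
      qed
      then obtain i where "\<not> \<bar>(x - c) $ i\<bar> \<le> d" by blast
      then have i: "\<bar>x $ i - c $ i\<bar> > d" by simp
      have "smooth_step (1 + (x $ i - c $ i) / d) * smooth_step (1 - (x $ i - c $ i) / d) = 0"
      proof (cases "x $ i - c $ i > 0")
        case True
        then have "1 - (x $ i - c $ i) / d \<le> 0" using i d by (simp add: field_simps)
        then show ?thesis by (simp add: smooth_step_eq_0)
      next
        case False
        then have "1 + (x $ i - c $ i) / d \<le> 0" using i d by (simp add: field_simps)
        then show ?thesis by (simp add: smooth_step_eq_0)
      qed
      then show ?thesis unfolding eq by (intro prod_zero) auto
    qed
  qed (use r in auto)
  moreover have "\<phi> c > 0" unfolding eq by (simp add: smooth_step_eq_1)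
  ultimately show ?thesis using that by blast
qed

section \<open>The subcritical Sobolev inequality\<close>

lemma borel_measurable_vec_nth' [measurable (raw)]:
  fixes f :: "'a \<Rightarrow> real^'n::finite"
  assumes "f \<in> borel_measurable M" shows "(\<lambda>x. f x $ i) \<in> borel_measurable M"
  by (rule measurable_compose[OF assms borel_measurable_continuous_onI])
    (intro continuous_intros)

lemma nn_integral_lborel_translate:
  assumes [measurable]: "f \<in> borel_measurable borel"
  shows "(\<integral>\<^sup>+ x. f (h + x) \<partial>lborel) = (\<integral>\<^sup>+ x. f x \<partial>lborel)"
proof -
  have "(\<integral>\<^sup>+ x. f x \<partial>lborel) = (\<integral>\<^sup>+ x. f x \<partial>distr lborel borel ((+) h))"
    by (simp add: lborel_distr_plus)
  also have "\<dots> = (\<integral>\<^sup>+ x. f (h + x) \<partial>lborel)"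
    by (rule nn_integral_distr) auto
  finally show ?thesis by simp
qed

text \<open>Cauchy-Schwarz against the indicator, read off from the nonnegative variance of
  \<open>g\<close> about its mean \<open>m\<close> on \<open>A\<close>.\<close>

lemma square_integral_indicator_le:
  fixes g :: "'a \<Rightarrow> real"
  assumes A: "A \<in> sets M" "emeasure M A < \<infinity>" "measure M A > 0"
    and g: "integrable M (\<lambda>x. indicator A x * g x)" "integrable M (\<lambda>x. indicator A x * (g x)\<^sup>2)"
  shows "(\<integral>x. indicator A x * g x \<partial>M)\<^sup>2 \<le> measure M A * (\<integral>x. indicator A x * (g x)\<^sup>2 \<partial>M)"
proof -
  define I where "I = (\<integral>x. indicator A x * g x \<partial>M)"
  define m where "m = I / measure M A"
  have i: "integrable M (\<lambda>x. indicator A x :: real)" using A by simp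
  have "0 \<le> (\<integral>x. indicator A x * (g x - m)\<^sup>2 \<partial>M)" by (intro integral_nonneg_AE) auto
  also have "(\<lambda>x. indicator A x * (g x - m)\<^sup>2) =
     (\<lambda>x. indicator A x * (g x)\<^sup>2 - (2 * m) * (indicator A x * g x) + m\<^sup>2 * indicator A x)"
    by (auto simp: power2_eq_square algebra_simps)
  also have "(\<integral>x. indicator A x * (g x)\<^sup>2 - (2 * m) * (indicator A x * g x) + m\<^sup>2 * indicator A x \<partial>M)
     = (\<integral>x. indicator A x * (g x)\<^sup>2 \<partial>M) - 2 * m * I + m\<^sup>2 * measure M A"
    using g i A by (simp add: I_def)
  finally have "0 \<le> measure M A * ((\<integral>x. indicator A x * (g x)\<^sup>2 \<partial>M) - 2 * m * I + m\<^sup>2 * measure M A)"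
    using A(3) by (intro mult_nonneg_nonneg) auto
  also have "\<dots> = measure M A * (\<integral>x. indicator A x * (g x)\<^sup>2 \<partial>M) - I\<^sup>2"
    using A(3) by (simp add: m_def power2_eq_square field_simps)
  finally show ?thesis by (simp add: I_def)
qed

text \<open>The increment is the integral of the directional derivative along the segment, to which
  Cauchy-Schwarz on \<open>{0..1}\<close> applies. The extended nonnegative form lets the inequality
  be integrated in \<open>x\<close> without integrability questions.\<close>

lemma increment_square_le:
  assumes "smooth_fun f"
  shows "ennreal ((f (x + h) - f x)\<^sup>2) \<le>
    ennreal ((norm h)\<^sup>2) * (\<integral>\<^sup>+ t. indicator {0..1::real} t * ennreal ((norm (grad f (x + t *\<^sub>R h)))\<^sup>2) \<partial>lborel)"
proof -
  define G where "G t = grad f (x + t *\<^sub>R h) \<bullet> h" for t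
  define H where "H t = norm (grad f (x + t *\<^sub>R h))" for t
  have cg: "continuous_on UNIV (\<lambda>t. grad f (x + t *\<^sub>R h))"
    by (intro continuous_on_compose2[OF continuous_on_grad[OF assms, of UNIV]] continuous_intros) auto
  then have cont: "continuous_on UNIV G" "continuous_on UNIV H"
    unfolding G_def H_def by (auto intro!: continuous_intros)
  have isC: "isCont G t" "isCont H t" for t using cont by (auto simp: continuous_on_eq_continuous_at)
  have int: "integrable lborel (\<lambda>t. indicator {0..1} t * G t)"
     "integrable lborel (\<lambda>t. indicator {0..1} t * (G t)\<^sup>2)"
     "integrable lborel (\<lambda>t. indicator {0..1} t * (H t)\<^sup>2)"
    using borel_integrable_atLeastAtMost[of 0 1 G] borel_integrable_atLeastAtMost[of 0 1 "\<lambda>t. (G t)\<^sup>2"]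
      borel_integrable_atLeastAtMost[of 0 1 "\<lambda>t. (H t)\<^sup>2"] isC
    by (auto simp: mult.commute intro!: continuous_intros)
  have "(\<integral>t. G t * indicator {0..1} t \<partial>lborel) = f (x + 1 *\<^sub>R h) - f (x + 0 *\<^sub>R h)"
    by (rule integral_FTC_Icc_real)
       (use isC smooth_fun_has_directional_derivative[OF assms, of x h, folded G_def] in auto)
  then have "f (x + h) - f x = (\<integral>t. indicator {0..1} t * G t \<partial>lborel)"
    by (simp add: mult.commute)
  then have "(f (x + h) - f x)\<^sup>2 \<le> (\<integral>t. indicator {0..1} t * (G t)\<^sup>2 \<partial>lborel)"
    using square_integral_indicator_le[of "{0..1::real}" lborel G] int by simp
  also have "\<dots> \<le> (\<integral>t. (norm h)\<^sup>2 * (indicator {0..1} t * (H t)\<^sup>2) \<partial>lborel)"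
  proof (rule integral_mono[OF int(2) integrable_mult_right])
    fix t
    have "(G t)\<^sup>2 \<le> (H t * norm h)\<^sup>2"
      unfolding G_def H_def using Cauchy_Schwarz_ineq2[of "grad f (x + t *\<^sub>R h)" h]
      by (metis abs_ge_zero power2_abs power_mono)
    then show "indicator {0..1} t * (G t)\<^sup>2 \<le> (norm h)\<^sup>2 * (indicator {0..1} t * (H t)\<^sup>2)"
      by (auto simp: indicator_def power_mult_distrib mult.commute)
  qed (use int in auto)
  also have "\<dots> = (norm h)\<^sup>2 * (\<integral>t. indicator {0..1} t * (H t)\<^sup>2 \<partial>lborel)" by simp
  finally have "ennreal ((f (x + h) - f x)\<^sup>2) \<le> ennreal ((norm h)\<^sup>2 * (\<integral>t. indicator {0..1} t * (H t)\<^sup>2 \<partial>lborel))"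
    by (rule ennreal_leI)
  also have "\<dots> = ennreal ((norm h)\<^sup>2) * (\<integral>\<^sup>+ t. ennreal (indicator {0..1} t * (H t)\<^sup>2) \<partial>lborel)"
    using int(3) by (subst nn_integral_eq_integral) (auto simp: ennreal_mult')
  finally show ?thesis
    by (simp add: H_def ennreal_mult' ennreal_indicator)
qed

text \<open>After exchanging the integrals in \<open>x\<close> and \<open>t\<close>, translation
  invariance makes the inner integral the same for all \<open>t\<close>.\<close>

lemma nn_integral_increment_le:
  fixes f :: "real^'n::finite \<Rightarrow> real"
  assumes f: "smooth_fun f"
  shows "(\<integral>\<^sup>+ x. ennreal ((f (x + h) - f x)\<^sup>2) \<partial>lborel) \<le>
    ennreal ((norm h)\<^sup>2) * (\<integral>\<^sup>+ x. ennreal ((norm (grad f x))\<^sup>2) \<partial>lborel)"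
proof -
  define g where "g y = ennreal ((norm (grad f y))\<^sup>2)" for y
  have [measurable]: "g \<in> borel_measurable borel"
    unfolding g_def using continuous_on_grad[OF f, THEN borel_measurable_continuous_onI] by measurable
  have "(\<integral>\<^sup>+ x. ennreal ((f (x + h) - f x)\<^sup>2) \<partial>lborel) \<le>
      (\<integral>\<^sup>+ x. ennreal ((norm h)\<^sup>2) * (\<integral>\<^sup>+ t. indicator {0..1::real} t * g (x + t *\<^sub>R h) \<partial>lborel) \<partial>lborel)"
    unfolding g_def by (intro nn_integral_mono increment_square_le f)
  also have "\<dots> = ennreal ((norm h)\<^sup>2) * (\<integral>\<^sup>+ x. (\<integral>\<^sup>+ t. indicator {0..1::real} t * g (x + t *\<^sub>R h) \<partial>lborel) \<partial>lborel)"
    by (rule nn_integral_cmult) measurable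
  also have "(\<integral>\<^sup>+ x. (\<integral>\<^sup>+ t. indicator {0..1::real} t * g (x + t *\<^sub>R h) \<partial>lborel) \<partial>lborel)
      = (\<integral>\<^sup>+ t. (\<integral>\<^sup>+ x. indicator {0..1::real} t * g (x + t *\<^sub>R h) \<partial>lborel) \<partial>lborel)"
    by (rule lborel_pair.Fubini') measurable
  also have "\<dots> = (\<integral>\<^sup>+ t. indicator {0..1::real} t * (\<integral>\<^sup>+ x. g x \<partial>lborel) \<partial>lborel)"
  proof (rule nn_integral_cong)
    fix t :: real
    have "(\<integral>\<^sup>+ x. indicator {0..1::real} t * g (x + t *\<^sub>R h) \<partial>lborel)
        = indicator {0..1::real} t * (\<integral>\<^sup>+ x. g (t *\<^sub>R h + x) \<partial>lborel)"
      by (subst nn_integral_cmult) (auto simp: add.commute)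
    then show "(\<integral>\<^sup>+ x. indicator {0..1::real} t * g (x + t *\<^sub>R h) \<partial>lborel) = indicator {0..1::real} t * (\<integral>\<^sup>+ x. g x \<partial>lborel)"
      by (simp add: nn_integral_lborel_translate)
  qed
  also have "\<dots> = (\<integral>\<^sup>+ x. g x \<partial>lborel)"
    by (subst nn_integral_multc) auto
  finally show ?thesis by (simp add: g_def)
qed

subsection \<open>Averages over a grid of cubes\<close>

text \<open>For \<open>r > 0\<close> this is the half-open cube of side \<open>r\<close> that
  contains \<open>x\<close> in the grid of multiples of \<open>r\<close>. Comparing floors makes
  sharing a cell an equivalence relation, so averages are constant on cells.\<close>

definition cell :: "real \<Rightarrow> real^'n::finite \<Rightarrow> (real^'n) set" where
  "cell r x = {y. \<forall>i. \<lfloor>y $ i / r\<rfloor> = \<lfloor>x $ i / r\<rfloor>}"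

definition cell_avg :: "real \<Rightarrow> (real^'n::finite \<Rightarrow> real) \<Rightarrow> real^'n \<Rightarrow> real" where
  "cell_avg r f x = (\<integral>y. indicator (cell r x) y * f y \<partial>lborel) / r ^ CARD('n)"

lemma cell_measurable [measurable]: "cell r x \<in> sets borel"
proof -
  have "{y \<in> space borel. \<forall>i. \<lfloor>y $ i / r\<rfloor> = \<lfloor>x $ i / r\<rfloor>} \<in> sets borel" by measurable
  then show ?thesis by (simp add: cell_def)
qed

lemma indicator_cell_measurable [measurable]:
  "(\<lambda>(x, y). indicator (cell r x) y :: real) \<in> borel_measurable (borel \<Otimes>\<^sub>M (borel :: (real^'n::finite) measure))"
proof -
  have "(\<lambda>(x, y). indicator (cell r x) y :: real) =
      (\<lambda>p. if (\<forall>i::'n. \<lfloor>snd p $ i / r\<rfloor> = \<lfloor>fst p $ i / r\<rfloor>) then 1 else 0)"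
    by (auto simp: fun_eq_iff cell_def indicator_def)
  moreover have "\<dots> \<in> borel_measurable (borel \<Otimes>\<^sub>M (borel :: (real^'n::finite) measure))"
    by measurable
  ultimately show ?thesis by simp
qed

text \<open>The cell lies between the open and the closed box with the same corners, and these have
  equal volume.\<close>

lemma emeasure_cell:
  fixes x :: "real^'n::finite"
  assumes "r > 0"
  shows "emeasure lborel (cell r x) = ennreal (r ^ CARD('n))"
proof -
  define a where "a = (\<chi> i. r * \<lfloor>x $ i / r\<rfloor>)"
  define b where "b = (\<chi> i. r * (\<lfloor>x $ i / r\<rfloor> + 1))"
  have 1: "box a b \<subseteq> cell r x"
  proof
    fix y assume y: "y \<in> box a b"
    show "y \<in> cell r x" unfolding cell_def
    proof (intro CollectI allI)
      fix i
      have "r * \<lfloor>x $ i / r\<rfloor> < y $ i" "y $ i < r * (\<lfloor>x $ i / r\<rfloor> + 1)"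
        using y by (auto simp: mem_box_cart a_def b_def)
      then show "\<lfloor>y $ i / r\<rfloor> = \<lfloor>x $ i / r\<rfloor>"
        using assms by (intro floor_unique) (auto simp: field_simps)
    qed
  qed
  have 2: "cell r x \<subseteq> cbox a b"
  proof
    fix y assume y: "y \<in> cell r x"
    have "r * \<lfloor>x $ i / r\<rfloor> \<le> y $ i \<and> y $ i \<le> r * (\<lfloor>x $ i / r\<rfloor> + 1)" for i
    proof -
      have "\<lfloor>y $ i / r\<rfloor> = \<lfloor>x $ i / r\<rfloor>" using y by (simp add: cell_def)
      then have "of_int \<lfloor>x $ i / r\<rfloor> \<le> y $ i / r" "y $ i / r < of_int \<lfloor>x $ i / r\<rfloor> + 1"
        by linarith+
      then show ?thesis using assms by (auto simp: field_simps)
    qed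
    then show "y \<in> cbox a b" by (auto simp: mem_box_cart a_def b_def)
  qed
  have ab: "\<forall>i\<in>Basis. a \<bullet> i \<le> b \<bullet> i"
    using assms by (auto simp: Basis_vec_def inner_axis a_def b_def)
  have "(\<Prod>i\<in>Basis. (b - a) \<bullet> i) = (\<Prod>i\<in>(Basis :: (real^'n) set). r)"
    by (intro prod.cong) (auto simp: Basis_vec_def inner_axis a_def b_def algebra_simps)
  then have P: "(\<Prod>i\<in>Basis. (b - a) \<bullet> i) = r ^ CARD('n)" by simp
  have "emeasure lborel (cell r x) \<le> emeasure lborel (cbox a b)"
    by (intro emeasure_mono 2) auto
  moreover have "emeasure lborel (box a b) \<le> emeasure lborel (cell r x)"
    by (intro emeasure_mono 1) auto
  ultimately show ?thesis
    using ab P emeasure_lborel_cbox[of a b] emeasure_lborel_box[of a b] by simp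
qed

lemma measure_cell: "r > 0 \<Longrightarrow> measure lborel (cell r (x :: real^'n::finite)) = r ^ CARD('n)"
  by (simp add: measure_def emeasure_cell)

lemma indicator_cell_integrable:
  fixes f :: "real^'n::finite \<Rightarrow> real"
  assumes "f \<in> borel_measurable borel" "\<And>x. \<bar>f x\<bar> \<le> C" "r > 0"
  shows "integrable lborel (\<lambda>y. indicator (cell r x) y * f y)"
proof (rule Bochner_Integration.integrable_bound)
  show "integrable lborel (\<lambda>y. C * indicator (cell r x) y)"
    using emeasure_cell[OF assms(3), of x] by (intro integrable_mult_right) simp
  show "AE y in lborel. norm (indicator (cell r x) y * f y) \<le> norm (C * indicator (cell r x) y)"
    using assms(2) by (intro AE_I2) (auto simp: indicator_def intro: order_trans[OF _ abs_ge_self])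
  show "(\<lambda>y. indicator (cell r x) y * f y) \<in> borel_measurable lborel"
    using assms(1) by measurable
qed

lemma cell_avg_measurable [measurable]:
  assumes [measurable]: "f \<in> borel_measurable borel"
  shows "cell_avg r f \<in> borel_measurable borel"
proof -
  have "(\<lambda>x. \<integral>y. (case (x, y) of (x, y) \<Rightarrow> indicator (cell r x) y) * f y \<partial>lborel) \<in> borel_measurable borel"
    by measurable
  then show ?thesis unfolding cell_avg_def[abs_def] by measurable
qed

text \<open>Cauchy-Schwarz on the cell bounds the error by the mean of the squared increments.
  Replacing the cell by the cube of all possible differences \<open>h\<close> makes the domain
  independent of \<open>x\<close>, as the later exchange of integrals requires.\<close>

lemma cell_avg_error_le:
  fixes f :: "real^'n::finite \<Rightarrow> real"
  assumes f: "f \<in> borel_measurable borel" "\<And>x. \<bar>f x\<bar> \<le> C" and r: "r > 0"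
  shows "ennreal ((f x - cell_avg r f x)\<^sup>2) \<le>
    ennreal (1 / r ^ CARD('n)) * (\<integral>\<^sup>+ h. indicator (cbox (\<chi> i. -r) (\<chi> i. r)) h * ennreal ((f (x + h) - f x)\<^sup>2) \<partial>lborel)"
proof -
  note [measurable] = f(1)
  let ?V = "r ^ CARD('n)"
  have V: "?V > 0" using r by simp
  have bd: "\<bar>f y - f x\<bar> \<le> 2 * C" for y using f(2)[of x] f(2)[of y] by linarith
  have bd2: "\<bar>(f y - f x)\<^sup>2\<bar> \<le> (2 * C)\<^sup>2" for y
    using power_mono[OF bd[of y], of 2] by simp
  have i1: "integrable lborel (\<lambda>y. indicator (cell r x) y * (f y - f x))"
    by (rule indicator_cell_integrable[OF _ bd r]) measurable
  have i2: "integrable lborel (\<lambda>y. indicator (cell r x) y * (f y - f x)\<^sup>2)"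
    by (rule indicator_cell_integrable[OF _ bd2 r]) measurable
  have i3: "integrable lborel (\<lambda>y. indicator (cell r x) y * f y)"
    by (rule indicator_cell_integrable[OF f r])
  have i4: "integrable lborel (\<lambda>y. indicator (cell r x) y * f x)"
    using f(2)[of x] by (intro indicator_cell_integrable[OF _ _ r]) auto
  have "(\<integral>y. indicator (cell r x) y * (f y - f x) \<partial>lborel)
      = (\<integral>y. indicator (cell r x) y * f y - indicator (cell r x) y * f x \<partial>lborel)"
    by (simp add: right_diff_distrib)
  also have "\<dots> = (\<integral>y. indicator (cell r x) y * f y \<partial>lborel) - ?V * f x"
    using i3 i4 by (simp add: measure_cell[OF r])
  finally have E: "(\<integral>y. indicator (cell r x) y * (f y - f x) \<partial>lborel)
      = (\<integral>y. indicator (cell r x) y * f y \<partial>lborel) - ?V * f x" .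
  have "cell_avg r f x - f x = (\<integral>y. indicator (cell r x) y * (f y - f x) \<partial>lborel) / ?V"
    unfolding cell_avg_def E using r by (simp add: diff_divide_distrib)
  then have "(f x - cell_avg r f x)\<^sup>2 = (\<integral>y. indicator (cell r x) y * (f y - f x) \<partial>lborel)\<^sup>2 / ?V\<^sup>2"
    by (simp only: power2_commute[of "f x"] power_divide)
  also have "\<dots> \<le> (?V * (\<integral>y. indicator (cell r x) y * (f y - f x)\<^sup>2 \<partial>lborel)) / ?V\<^sup>2"
    using square_integral_indicator_le[of "cell r x" lborel "\<lambda>y. f y - f x"] i1 i2 V
    by (intro divide_right_mono) (auto simp: measure_cell[OF r] emeasure_cell[OF r])
  also have "\<dots> = 1 / ?V * (\<integral>y. indicator (cell r x) y * (f y - f x)\<^sup>2 \<partial>lborel)"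
    using V by (simp add: power2_eq_square)
  finally have "ennreal ((f x - cell_avg r f x)\<^sup>2) \<le> ennreal (1 / ?V * (\<integral>y. indicator (cell r x) y * (f y - f x)\<^sup>2 \<partial>lborel))"
    by (rule ennreal_leI)
  also have "\<dots> = ennreal (1 / ?V) * (\<integral>\<^sup>+ y. ennreal (indicator (cell r x) y * (f y - f x)\<^sup>2) \<partial>lborel)"
    using i2 r by (subst nn_integral_eq_integral) (auto simp: ennreal_mult'[symmetric])
  also have "(\<integral>\<^sup>+ y. ennreal (indicator (cell r x) y * (f y - f x)\<^sup>2) \<partial>lborel)
     = (\<integral>\<^sup>+ h. ennreal (indicator (cell r x) (x + h) * (f (x + h) - f x)\<^sup>2) \<partial>lborel)"
    by (rule nn_integral_lborel_translate[symmetric]) measurable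
  also have "\<dots> \<le> (\<integral>\<^sup>+ h. indicator (cbox (\<chi> i. -r) (\<chi> i. r)) h * ennreal ((f (x + h) - f x)\<^sup>2) \<partial>lborel)"
  proof (intro nn_integral_mono)
    fix h :: "real^'n"
    have "h \<in> cbox (\<chi> i. -r) (\<chi> i. r)" if h: "x + h \<in> cell r x"
    proof -
      have "- r \<le> h $ i \<and> h $ i \<le> r" for i
      proof -
        have "\<lfloor>x $ i / r + h $ i / r\<rfloor> = \<lfloor>x $ i / r\<rfloor>"
          using h by (simp add: cell_def add_divide_distrib)
        then have "\<bar>h $ i / r\<bar> < 1" by linarith
        then show ?thesis using r by (auto simp: abs_less_iff field_simps)
      qed
      then show ?thesis by (simp add: mem_box_cart)
    qed
    then show "ennreal (indicator (cell r x) (x + h) * (f (x + h) - f x)\<^sup>2) \<le>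
        indicator (cbox (\<chi> i. -r) (\<chi> i. r)) h * ennreal ((f (x + h) - f x)\<^sup>2)"
      by (auto simp: indicator_def)
  qed
  finally show ?thesis by (simp add: mult_left_mono)
qed

text \<open>The cube of differences has volume \<open>(2 * r) ^ CARD('n)\<close> against the cell
  volume \<open>r ^ CARD('n)\<close>, whence the power of 2; the bound
  \<open>norm h \<le> CARD('n) * r\<close> gives the remaining factors.\<close>

lemma nn_integral_cell_avg_error_le:
  fixes f :: "real^'n::finite \<Rightarrow> real"
  assumes f: "smooth_fun f" "\<And>x. \<bar>f x\<bar> \<le> C" and r: "r > 0"
  shows "(\<integral>\<^sup>+ x. ennreal ((f x - cell_avg r f x)\<^sup>2) \<partial>lborel) \<le>
    ennreal (2 ^ CARD('n) * (real CARD('n))\<^sup>2 * r\<^sup>2) * (\<integral>\<^sup>+ x. ennreal ((norm (grad f x))\<^sup>2) \<partial>lborel)"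
proof -
  have reassoc: "ennreal u * (ennreal v * X * ennreal w) = ennreal (u * v * w) * X"
    if "u \<ge> 0" "v \<ge> 0" "w \<ge> 0" for u v w X
    using that by (simp add: ennreal_mult mult_ac)
  have [measurable]: "f \<in> borel_measurable borel"
    by (intro borel_measurable_continuous_onI smooth_fun_continuous f)
  let ?V = "r ^ CARD('n)"
  let ?B = "cbox (\<chi> i. -r) (\<chi> i. r) :: (real^'n) set"
  let ?E = "\<integral>\<^sup>+ x. ennreal ((norm (grad f x))\<^sup>2) \<partial>lborel"
  have "(\<integral>\<^sup>+ x. ennreal ((f x - cell_avg r f x)\<^sup>2) \<partial>lborel) \<le>
    (\<integral>\<^sup>+ x. ennreal (1 / ?V) * (\<integral>\<^sup>+ h. indicator ?B h * ennreal ((f (x + h) - f x)\<^sup>2) \<partial>lborel) \<partial>lborel)"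
    by (intro nn_integral_mono cell_avg_error_le[OF _ f(2) r]) measurable
  also have "\<dots> = ennreal (1 / ?V) * (\<integral>\<^sup>+ x. (\<integral>\<^sup>+ h. indicator ?B h * ennreal ((f (x + h) - f x)\<^sup>2) \<partial>lborel) \<partial>lborel)"
    by (rule nn_integral_cmult) measurable
  also have "(\<integral>\<^sup>+ x. (\<integral>\<^sup>+ h. indicator ?B h * ennreal ((f (x + h) - f x)\<^sup>2) \<partial>lborel) \<partial>lborel)
     = (\<integral>\<^sup>+ h. (\<integral>\<^sup>+ x. indicator ?B h * ennreal ((f (x + h) - f x)\<^sup>2) \<partial>lborel) \<partial>lborel)"
    by (rule lborel_pair.Fubini') measurable
  also have "\<dots> \<le> (\<integral>\<^sup>+ h. (ennreal ((real CARD('n) * r)\<^sup>2) * ?E) * indicator ?B h \<partial>lborel)"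
  proof (intro nn_integral_mono)
    fix h :: "real^'n"
    have "(\<integral>\<^sup>+ x. indicator ?B h * ennreal ((f (x + h) - f x)\<^sup>2) \<partial>lborel)
       = indicator ?B h * (\<integral>\<^sup>+ x. ennreal ((f (x + h) - f x)\<^sup>2) \<partial>lborel)"
      by (rule nn_integral_cmult) measurable
    also have "\<dots> \<le> indicator ?B h * (ennreal ((real CARD('n) * r)\<^sup>2) * ?E)"
    proof (cases "h \<in> ?B")
      case True
      then have "\<bar>h $ i\<bar> \<le> r" for i by (simp add: mem_box_cart abs_le_iff) (smt (verit))
      then have "(\<Sum>i\<in>UNIV. \<bar>h $ i\<bar>) \<le> (\<Sum>i\<in>(UNIV::'n set). r)" by (intro sum_mono)
      then have "norm h \<le> real CARD('n) * r"
        using norm_le_l1_cart[of h] by simp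
      then have "ennreal ((norm h)\<^sup>2) \<le> ennreal ((real CARD('n) * r)\<^sup>2)"
        by (intro ennreal_leI power_mono) auto
      from order_trans[OF nn_integral_increment_le[OF f(1), of h] mult_right_mono[OF this]]
      show ?thesis by (intro mult_left_mono) auto
    qed simp
    finally show "(\<integral>\<^sup>+ x. indicator ?B h * ennreal ((f (x + h) - f x)\<^sup>2) \<partial>lborel)
       \<le> (ennreal ((real CARD('n) * r)\<^sup>2) * ?E) * indicator ?B h" by (simp add: mult.commute)
  qed
  also have "\<dots> = (ennreal ((real CARD('n) * r)\<^sup>2) * ?E) * emeasure lborel ?B"
    by (rule nn_integral_cmult_indicator) auto
  also have "emeasure lborel ?B = ennreal ((2 * r) ^ CARD('n))"
  proof -
    have "\<forall>i\<in>Basis. (\<chi> i. -r) \<bullet> i \<le> (\<chi> i. r :: real^'n) \<bullet> i"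
      using r by (auto simp: Basis_vec_def inner_axis)
    moreover have "(\<Prod>i\<in>Basis. ((\<chi> i. r) - (\<chi> i. -r) :: real^'n) \<bullet> i) = (\<Prod>i\<in>(Basis :: (real^'n) set). 2 * r)"
      by (intro prod.cong) (auto simp: Basis_vec_def inner_axis)
    ultimately show ?thesis by (subst emeasure_lborel_cbox) auto
  qed
  also have "ennreal (1 / ?V) * (ennreal ((real CARD('n) * r)\<^sup>2) * ?E * ennreal ((2 * r) ^ CARD('n)))
     = ennreal (1 / ?V * (real CARD('n) * r)\<^sup>2 * (2 * r) ^ CARD('n)) * ?E"
    using r by (intro reassoc) auto
  also have "1 / ?V * (real CARD('n) * r)\<^sup>2 * (2 * r) ^ CARD('n) = 2 ^ CARD('n) * (real CARD('n))\<^sup>2 * r\<^sup>2"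
    using r by (simp add: power_mult_distrib)
  finally show ?thesis by (simp add: mult_left_mono)
qed

subsection \<open>Bootstrapping the exponent\<close>

definition dirichlet :: "(real^'n::finite \<Rightarrow> real) \<Rightarrow> real" where
  "dirichlet f = (\<integral>x. (norm (grad f x))\<^sup>2 \<partial>lborel)"

definition power_mass :: "real \<Rightarrow> (real^'n::finite \<Rightarrow> real) \<Rightarrow> real" where
  "power_mass p f = (\<integral>x. \<bar>f x\<bar> powr p \<partial>lborel)"

text \<open>Only functions normalized in \<open>L^2\<close> and in energy are considered; rescaling
  recovers the general case. The first argument carries nothing but the dimension, through its
  type.\<close>

definition sobolev_bound :: "'n::finite itself \<Rightarrow> real \<Rightarrow> bool" where
  "sobolev_bound _ q \<longleftrightarrow> (\<exists>C. \<forall>f :: real^'n \<Rightarrow> real. test_fun UNIV f \<and> power_mass 2 f \<le> 1 \<and>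
     dirichlet f \<le> 1 \<longrightarrow> power_mass q f \<le> C)"

lemma dirichlet_nonneg: "dirichlet f \<ge> 0"
  unfolding dirichlet_def by (intro integral_nonneg_AE) auto

lemma power_mass_nonneg: "power_mass p f \<ge> 0"
  unfolding power_mass_def by (intro integral_nonneg_AE) auto

lemma abs_powr_2: "\<bar>x::real\<bar> powr 2 = x\<^sup>2"
  by (cases "x = 0") (auto simp: powr_numeral)

lemma nn_integral_dirichlet:
  assumes "test_fun \<Omega> f"
  shows "(\<integral>\<^sup>+ x. ennreal ((norm (grad f x))\<^sup>2) \<partial>lborel) = ennreal (dirichlet f)"
  unfolding dirichlet_def by (rule nn_integral_eq_integral) (auto intro: test_fun_integrable[OF assms])

lemma nn_integral_power_mass:
  assumes "test_fun \<Omega> f" "p > 0"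
  shows "(\<integral>\<^sup>+ x. ennreal (\<bar>f x\<bar> powr p) \<partial>lborel) = ennreal (power_mass p f)"
  unfolding power_mass_def
  by (rule nn_integral_eq_integral) (auto intro: test_fun_integrable[OF assms(1)] assms(2))

text \<open>Above the level, \<open>|t| = |t| powr q * |t| powr (1 - q)\<close>, and the last factor
  does not increase with \<open>|t|\<close>.\<close>

lemma abs_le_level_plus_powr:
  fixes t l q :: real
  assumes "l > 0" "q \<ge> 1" shows "\<bar>t\<bar> \<le> l + \<bar>t\<bar> powr q * l powr (1 - q)"
proof (cases "\<bar>t\<bar> \<le> l")
  case False
  then have t: "\<bar>t\<bar> > 0" using assms by linarith
  have "\<bar>t\<bar> powr 1 = \<bar>t\<bar> powr q * \<bar>t\<bar> powr (1 - q)"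
    by (subst powr_add[symmetric]) simp
  also have "\<dots> \<le> \<bar>t\<bar> powr q * l powr (1 - q)"
    using assms False by (intro mult_left_mono powr_mono2') auto
  finally show ?thesis using t assms(1) by simp
qed (simp add: add_increasing2)

text \<open>Values below \<open>l\<close> contribute at most \<open>l\<close> to the average, and
  the excess at most \<open>M * l powr (1 - q)\<close> divided by the cell volume. The side
  \<open>r\<close> is chosen so that the second contribution is \<open>l\<close> as well.\<close>

lemma abs_cell_avg_le:
  fixes f :: "real^'n::finite \<Rightarrow> real"
  assumes f: "test_fun UNIV f" and q: "q \<ge> 1" and M: "power_mass q f \<le> M" "M > 0"
    and l: "l > 0" and r: "r ^ CARD('n) = M * l powr (-q)" "r > 0"
  shows "\<bar>cell_avg r f x\<bar> \<le> 2 * l"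
proof -
  let ?V = "r ^ CARD('n)"
  have V: "?V > 0" by (rule zero_less_power[OF r(2)])
  obtain C where C: "\<And>x. \<bar>f x\<bar> \<le> C" using test_fun_bounded[OF f] by metis
  have meas [measurable]: "f \<in> borel_measurable borel" by (rule test_fun_borel_measurable[OF f])
  have i1: "integrable lborel (\<lambda>y. indicator (cell r x) y * f y)"
    by (rule indicator_cell_integrable[OF meas C r(2)])
  have i2: "integrable lborel (\<lambda>y. l * indicator (cell r x) y)"
    using emeasure_cell[OF r(2), of x] by (intro integrable_mult_right) simp
  have i3: "integrable lborel (\<lambda>y. \<bar>f y\<bar> powr q * l powr (1 - q))"
    using q by (intro integrable_mult_left test_fun_integrable[OF f]) auto
  have "\<bar>\<integral>y. indicator (cell r x) y * f y \<partial>lborel\<bar> \<le> (\<integral>y. \<bar>indicator (cell r x) y * f y\<bar> \<partial>lborel)"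
    by (rule integral_abs_bound)
  also have "\<dots> \<le> (\<integral>y. l * indicator (cell r x) y + \<bar>f y\<bar> powr q * l powr (1 - q) \<partial>lborel)"
    using abs_le_level_plus_powr[OF l q]
    by (intro integral_mono Bochner_Integration.integrable_add integrable_abs i1 i2 i3)
      (auto simp: indicator_def)
  also have "\<dots> = l * ?V + power_mass q f * l powr (1 - q)"
    unfolding power_mass_def using i2 i3 by (simp add: measure_cell[OF r(2)])
  also have "\<dots> \<le> l * ?V + M * l powr (1 - q)"
    using M by (intro add_left_mono mult_right_mono) auto
  also have "M * l powr (1 - q) = l * ?V"
    unfolding r(1) using l by (simp add: powr_diff powr_minus field_simps)
  finally have "\<bar>\<integral>y. indicator (cell r x) y * f y \<partial>lborel\<bar> \<le> 2 * l * ?V" by simp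
  then show ?thesis
    unfolding cell_avg_def abs_divide using V r(2) by (simp add: field_simps)
qed

lemma dyadic_level:
  fixes t :: real assumes "t > 1" obtains k :: nat where "2 ^ k < t" "t \<le> 2 ^ Suc k"
proof -
  obtain n where n: "t < 2 ^ n" using real_arch_pow[of 2 t] by auto
  define m where "m = (LEAST n. t \<le> 2 ^ n)"
  have m: "t \<le> 2 ^ m" unfolding m_def by (rule LeastI[of _ n]) (use n in simp)
  have "m \<noteq> 0" using m assms by (intro notI) simp
  then obtain k where k: "m = Suc k" using not0_implies_Suc by blast
  have "\<not> t \<le> 2 ^ k" using not_less_Least[of k "\<lambda>n. t \<le> 2 ^ n"] k unfolding m_def by simp
  then show ?thesis using that[of k] m k by simp
qed

text \<open>On the level set where \<open>2^k < |f| \<le> 2^(k+1)\<close> the average over cubes of a suitable size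
  is at most half of \<open>|f|\<close>, so that \<open>|f|\<close> is controlled by the \<open>L^2\<close>-small averaging error.\<close>

lemma sobolev_bound_improve:
  fixes q q' :: real
  assumes q: "2 \<le> q" "2 < q'" "q' < 2 + 2 * q / real CARD('n::finite)"
    and sob: "sobolev_bound TYPE('n) q"
  shows "sobolev_bound TYPE('n) q'"
proof -
  let ?N = "real CARD('n)"
  obtain C0 where C0: "\<And>f :: real^'n \<Rightarrow> real. test_fun UNIV f \<Longrightarrow> power_mass 2 f \<le> 1 \<Longrightarrow>
     dirichlet f \<le> 1 \<Longrightarrow> power_mass q f \<le> C0" using sob unfolding sobolev_bound_def by blast
  define M where "M = max C0 1"
  have M: "M > 0" by (simp add: M_def)
  \<comment> \<open>The divisor 4 makes the cell averages at most
    \<open>2 * l k = 2 ^ k / 2\<close>, less than half of \<open>|f|\<close> where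
    \<open>|f| > 2 ^ k\<close>.\<close>
  define l where "l k = 2 ^ k / (4::real)" for k :: nat
  define r where "r k = (M * l k powr (-q)) powr (1 / ?N)" for k
  define c where "c k = (2 ^ Suc k) powr (q' - 2) * (4 * (2 ^ CARD('n) * ?N\<^sup>2 * (r k)\<^sup>2))" for k
  \<comment> \<open>Ratio of consecutive levels: the values, up to \<open>2 ^ Suc k\<close>,
    contribute \<open>2 powr (q' - 2)\<close>, and the shrinking cells, through
    \<open>(r k)\<^sup>2\<close>, contribute \<open>2 powr (- 2 * q / N)\<close>. The ratio is below
    1 exactly for \<open>q' < 2 + 2 * q / N\<close>.\<close>
  define \<rho> where "\<rho> = 2 powr (q' - 2 - 2 * q / ?N)"
  define A where "A = 2 powr (q' - 2) * (4 * (2 ^ CARD('n) * ?N\<^sup>2)) * (M powr (2 / ?N) * 4 powr (2 * q / ?N))"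
  have l: "l k > 0" for k by (simp add: l_def)
  have r: "r k > 0" "r k ^ CARD('n) = M * l k powr (-q)" for k
    using M l[of k] by (auto simp: r_def powr_realpow[symmetric] powr_powr)
  have c: "c k = A * \<rho> ^ k" for k
  proof -
    have "(r k)\<^sup>2 = (M * l k powr (-q)) powr (2 / ?N)"
      using M l[of k] by (simp add: r_def powr_realpow[symmetric] powr_powr)
    also have "\<dots> = M powr (2 / ?N) * l k powr (- (2 * q / ?N))"
      using M l[of k] by (simp add: powr_mult powr_powr mult.commute)
    also have "l k = 2 powr (real k) / 4" by (simp add: l_def powr_realpow)
    also have "(2 powr (real k) / 4) powr (- (2 * q / ?N)) = 2 powr (real k * (- (2 * q / ?N))) * 4 powr (2 * q / ?N)"
      by (simp add: powr_divide powr_powr powr_minus field_simps)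
    finally have rk: "(r k)\<^sup>2 = M powr (2 / ?N) * (2 powr (real k * (- (2 * q / ?N))) * 4 powr (2 * q / ?N))" .
    have "(2 ^ Suc k) powr (q' - 2) = (2 powr (1 + real k)) powr (q' - 2)"
      using powr_realpow[of 2 "Suc k"] by simp
    also have "\<dots> = 2 powr (q' - 2) * 2 powr (real k * (q' - 2))"
      by (simp add: powr_powr powr_add[symmetric] algebra_simps)
    finally have pk: "(2 ^ Suc k) powr (q' - 2) = 2 powr (q' - 2) * 2 powr (real k * (q' - 2))" .
    have "\<rho> ^ k = 2 powr (real k * (q' - 2)) * 2 powr (real k * (- (2 * q / ?N)))"
      by (simp add: \<rho>_def powr_realpow[symmetric] powr_powr powr_add[symmetric] algebra_simps)
    then show ?thesis unfolding c_def A_def rk pk by (simp only: mult_ac)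
  qed
  have "\<rho> < 1" using q unfolding \<rho>_def by (simp add: powr_less_one)
  moreover have "\<rho> > 0" by (simp add: \<rho>_def)
  ultimately have sm: "summable c" unfolding c[abs_def] by (intro summable_mult summable_geometric) auto
  have cpos: "c k \<ge> 0" for k by (simp add: c_def)
  have "power_mass q' f \<le> 1 + suminf c" if f: "test_fun UNIV f" "power_mass 2 f \<le> 1" "dirichlet f \<le> 1"
    for f :: "real^'n \<Rightarrow> real"
  proof -
    have Mf: "power_mass q f \<le> M" using C0[OF f] by (simp add: M_def)
    have [measurable]: "f \<in> borel_measurable borel" by (rule test_fun_borel_measurable[OF f(1)])
    obtain C where C: "\<And>x. \<bar>f x\<bar> \<le> C" using test_fun_bounded[OF f(1)] by metis
    define T where "T k x = ennreal ((2 ^ Suc k) powr (q' - 2) * 4) * ennreal ((f x - cell_avg (r k) f x)\<^sup>2)" for k x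
    have Tm [measurable]: "T k \<in> borel_measurable borel" for k unfolding T_def[abs_def] by measurable
    \<comment> \<open>Where \<open>|f| \<le> 1\<close> the square dominates; elsewhere the point
      lies in one dyadic level \<open>k\<close>, and the error term \<open>T k\<close> of that level
      alone suffices.\<close>
    have pt: "ennreal (\<bar>f x\<bar> powr q') \<le> ennreal (\<bar>f x\<bar> powr 2) + (\<Sum>k. T k x)" for x
    proof (cases "\<bar>f x\<bar> \<le> 1")
      case True
      have "\<bar>f x\<bar> powr q' \<le> \<bar>f x\<bar> powr 2"
        using True q by (intro powr_mono') auto
      then have "ennreal (\<bar>f x\<bar> powr q') \<le> ennreal (\<bar>f x\<bar> powr 2)" by (rule ennreal_leI)
      then show ?thesis by (rule add_increasing2[rotated]) simp
    next
      case False
      then obtain k where k: "2 ^ k < \<bar>f x\<bar>" "\<bar>f x\<bar> \<le> 2 ^ Suc k" using dyadic_level[of "\<bar>f x\<bar>"] by auto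
      have "\<bar>cell_avg (r k) f x\<bar> \<le> 2 * l k"
        using q by (intro abs_cell_avg_le[OF f(1) _ Mf M l r(2) r(1)]) auto
      then have "\<bar>f x\<bar> \<le> 2 * \<bar>f x - cell_avg (r k) f x\<bar>"
        using k(1) abs_triangle_ineq2[of "f x" "cell_avg (r k) f x"] by (simp add: l_def)
      then have "\<bar>f x\<bar>\<^sup>2 \<le> (2 * \<bar>f x - cell_avg (r k) f x\<bar>)\<^sup>2" by (rule power_mono) simp
      then have sq: "(f x)\<^sup>2 \<le> 4 * (f x - cell_avg (r k) f x)\<^sup>2" by (simp add: power_mult_distrib)
      have "\<bar>f x\<bar> powr q' = \<bar>f x\<bar> powr (q' - 2) * (f x)\<^sup>2"
        using powr_add[of "\<bar>f x\<bar>" "q' - 2" 2] by (simp add: abs_powr_2)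
      also have "\<dots> \<le> (2 ^ Suc k) powr (q' - 2) * (4 * (f x - cell_avg (r k) f x)\<^sup>2)"
        using k q sq by (intro mult_mono powr_mono2) auto
      finally have "ennreal (\<bar>f x\<bar> powr q') \<le> T k x"
        unfolding T_def by (subst ennreal_mult'[symmetric]) (auto intro!: ennreal_leI simp: mult.assoc)
      also have "T k x \<le> (\<Sum>k. T k x)"
        using sum_le_suminf[of "\<lambda>k. T k x" "{k}"] by simp
      finally show ?thesis by (rule add_increasing[rotated]) simp
    qed
    have Tint: "(\<integral>\<^sup>+ x. T k x \<partial>lborel) \<le> ennreal (c k)" for k
    proof -
      have "(\<integral>\<^sup>+ x. T k x \<partial>lborel) = ennreal ((2 ^ Suc k) powr (q' - 2) * 4) *
          (\<integral>\<^sup>+ x. ennreal ((f x - cell_avg (r k) f x)\<^sup>2) \<partial>lborel)"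
        unfolding T_def by (rule nn_integral_cmult) measurable
      also have "\<dots> \<le> ennreal ((2 ^ Suc k) powr (q' - 2) * 4) *
          (ennreal (2 ^ CARD('n) * ?N\<^sup>2 * (r k)\<^sup>2) * ennreal (dirichlet f))"
        using nn_integral_cell_avg_error_le[OF test_fun_smooth[OF f(1)] C r(1), of k]
        by (intro mult_left_mono) (auto simp: nn_integral_dirichlet[OF f(1)])
      also have "\<dots> \<le> ennreal ((2 ^ Suc k) powr (q' - 2) * 4) *
          (ennreal (2 ^ CARD('n) * ?N\<^sup>2 * (r k)\<^sup>2) * 1)"
        using f(3) by (intro mult_left_mono) (auto simp: ennreal_le_1)
      also have "\<dots> = ennreal (c k)"
        unfolding c_def by (simp add: ennreal_mult'[symmetric] mult.assoc)
      finally show ?thesis .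
    qed
    have "ennreal (power_mass q' f) = (\<integral>\<^sup>+ x. ennreal (\<bar>f x\<bar> powr q') \<partial>lborel)"
      using q by (intro nn_integral_power_mass[OF f(1), symmetric]) auto
    also have "\<dots> \<le> (\<integral>\<^sup>+ x. ennreal (\<bar>f x\<bar> powr 2) + (\<Sum>k. T k x) \<partial>lborel)"
      by (intro nn_integral_mono pt)
    also have "\<dots> = ennreal (power_mass 2 f) + (\<Sum>k. \<integral>\<^sup>+ x. T k x \<partial>lborel)"
      by (subst nn_integral_add) (auto simp: nn_integral_suminf nn_integral_power_mass[OF f(1), symmetric])
    also have "\<dots> \<le> 1 + (\<Sum>k. ennreal (c k))"
      using f(2) by (intro add_mono suminf_le Tint) (auto simp: ennreal_le_1)
    also have "(\<Sum>k. ennreal (c k)) = ennreal (suminf c)"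
      by (rule suminf_ennreal_eq[OF cpos summable_sums[OF sm]])
    also have "1 + ennreal (suminf c) = ennreal (1 + suminf c)"
      using suminf_nonneg[OF sm cpos] by (simp add: ennreal_plus)
    finally show ?thesis
      using suminf_nonneg[OF sm cpos] by (subst (asm) ennreal_le_iff) auto
  qed
  then show ?thesis unfolding sobolev_bound_def by blast
qed

text \<open>Continuity argument in the exponent: at the supremum \<open>s\<close> of the exponents
  up to \<open>p\<close> already obtained, the improvement started from a nearby \<open>q\<close>
  would pass beyond \<open>s\<close>, unless it reaches \<open>p\<close>.\<close>

theorem sobolev_subcritical:
  fixes p :: real
  assumes N: "CARD('n::finite) \<ge> 3" and p: "2 \<le> p" "p < 2 * real CARD('n) / (real CARD('n) - 2)"
  shows "sobolev_bound TYPE('n) p"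
proof -
  let ?N = "real CARD('n)"
  define Q where "Q = {q. 2 \<le> q \<and> q \<le> p \<and> sobolev_bound TYPE('n) q}"
  have 2: "2 \<in> Q" using p by (auto simp: Q_def sobolev_bound_def)
  have bdd: "bdd_above Q" by (auto simp: Q_def bdd_above_def)
  define s where "s = Sup Q"
  have "2 \<le> s" unfolding s_def by (rule cSup_upper[OF 2 bdd])
  moreover have "s \<le> p"
    unfolding s_def by (rule cSup_least) (use 2 in \<open>auto simp: Q_def\<close>)
  ultimately have s: "2 \<le> s" "s \<le> p" by blast+
  have "s * (?N - 2) < 2 * ?N"
  proof -
    have "s * (?N - 2) \<le> p * (?N - 2)" using s N by (intro mult_right_mono) auto
    also have "\<dots> < 2 * ?N" using p N by (simp add: field_simps)
    finally show ?thesis .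
  qed
  \<comment> \<open>This is \<open>s < 2 * N / (N - 2)\<close>, rewritten so that an exponent
    \<open>q\<close> in \<open>Q\<close> close enough to \<open>s\<close> satisfies
    \<open>s < 2 + 2 * q / N\<close>.\<close>
  then have gap: "(s - 2) * ?N / 2 < s" using N by (simp add: field_simps)
  then obtain q where q: "q \<in> Q" "q > (s - 2) * ?N / 2"
    using less_cSupD[of Q "(s - 2) * ?N / 2"] 2 unfolding s_def by blast
  then have up: "s < 2 + 2 * q / ?N" using N by (simp add: field_simps)
  show ?thesis
  proof (cases "p = 2")
    case True then show ?thesis using 2 by (simp add: Q_def)
  next
    case False
    \<comment> \<open>The midpoint lies strictly between \<open>s\<close> and the limit of the
      improvement step; it is capped at \<open>p\<close>.\<close>
    define q' where "q' = min p ((s + (2 + 2 * q / ?N)) / 2)"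
    have q2: "2 \<le> q" using q by (simp add: Q_def)
    have "2 < q'" using False p s up q2 by (auto simp: q'_def min_def)
    moreover have "q' < 2 + 2 * q / ?N" using up by (auto simp: q'_def min_def)
    ultimately have sob: "sobolev_bound TYPE('n) q'"
      using sobolev_bound_improve[OF q2] q by (auto simp: Q_def)
    show ?thesis
    proof (cases "q' = p")
      case False
      then have "q' \<in> Q" "q' > s" using sob \<open>2 < q'\<close> up by (auto simp: Q_def q'_def min_def)
      then show ?thesis using cSup_upper[OF _ bdd] unfolding s_def by fastforce
    qed (use sob in simp)
  qed
qed

section \<open>Minimizing sequences on cylinders\<close>

lemma dirichlet_cmult: "smooth_fun f \<Longrightarrow> dirichlet (\<lambda>x. c * f x) = c\<^sup>2 * dirichlet f"
  by (simp add: dirichlet_def grad_cmult power_mult_distrib)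

lemma power_mass_cmult: "power_mass p (\<lambda>x. c * f x) = \<bar>c\<bar> powr p * power_mass p f"
  by (simp add: power_mass_def abs_mult powr_mult)

lemma integrable_indicator_mult:
  fixes f :: "'a \<Rightarrow> real"
  assumes "integrable M f" "A \<in> sets M" shows "integrable M (\<lambda>x. indicator A x * f x)"
  using integrable_mult_indicator[OF assms(2,1)] by simp

definition local_mass :: "real \<Rightarrow> (real^'n::finite) set \<Rightarrow> (real^'n \<Rightarrow> real) \<Rightarrow> real" where
  "local_mass p A f = (\<integral>x. indicator A x * \<bar>f x\<bar> powr p \<partial>lborel)"

lemma local_mass_integrable:
  assumes "test_fun \<Omega> f" "p > 0" "A \<in> sets borel"
  shows "integrable lborel (\<lambda>x. indicator A x * \<bar>f x\<bar> powr p)"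
  by (intro integrable_indicator_mult test_fun_integrable[OF assms(1)]) (use assms in auto)

lemma half_space_borel [measurable]:
  "{x :: real^'n::finite. x $ i \<le> c} \<in> sets borel" "{x :: real^'n. c \<le> x $ i} \<in> sets borel"
  "{x :: real^'n. x $ i < c} \<in> sets borel" "{x :: real^'n. c < x $ i} \<in> sets borel"
proof -
  have "{x \<in> space borel. (x :: real^'n) $ i \<le> c} \<in> sets borel" "{x \<in> space borel. c \<le> (x :: real^'n) $ i} \<in> sets borel"
    "{x \<in> space borel. (x :: real^'n) $ i < c} \<in> sets borel" "{x \<in> space borel. c < (x :: real^'n) $ i} \<in> sets borel"
    by measurable
  then show "{x :: real^'n::finite. x $ i \<le> c} \<in> sets borel" "{x :: real^'n. c \<le> x $ i} \<in> sets borel"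
    "{x :: real^'n. x $ i < c} \<in> sets borel" "{x :: real^'n. c < x $ i} \<in> sets borel" by simp_all
qed

text \<open>If \<open>b\<close> is small against \<open>a\<close>, it is absorbed into the factor
  \<open>1 + \<delta>\<close>, the threshold \<open>\<eta>\<close> being fixed by
  \<open>(1 + \<eta>) powr p = 1 + \<delta>\<close>; otherwise \<open>b\<close> controls the whole
  sum. The factor near 1 on \<open>a\<close> is what prevents a loss of mass in limits.\<close>

lemma abs_add_powr_le:
  fixes p \<delta> :: real
  assumes "p \<ge> 1" "\<delta> > 0"
  obtains C where "C > 0" "\<And>a b :: real. \<bar>a + b\<bar> powr p \<le> (1 + \<delta>) * \<bar>a\<bar> powr p + C * \<bar>b\<bar> powr p"
proof -
  define \<eta> where "\<eta> = (1 + \<delta>) powr (1 / p) - 1"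
  have "1 powr (1 / p) < (1 + \<delta>) powr (1 / p)" using assms by (intro powr_less_mono2) auto
  then have \<eta>: "\<eta> > 0" by (simp add: \<eta>_def)
  have \<eta>p: "(1 + \<eta>) powr p = 1 + \<delta>" using assms by (simp add: \<eta>_def powr_powr)
  show ?thesis
  proof (rule that[of "(1 + 1 / \<eta>) powr p"])
    have "1 + 1 / \<eta> > 0" using \<eta> by (simp add: add_pos_pos)
    then show "(1 + 1 / \<eta>) powr p > 0" by simp
    fix a b :: real
    show "\<bar>a + b\<bar> powr p \<le> (1 + \<delta>) * \<bar>a\<bar> powr p + (1 + 1 / \<eta>) powr p * \<bar>b\<bar> powr p"
    proof (cases "\<bar>b\<bar> \<le> \<eta> * \<bar>a\<bar>")
      case True
      have "\<bar>a + b\<bar> \<le> (1 + \<eta>) * \<bar>a\<bar>" using True abs_triangle_ineq[of a b] by (simp add: algebra_simps)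
      then have "\<bar>a + b\<bar> powr p \<le> ((1 + \<eta>) * \<bar>a\<bar>) powr p" using assms by (intro powr_mono2) auto
      also have "\<dots> = (1 + \<delta>) * \<bar>a\<bar> powr p" using \<eta> \<eta>p by (simp add: powr_mult)
      finally show ?thesis by (simp add: add_increasing2)
    next
      case False
      then have "\<bar>a\<bar> \<le> \<bar>b\<bar> / \<eta>" using \<eta> by (simp add: field_simps)
      then have "\<bar>a + b\<bar> \<le> (1 + 1 / \<eta>) * \<bar>b\<bar>" using abs_triangle_ineq[of a b] by (simp add: algebra_simps)
      then have "\<bar>a + b\<bar> powr p \<le> ((1 + 1 / \<eta>) * \<bar>b\<bar>) powr p" using assms by (intro powr_mono2) auto
      also have "\<dots> = (1 + 1 / \<eta>) powr p * \<bar>b\<bar> powr p" using \<eta> by (simp add: powr_mult)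
      finally show ?thesis using assms by (simp add: add_increasing)
    qed
  qed
qed

text \<open>\<open>Z\<close> is the set of the unbounded coordinate directions.\<close>

locale cylinder =
  fixes D :: "(real^'n::finite) set" and Z :: "'n set" and b p :: real
  assumes open_D: "open D" and D_nonempty: "D \<noteq> {}"
    and Z_proper: "Z \<noteq> UNIV"
    and D_bounded: "\<And>x i. x \<in> D \<Longrightarrow> i \<notin> Z \<Longrightarrow> \<bar>x $ i\<bar> \<le> b"
    and D_translate: "\<And>x h. (\<And>i. i \<notin> Z \<Longrightarrow> h $ i = 0) \<Longrightarrow> h + x \<in> D \<longleftrightarrow> x \<in> D"
    and dim: "CARD('n) \<ge> 3"
    and p_gt_2: "2 < p" and p_lt: "p < 2 * real CARD('n) / (real CARD('n) - 2)"
begin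

section \<open>Poincare and Sobolev inequalities on the cylinder, and the minimal level\<close>

lemma b_nonneg: "b \<ge> 0"
  using D_nonempty Z_proper D_bounded by (metis UNIV_eq_I abs_ge_zero ex_in_conv order_trans)

text \<open>Square of the shift length: \<open>D\<close> has width at most \<open>2 * b\<close> in a
  bounded direction, and the extra 1 ensures that the shift leaves \<open>D\<close>.\<close>

definition poincare_const :: real where "poincare_const = (2 * b + 1)\<^sup>2"

lemma poincare_const_pos: "poincare_const > 0"
  using b_nonneg by (simp add: poincare_const_def)

text \<open>A shift by more than the width of \<open>D\<close> separates \<open>\<phi>\<close> from its translate.\<close>

lemma poincare:
  assumes \<phi>: "test_fun D \<phi>"
  shows "power_mass 2 \<phi> \<le> poincare_const * dirichlet \<phi>"
proof -
  obtain i where i: "i \<notin> Z" using Z_proper by blast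
  define h :: "real^'n" where "h = (2 * b + 1) *\<^sub>R axis i 1"
  have supp: "\<phi> x = 0" if "x \<notin> D" for x using test_fun_support[OF \<phi>] that by (metis subsetD)
  have nh: "norm h = 2 * b + 1" using b_nonneg by (simp add: h_def)
  have "\<bar>\<phi> x\<bar> powr 2 \<le> (\<phi> (x + h) - \<phi> x)\<^sup>2" for x
  proof (cases "x \<in> D")
    case True
    have "x + h \<notin> D"
    proof
      assume "x + h \<in> D"
      from D_bounded[OF this i] D_bounded[OF True i] show False
        by (simp add: h_def abs_le_iff)
    qed
    then show ?thesis by (simp add: supp abs_powr_2)
  qed (simp add: supp abs_powr_2)
  then have "(\<integral>\<^sup>+ x. ennreal (\<bar>\<phi> x\<bar> powr 2) \<partial>lborel) \<le> (\<integral>\<^sup>+ x. ennreal ((\<phi> (x + h) - \<phi> x)\<^sup>2) \<partial>lborel)"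
    by (intro nn_integral_mono ennreal_leI)
  also have "\<dots> \<le> ennreal ((norm h)\<^sup>2) * (\<integral>\<^sup>+ x. ennreal ((norm (grad \<phi> x))\<^sup>2) \<partial>lborel)"
    by (rule nn_integral_increment_le[OF test_fun_smooth[OF \<phi>]])
  finally have "ennreal (power_mass 2 \<phi>) \<le> ennreal (poincare_const * dirichlet \<phi>)"
    using nn_integral_power_mass[OF \<phi>, of 2]
    by (simp add: nn_integral_dirichlet[OF \<phi>] nh poincare_const_def ennreal_mult')
  then show ?thesis
    using dirichlet_nonneg[of \<phi>] poincare_const_pos by (subst (asm) ennreal_le_iff) auto
qed

text \<open>\<open>T\<close> dominates both the energy and, by the Poincare inequality, the
  \<open>L^2\<close> mass, so \<open>\<phi>\<close> divided by the square root of \<open>T\<close>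
  is normalized in both respects and the unit bound applies.\<close>

lemma sobolev:
  assumes q: "2 \<le> q" "q < 2 * real CARD('n) / (real CARD('n) - 2)" and K: "K > 0"
  obtains C where "C > 0" "\<And>\<phi>. test_fun D \<phi> \<Longrightarrow> dirichlet \<phi> \<le> K \<Longrightarrow> power_mass q \<phi> \<le> C"
proof -
  obtain C0 where C0: "\<And>f :: real^'n \<Rightarrow> real. test_fun UNIV f \<Longrightarrow> power_mass 2 f \<le> 1 \<Longrightarrow>
     dirichlet f \<le> 1 \<Longrightarrow> power_mass q f \<le> C0"
    using sobolev_subcritical[OF dim q] unfolding sobolev_bound_def by blast
  define T where "T = (1 + poincare_const) * K"
  have T: "T > 0" using K poincare_const_pos by (simp add: T_def)
  have "power_mass q \<phi> \<le> T powr (q / 2) * max C0 1" if \<phi>: "test_fun D \<phi>" "dirichlet \<phi> \<le> K" for \<phi>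
  proof -
    define c where "c = T powr (- 1 / 2)"
    have c: "c > 0" "c\<^sup>2 = 1 / T"
      using T by (auto simp: c_def powr_minus_divide powr_half_sqrt power_divide)
    have "c powr q = T powr (- (q / 2))" unfolding c_def powr_powr by simp
    then have cq: "c powr q = 1 / T powr (q / 2)" by (simp add: powr_minus_divide)
    have "dirichlet (\<lambda>x. c * \<phi> x) = dirichlet \<phi> / T"
      using c by (simp add: dirichlet_cmult[OF test_fun_smooth[OF \<phi>(1)]])
    also have "\<dots> \<le> K / T" using \<phi>(2) T by (simp add: divide_right_mono)
    also have "\<dots> \<le> 1" using T K poincare_const_pos by (simp add: T_def)
    finally have 1: "dirichlet (\<lambda>x. c * \<phi> x) \<le> 1" .
    have "power_mass 2 (\<lambda>x. c * \<phi> x) = power_mass 2 \<phi> / T"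
      using c by (simp add: power_mass_cmult abs_powr_2)
    also have "\<dots> \<le> (poincare_const * K) / T"
      using order_trans[OF poincare[OF \<phi>(1)] mult_left_mono[OF \<phi>(2)]] poincare_const_pos T
      by (intro divide_right_mono) auto
    also have "\<dots> \<le> 1" using T K by (simp add: T_def algebra_simps)
    finally have "power_mass q (\<lambda>x. c * \<phi> x) \<le> C0"
      using C0 1 test_fun_cmult[OF test_fun_mono[OF \<phi>(1)]] by blast
    then have "power_mass q \<phi> / T powr (q / 2) \<le> max C0 1"
      using c cq by (simp add: power_mass_cmult)
    then show ?thesis using T by (simp add: field_simps)
  qed
  then show ?thesis using that[of "T powr (q / 2) * max C0 1"] T by simp
qed

text \<open>The infimum runs over test functions only, so no Sobolev space has to be set up to speak
  of it. Its reciprocal is the best constant bounding the squared \<open>L^p\<close> norm by the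
  energy.\<close>

definition level :: real where
  "level = Inf {dirichlet \<phi> | \<phi>. test_fun D \<phi> \<and> power_mass p \<phi> = 1}"

lemma normalized_test_fun_exists: obtains \<phi> where "test_fun D \<phi>" "power_mass p \<phi> = 1"
proof -
  obtain c where "c \<in> D" using D_nonempty by blast
  then obtain f where f: "test_fun D f" "f c > 0" using test_fun_exists[OF open_D] by metis
  have "continuous_on UNIV (\<lambda>x. \<bar>f x\<bar> powr p)"
    using p_gt_2 by (intro continuous_on_abs_powr smooth_fun_continuous test_fun_smooth[OF f(1)]) auto
  \<comment> \<open>Vanishing mass would make \<open>f\<close> zero almost everywhere, and the
    closed zero set would then contain \<open>c\<close>.\<close>
  have "power_mass p f \<noteq> 0"
  proof
    assume "power_mass p f = 0"
    then have "AE x in lborel. \<bar>f x\<bar> powr p = 0"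
      unfolding power_mass_def
      using p_gt_2 by (subst (asm) integral_nonneg_eq_0_iff_AE) (auto intro: test_fun_integrable[OF f(1)])
    then have "AE x in lborel. x \<in> {x. f x = 0}" by simp
    then have "AE x in lebesgue. x \<in> {x. f x = 0}" by (rule AE_completion)
    moreover have "closed {x. f x = 0}"
      using smooth_fun_continuous[OF test_fun_smooth[OF f(1)], of UNIV] by (intro closed_Collect_eq) auto
    ultimately have "c \<in> {x. f x = 0}" using mem_closed_if_AE_lebesgue by blast
    then show False using f(2) by simp
  qed
  then have pos: "power_mass p f > 0" using power_mass_nonneg[of p f] by simp
  define t where "t = power_mass p f powr (- 1 / p)"
  have "t powr p = power_mass p f powr (- 1)" unfolding t_def powr_powr using p_gt_2 by simp
  moreover have "t > 0" using pos by (simp add: t_def)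
  ultimately have "\<bar>t\<bar> powr p = 1 / power_mass p f" using pos by (simp add: powr_minus_divide)
  then have "power_mass p (\<lambda>x. t * f x) = 1" using pos by (simp add: power_mass_cmult)
  then show ?thesis using that test_fun_cmult[OF f(1)] by blast
qed

lemma level_le: "test_fun D \<phi> \<Longrightarrow> power_mass p \<phi> = 1 \<Longrightarrow> level \<le> dirichlet \<phi>"
  unfolding level_def by (rule cInf_lower) (auto intro: bdd_belowI[of _ 0] dirichlet_nonneg)

text \<open>A function of \<open>p\<close>-mass 1 and energy below \<open>1 / T\<^sup>2\<close>
  would become, scaled by \<open>T\<close>, a function of energy at most 1 and \<open>p\<close>-mass
  \<open>T powr p = C + 1\<close>, against the Sobolev bound.\<close>

lemma level_pos: "level > 0"
proof -
  obtain C where C: "C > 0" "\<And>\<phi>. test_fun D \<phi> \<Longrightarrow> dirichlet \<phi> \<le> 1 \<Longrightarrow> power_mass p \<phi> \<le> C"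
    using sobolev[of p 1] p_gt_2 p_lt by auto
  define T where "T = (C + 1) powr (1 / p)"
  have T: "T > 0" "T powr p = C + 1" using C p_gt_2 by (auto simp: T_def powr_powr)
  have "1 / T\<^sup>2 \<le> dirichlet \<phi>" if \<phi>: "test_fun D \<phi>" "power_mass p \<phi> = 1" for \<phi>
  proof (rule ccontr)
    assume "\<not> 1 / T\<^sup>2 \<le> dirichlet \<phi>"
    then have "dirichlet (\<lambda>x. T * \<phi> x) \<le> 1"
      using T(1) by (simp add: dirichlet_cmult[OF test_fun_smooth[OF \<phi>(1)]] field_simps)
    then have "power_mass p (\<lambda>x. T * \<phi> x) \<le> C" by (intro C test_fun_cmult \<phi>)
    then show False using T \<phi>(2) by (simp add: power_mass_cmult)
  qed
  then have "1 / T\<^sup>2 \<le> level"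
    unfolding level_def using normalized_test_fun_exists by (intro cInf_greatest) blast+
  moreover have "1 / T\<^sup>2 > 0" using T by simp
  ultimately show ?thesis by linarith
qed

lemma level_inequality:
  assumes \<phi>: "test_fun D \<phi>"
  shows "level * power_mass p \<phi> powr (2 / p) \<le> dirichlet \<phi>"
proof (cases "power_mass p \<phi> = 0")
  case False
  then have pos: "power_mass p \<phi> > 0" using power_mass_nonneg[of p \<phi>] by simp
  define t where "t = power_mass p \<phi> powr (- 1 / p)"
  have "t powr p = power_mass p \<phi> powr (- 1)" "t powr 2 = power_mass p \<phi> powr (- (2 / p))"
    unfolding t_def powr_powr using p_gt_2 by simp_all
  moreover have "t > 0" using pos by (simp add: t_def)
  ultimately have t: "\<bar>t\<bar> powr p = 1 / power_mass p \<phi>" "t\<^sup>2 = 1 / power_mass p \<phi> powr (2 / p)"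
    using pos by (simp_all add: powr_minus_divide powr_numeral)
  have "power_mass p (\<lambda>x. t * \<phi> x) = 1" using pos t by (simp add: power_mass_cmult)
  then have "level \<le> dirichlet (\<lambda>x. t * \<phi> x)" by (intro level_le test_fun_cmult \<phi>)
  also have "\<dots> = dirichlet \<phi> / power_mass p \<phi> powr (2 / p)"
    using t by (simp add: dirichlet_cmult[OF test_fun_smooth[OF \<phi>]])
  finally show ?thesis using pos by (simp add: field_simps)
qed (simp add: dirichlet_nonneg)

subsection \<open>Tightness\<close>

text \<open>A function close to the minimum cannot carry mass on both sides of a long gap: cutting it along
  the unit slab of the gap with the least energy would produce two functions whose quotients violate
  the strict subadditivity of \<open>t powr (2 / p)\<close>.\<close>

lemma no_splitting:
  assumes \<epsilon>: "0 < \<epsilon>" "\<epsilon> < 1"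
  obtains R \<delta> :: real where "R > 0" "\<delta> > 0"
    "\<And>\<phi> i c. test_fun D \<phi> \<Longrightarrow> power_mass p \<phi> = 1 \<Longrightarrow> dirichlet \<phi> \<le> level + \<delta> \<Longrightarrow>
       \<epsilon> \<le> local_mass p {x. x $ i \<le> c} \<phi> \<Longrightarrow> local_mass p {x. c + R \<le> x $ i} \<phi> < \<epsilon>"
proof -
  obtain d B where d: "\<And>t. (smooth_step has_real_derivative d t) (at t)" "\<And>t. \<bar>d t\<bar> \<le> B"
    "\<And>t. t \<notin> {0<..<1} \<Longrightarrow> d t = 0" using smooth_step_has_derivative by blast
  have B0: "B \<ge> 0" using d(2)[of 0] by linarith
  define \<tau> where "\<tau> = 2 / p"
  have \<tau>: "\<tau> < 1" "\<tau> > 0" using p_gt_2 by (auto simp: \<tau>_def)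
  \<comment> \<open>For \<open>0 < A \<le> 1 - \<epsilon>\<close> one has
    \<open>A powr \<tau> \<ge> \<kappa> * A\<close>, the quantitative form of strict
    concavity.\<close>
  define \<kappa> where "\<kappa> = (1 - \<epsilon>) powr (\<tau> - 1)"
  have "(1 - \<epsilon>) powr (1 - \<tau>) < 1"
    using \<epsilon> \<tau> powr_less_mono2[of "1 - \<tau>" "1 - \<epsilon>" 1] by simp
  moreover have "(1 - \<epsilon>) powr (1 - \<tau>) * \<kappa> = 1"
    using \<epsilon> by (simp add: \<kappa>_def powr_add[symmetric])
  moreover have "\<kappa> > 0" using \<epsilon> by (simp add: \<kappa>_def)
  ultimately have \<kappa>: "\<kappa> > 1" by (metis mult_le_cancel_right1 not_less order_less_imp_not_less)
  \<comment> \<open>Bounds the integral of squares, energy and \<open>p\<close>-mass together when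
    the energy is at most \<open>level + 1\<close>.\<close>
  define K where "K = (poincare_const + 1) * (level + 1) + 1"
  have K: "K > 0" using level_pos poincare_const_pos by (simp add: K_def add_pos_pos)
  \<comment> \<open>Cost of the cut inside a slab: squaring a sum of two terms doubles, and there
    are two pieces, hence 4; \<open>B\<close> bounds the gradient of the cutoff.\<close>
  define C1 where "C1 = 4 + 4 * B\<^sup>2"
  \<comment> \<open>\<open>g\<close> is the margin of the contradiction: \<open>\<delta>\<close> and
    the loss in the slab each use at most \<open>g / 4\<close> of it.\<close>
  define g where "g = level * (\<kappa> - 1)"
  have g: "g > 0" using level_pos \<kappa> by (simp add: g_def)
  define \<delta> where "\<delta> = min 1 (g / 4)"
  have \<delta>: "\<delta> > 0" "\<delta> \<le> 1" "\<delta> \<le> g / 4" using g by (auto simp: \<delta>_def)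
  obtain n :: nat where n: "real n > 4 * K * (level * \<kappa> + C1) / g" using reals_Archimedean2 by blast
  have "4 * K * (level * \<kappa> + C1) / g \<ge> 0"
    using K level_pos \<kappa> g by (intro divide_nonneg_nonneg mult_nonneg_nonneg) (auto simp: C1_def)
  then have n0: "real n > 0" using n by linarith
  have "4 * K * (level * \<kappa> + C1) < g * real n" using n g by (simp add: pos_divide_less_eq mult.commute)
  then have small: "K / real n * (level * \<kappa> + C1) < g / 4" using n0 by (simp add: field_simps)
  have "local_mass p {x. c + real n \<le> x $ i} \<phi> < \<epsilon>"
    if \<phi>: "test_fun D \<phi>" and m1: "power_mass p \<phi> = 1" and dl: "dirichlet \<phi> \<le> level + \<delta>"
      and left: "\<epsilon> \<le> local_mass p {x. x $ i \<le> c} \<phi>" for \<phi> i c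
  proof (rule ccontr)
    assume "\<not> ?thesis"
    then have right: "\<epsilon> \<le> local_mass p {x. c + real n \<le> x $ i} \<phi>" by simp
    note int = test_fun_integrable[OF \<phi>]
    have intp: "integrable lborel (\<lambda>x. \<bar>\<phi> x\<bar> powr p)" using p_gt_2 int(3) by simp
    \<comment> \<open>One density for all quantities, so that a single slab is cheap for all of them
      at once.\<close>
    define e where "e x = (\<phi> x)\<^sup>2 + (norm (grad \<phi> x))\<^sup>2 + \<bar>\<phi> x\<bar> powr p" for x
    have e_int: "integrable lborel e" unfolding e_def[abs_def] using int(1,2) intp by auto
    have e_nonneg: "e x \<ge> 0" for x by (simp add: e_def)
    define S where "S j = {x :: real^'n. c + real j \<le> x $ i \<and> x $ i < c + real j + 1}" for j :: nat
    have S_meas [measurable]: "S j \<in> sets borel" for j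
    proof -
      have "S j = {x. c + real j \<le> x $ i} \<inter> {x. x $ i < c + real j + 1}" by (auto simp: S_def)
      then show ?thesis by simp
    qed
    have Sint: "integrable lborel (\<lambda>x. indicator (S j) x * e x)" for j
      by (intro integrable_indicator_mult e_int) simp
    have "integral\<^sup>L lborel e = power_mass 2 \<phi> + dirichlet \<phi> + power_mass p \<phi>"
      unfolding e_def[abs_def] power_mass_def dirichlet_def abs_powr_2 using int(1,2) intp by simp
    also have "\<dots> \<le> poincare_const * dirichlet \<phi> + dirichlet \<phi> + 1" using poincare[OF \<phi>] m1 by simp
    also have "\<dots> = (poincare_const + 1) * dirichlet \<phi> + 1" by (simp add: algebra_simps)
    also have "\<dots> \<le> K"
      unfolding K_def using dl \<delta>(2) poincare_const_pos by (intro add_right_mono mult_left_mono) auto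
    finally have eK: "integral\<^sup>L lborel e \<le> K" .
    \<comment> \<open>Otherwise the \<open>n\<close> disjoint slabs together would carry more than
      \<open>K\<close>.\<close>
    have "\<exists>j<n. (\<integral>x. indicator (S j) x * e x \<partial>lborel) \<le> K / real n"
    proof (rule ccontr)
      assume "\<not> ?thesis"
      then have gt: "(\<integral>x. indicator (S j) x * e x \<partial>lborel) > K / real n" if "j < n" for j
        using that by (auto simp: not_le)
      have "K = (\<Sum>j<n. K / real n)" using n0 by simp
      also have "\<dots> < (\<Sum>j<n. \<integral>x. indicator (S j) x * e x \<partial>lborel)"
        using n0 gt by (intro sum_strict_mono) auto
      also have "\<dots> = (\<integral>x. (\<Sum>j<n. indicator (S j) x * e x) \<partial>lborel)"
        by (rule Bochner_Integration.integral_sum[symmetric]) (rule Sint)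
      also have "\<dots> \<le> integral\<^sup>L lborel e"
      proof (intro integral_mono Bochner_Integration.integrable_sum Sint e_int)
        fix x :: "real^'n"
        have "(\<Sum>j<n. indicator (S j) x :: real) \<le> 1"
        proof (cases "\<exists>j<n. x \<in> S j")
          case True
          then obtain j where j: "j < n" "x \<in> S j" by blast
          have "x \<notin> S j'" if "j' \<noteq> j" for j'
          proof (cases "j' < j")
            case True
            then have "real j' + 1 \<le> real j" by simp
            then show ?thesis using j(2) by (auto simp: S_def)
          next
            case False
            then have "real j + 1 \<le> real j'" using that by simp
            then show ?thesis using j(2) by (auto simp: S_def)
          qed
          then have "(\<Sum>j<n. indicator (S j) x :: real) = (\<Sum>j'<n. if j' = j then 1 else 0)"
            using j(2) by (intro sum.cong) (auto simp: indicator_def)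
          then show ?thesis by simp
        qed (auto simp: indicator_def)
        from mult_right_mono[OF this e_nonneg[of x]]
        show "(\<Sum>j<n. indicator (S j) x * e x) \<le> e x" by (simp only: sum_distrib_right mult_1)
      qed
      finally show False using eK by simp
    qed
    then obtain j where j: "j < n" "(\<integral>x. indicator (S j) x * e x \<partial>lborel) \<le> K / real n" by blast
    define a where "a = - (c + real j)"
    define v :: "real^'n" where "v = axis i 1"
    have av: "a + v \<bullet> x = x $ i - (c + real j)" for x by (simp add: a_def v_def inner_axis')
    define \<zeta> where "\<zeta> x = smooth_step (a + v \<bullet> x)" for x
    have \<zeta>s: "smooth_fun \<zeta>" unfolding \<zeta>_def[abs_def] by (rule smooth_fun_step)
    have g\<zeta>: "grad \<zeta> x = d (a + v \<bullet> x) *\<^sub>R v" for x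
      unfolding \<zeta>_def[abs_def] by (rule grad_comp_linear_form[OF d(1)])
    have \<zeta>1: "0 \<le> \<zeta> x" "\<zeta> x \<le> 1" for x unfolding \<zeta>_def by (rule smooth_step_bounds)+
    define f1 where "f1 x = (1 - \<zeta> x) * \<phi> x" for x
    define f2 where "f2 x = \<zeta> x * \<phi> x" for x
    have t2: "test_fun D f2" unfolding f2_def[abs_def] by (intro test_fun_smooth_mult \<zeta>s \<phi>)
    have co\<zeta>s: "smooth_fun (\<lambda>x. 1 - \<zeta> x)" by (intro smooth_fun_diff smooth_fun_const \<zeta>s)
    have t1: "test_fun D f1" unfolding f1_def[abs_def] by (intro test_fun_smooth_mult co\<zeta>s \<phi>)
    have g2: "grad f2 x = \<zeta> x *\<^sub>R grad \<phi> x + \<phi> x *\<^sub>R grad \<zeta> x" for x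
      unfolding f2_def[abs_def] by (rule grad_mult[OF \<zeta>s test_fun_smooth[OF \<phi>]])
    have g1: "grad f1 x = (1 - \<zeta> x) *\<^sub>R grad \<phi> x - \<phi> x *\<^sub>R grad \<zeta> x" for x
      unfolding f1_def[abs_def] grad_mult[OF co\<zeta>s test_fun_smooth[OF \<phi>]]
      by (simp add: grad_diff[OF smooth_fun_const \<zeta>s] grad_const)
    have outside: "grad \<zeta> x = 0 \<and> (\<zeta> x = 0 \<or> \<zeta> x = 1)" if "x \<notin> S j" for x
    proof -
      have "a + v \<bullet> x \<le> 0 \<or> a + v \<bullet> x \<ge> 1" using that unfolding S_def av by auto
      then consider "a + v \<bullet> x \<le> 0" | "a + v \<bullet> x \<ge> 1" by blast
      then show ?thesis
        by cases (auto simp: g\<zeta> d(3) \<zeta>_def smooth_step_eq_0 smooth_step_eq_1)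
    qed
    have gb: "norm (grad \<zeta> x) \<le> B" for x using d(2) by (simp add: g\<zeta> v_def)
    have two: "(norm (u + w))\<^sup>2 \<le> 2 * (norm u)\<^sup>2 + 2 * (norm w)\<^sup>2" for u w :: "real^'n"
    proof -
      have "(norm (u + w))\<^sup>2 \<le> (norm u + norm w)\<^sup>2" by (intro power_mono norm_triangle_ineq) auto
      also have "\<dots> \<le> 2 * (norm u)\<^sup>2 + 2 * (norm w)\<^sup>2"
        using sum_squares_bound[of "norm u" "norm w"] by (simp add: power2_sum)
      finally show ?thesis .
    qed
    have en: "(norm (grad f1 x))\<^sup>2 + (norm (grad f2 x))\<^sup>2 \<le> (norm (grad \<phi> x))\<^sup>2 + C1 * (indicator (S j) x * e x)" for x
    proof (cases "x \<in> S j")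
      case True
      have s1: "(norm (s *\<^sub>R grad \<phi> x))\<^sup>2 \<le> (norm (grad \<phi> x))\<^sup>2" if "0 \<le> s" "s \<le> 1" for s
        using that by (intro power_mono) (auto simp: mult_left_le_one_le)
      have "norm (\<phi> x *\<^sub>R grad \<zeta> x) \<le> \<bar>\<phi> x\<bar> * B" using gb[of x] by (simp add: mult_left_mono)
      then have s2: "(norm (\<phi> x *\<^sub>R grad \<zeta> x))\<^sup>2 \<le> B\<^sup>2 * (\<phi> x)\<^sup>2"
        using power_mono[of "norm (\<phi> x *\<^sub>R grad \<zeta> x)" "\<bar>\<phi> x\<bar> * B" 2] by (simp add: power_mult_distrib mult.commute)
      have "(norm (grad f1 x))\<^sup>2 + (norm (grad f2 x))\<^sup>2 \<le> 4 * (norm (grad \<phi> x))\<^sup>2 + 4 * (B\<^sup>2 * (\<phi> x)\<^sup>2)"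
      proof -
        have r: "0 \<le> 1 - \<zeta> x" "1 - \<zeta> x \<le> 1" using \<zeta>1[of x] by auto
        have "(norm (grad f1 x))\<^sup>2 \<le> 2 * (norm (grad \<phi> x))\<^sup>2 + 2 * (B\<^sup>2 * (\<phi> x)\<^sup>2)"
          using two[of "(1 - \<zeta> x) *\<^sub>R grad \<phi> x" "- (\<phi> x *\<^sub>R grad \<zeta> x)"] s1[OF r] s2
          unfolding g1 norm_minus_cancel add_uminus_conv_diff by linarith
        moreover have "(norm (grad f2 x))\<^sup>2 \<le> 2 * (norm (grad \<phi> x))\<^sup>2 + 2 * (B\<^sup>2 * (\<phi> x)\<^sup>2)"
          using two[of "\<zeta> x *\<^sub>R grad \<phi> x" "\<phi> x *\<^sub>R grad \<zeta> x"] s1[OF \<zeta>1[of x]] s2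
          unfolding g2 by linarith
        ultimately show ?thesis by linarith
      qed
      also have "\<dots> \<le> C1 * ((\<phi> x)\<^sup>2 + (norm (grad \<phi> x))\<^sup>2)"
        by (simp add: C1_def algebra_simps)
      also have "\<dots> \<le> C1 * e x" by (intro mult_left_mono) (auto simp: C1_def e_def)
      finally show ?thesis using True by (simp add: add_increasing)
    next
      case False
      then show ?thesis using outside[OF False] by (auto simp: g1 g2)
    qed
    have "dirichlet f1 + dirichlet f2 = (\<integral>x. (norm (grad f1 x))\<^sup>2 + (norm (grad f2 x))\<^sup>2 \<partial>lborel)"
      unfolding dirichlet_def using test_fun_integrable(2)[OF t1] test_fun_integrable(2)[OF t2] by simp
    also have "\<dots> \<le> (\<integral>x. (norm (grad \<phi> x))\<^sup>2 + C1 * (indicator (S j) x * e x) \<partial>lborel)"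
      using test_fun_integrable(2)[OF t1] test_fun_integrable(2)[OF t2] int(2) Sint
      by (intro integral_mono en Bochner_Integration.integrable_add integrable_mult_right) auto
    also have "\<dots> = dirichlet \<phi> + C1 * (\<integral>x. indicator (S j) x * e x \<partial>lborel)"
      unfolding dirichlet_def using int(2) Sint[of j] by simp
    also have "\<dots> \<le> dirichlet \<phi> + C1 * (K / real n)"
      using j(2) by (intro add_left_mono mult_left_mono) (auto simp: C1_def)
    finally have dir: "dirichlet f1 + dirichlet f2 \<le> dirichlet \<phi> + C1 * (K / real n)" .
    have i1: "integrable lborel (\<lambda>x. \<bar>f1 x\<bar> powr p)" and i2: "integrable lborel (\<lambda>x. \<bar>f2 x\<bar> powr p)"
      using p_gt_2 test_fun_integrable(3)[OF t1] test_fun_integrable(3)[OF t2] by auto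
    \<comment> \<open>\<open>s powr p \<le> s\<close> on the unit interval, so the masses of the two
      pieces add up to at most the mass of \<open>\<phi>\<close>.\<close>
    have sc: "\<bar>s * \<phi> x\<bar> powr p \<le> s * \<bar>\<phi> x\<bar> powr p" if "0 \<le> s" "s \<le> 1" for s x
    proof -
      have "s powr p \<le> s powr 1" using that p_gt_2 by (intro powr_mono') auto
      then show ?thesis using that by (simp add: abs_mult powr_mult mult_right_mono)
    qed
    have "power_mass p f1 + power_mass p f2 = (\<integral>x. \<bar>f1 x\<bar> powr p + \<bar>f2 x\<bar> powr p \<partial>lborel)"
      unfolding power_mass_def using i1 i2 by simp
    also have "\<dots> \<le> (\<integral>x. \<bar>\<phi> x\<bar> powr p \<partial>lborel)"
    proof (intro integral_mono Bochner_Integration.integrable_add i1 i2 intp)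
      fix x
      have "\<bar>f1 x\<bar> powr p + \<bar>f2 x\<bar> powr p \<le> (1 - \<zeta> x) * \<bar>\<phi> x\<bar> powr p + \<zeta> x * \<bar>\<phi> x\<bar> powr p"
        unfolding f1_def f2_def using \<zeta>1[of x] by (intro add_mono sc) auto
      then show "\<bar>f1 x\<bar> powr p + \<bar>f2 x\<bar> powr p \<le> \<bar>\<phi> x\<bar> powr p" by (simp add: algebra_simps)
    qed
    finally have up: "power_mass p f1 + power_mass p f2 \<le> 1" using m1 by (simp add: power_mass_def)
    \<comment> \<open>Off the slab one of the pieces equals \<open>\<phi>\<close>, and on the slab
      \<open>e\<close> dominates the \<open>p\<close>-th power of \<open>|\<phi>|\<close>; hence at
      most \<open>K / n\<close> of the mass is lost.\<close>
    have "1 - K / real n \<le> (\<integral>x. \<bar>\<phi> x\<bar> powr p \<partial>lborel) - (\<integral>x. indicator (S j) x * e x \<partial>lborel)"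
      using j(2) m1 by (simp add: power_mass_def)
    also have "\<dots> = (\<integral>x. \<bar>\<phi> x\<bar> powr p - indicator (S j) x * e x \<partial>lborel)"
      using intp Sint by simp
    also have "\<dots> \<le> (\<integral>x. \<bar>f1 x\<bar> powr p + \<bar>f2 x\<bar> powr p \<partial>lborel)"
    proof (intro integral_mono Bochner_Integration.integrable_add Bochner_Integration.integrable_diff i1 i2 intp Sint)
      fix x
      show "\<bar>\<phi> x\<bar> powr p - indicator (S j) x * e x \<le> \<bar>f1 x\<bar> powr p + \<bar>f2 x\<bar> powr p"
      proof (cases "x \<in> S j")
        case True
        then have "\<bar>\<phi> x\<bar> powr p - indicator (S j) x * e x \<le> 0" by (simp add: e_def)
        then show ?thesis by (rule order_trans) simp
      next
        case False
        then show ?thesis using outside[OF False] by (auto simp: f1_def f2_def)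
      qed
    qed
    also have "\<dots> = power_mass p f1 + power_mass p f2"
      unfolding power_mass_def using i1 i2 by simp
    finally have low: "1 - K / real n \<le> power_mass p f1 + power_mass p f2" .
    have A1: "\<epsilon> \<le> power_mass p f1"
    proof -
      have "local_mass p {x. x $ i \<le> c} \<phi> \<le> power_mass p f1"
        unfolding local_mass_def power_mass_def
      proof (rule integral_mono[OF _ i1])
        show "integrable lborel (\<lambda>x. indicator {x. x $ i \<le> c} x * \<bar>\<phi> x\<bar> powr p)"
          using p_gt_2 by (intro local_mass_integrable[OF \<phi>]) auto
        fix x
        have "f1 x = \<phi> x" if "x $ i \<le> c"
          using that by (simp add: f1_def \<zeta>_def av smooth_step_eq_0)
        then show "indicator {x. x $ i \<le> c} x * \<bar>\<phi> x\<bar> powr p \<le> \<bar>f1 x\<bar> powr p"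
          by (simp add: indicator_def)
      qed
      then show ?thesis using left by simp
    qed
    have A2: "\<epsilon> \<le> power_mass p f2"
    proof -
      have "local_mass p {x. c + real n \<le> x $ i} \<phi> \<le> power_mass p f2"
        unfolding local_mass_def power_mass_def
      proof (rule integral_mono[OF _ i2])
        show "integrable lborel (\<lambda>x. indicator {x. c + real n \<le> x $ i} x * \<bar>\<phi> x\<bar> powr p)"
          using p_gt_2 by (intro local_mass_integrable[OF \<phi>]) auto
        fix x
        have jn: "real j + 1 \<le> real n" using j(1) by simp
        have "f2 x = \<phi> x" if "c + real n \<le> x $ i"
          using that jn by (simp add: f2_def \<zeta>_def av smooth_step_eq_1)
        then show "indicator {x. c + real n \<le> x $ i} x * \<bar>\<phi> x\<bar> powr p \<le> \<bar>f2 x\<bar> powr p"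
          by (simp add: indicator_def)
      qed
      then show ?thesis using right by simp
    qed
    have conc: "A * \<kappa> \<le> A powr \<tau>" if "0 < A" "A \<le> 1 - \<epsilon>" for A
    proof -
      have "\<kappa> \<le> A powr (\<tau> - 1)" unfolding \<kappa>_def using that \<tau> by (intro powr_mono2') auto
      then have "A * \<kappa> \<le> A * A powr (\<tau> - 1)" using that by (intro mult_left_mono) auto
      also have "\<dots> = A powr \<tau>" using that by (simp add: powr_diff)
      finally show ?thesis .
    qed
    \<comment> \<open>The factor \<open>\<kappa>\<close> applies because each piece has mass at
      least \<open>\<epsilon>\<close> and both together at most 1, so neither exceeds
      \<open>1 - \<epsilon>\<close>.\<close>
    have "level * ((1 - K / real n) * \<kappa>) \<le> level * ((power_mass p f1 + power_mass p f2) * \<kappa>)"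
      using low level_pos \<kappa> by (intro mult_left_mono mult_right_mono) auto
    also have "\<dots> \<le> level * (power_mass p f1 powr \<tau> + power_mass p f2 powr \<tau>)"
      using conc[of "power_mass p f1"] conc[of "power_mass p f2"] A1 A2 up \<epsilon> level_pos
      by (intro mult_left_mono) (auto simp: distrib_right)
    also have "\<dots> \<le> dirichlet f1 + dirichlet f2"
      using level_inequality[OF t1] level_inequality[OF t2] by (simp add: \<tau>_def distrib_left)
    also have "\<dots> \<le> level + \<delta> + C1 * (K / real n)" using dir dl by simp
    finally have "g \<le> \<delta> + K / real n * (level * \<kappa> + C1)"
      by (simp add: g_def algebra_simps)
    also have "\<dots> \<le> g / 4 + g / 4" using \<delta>(3) small by linarith
    finally show False using g by simp
  qed
  then show ?thesis using that[of "real n" \<delta>] n0 \<delta>(1) by blast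
qed

end

subsection \<open>Compactness modulo translations\<close>

lemma lborel_integral_translate:
  fixes f :: "'a::euclidean_space \<Rightarrow> real"
  assumes "f \<in> borel_measurable borel"
  shows "(\<integral>x. f (h + x) \<partial>lborel) = (\<integral>x. f x \<partial>lborel)"
proof -
  have "(\<integral>x. f x \<partial>lborel) = (\<integral>x. f x \<partial>distr lborel borel ((+) h))"
    by (simp add: lborel_distr_plus)
  also have "\<dots> = (\<integral>x. f (h + x) \<partial>lborel)"
    using assms by (intro integral_distr) auto
  finally show ?thesis by simp
qed

lemma dirichlet_translate:
  assumes "test_fun \<Omega> f" shows "dirichlet (\<lambda>x. f (h + x)) = dirichlet f"
  unfolding dirichlet_def grad_translate[OF test_fun_smooth[OF assms]]
  using test_fun_borel_measurable(2)[OF assms]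
  by (intro lborel_integral_translate[of "\<lambda>x. (norm (grad f x))\<^sup>2"]) measurable

lemma power_mass_translate:
  assumes "test_fun \<Omega> f" shows "power_mass p (\<lambda>x. f (h + x)) = power_mass p f"
  unfolding power_mass_def
  using test_fun_borel_measurable(1)[OF assms]
  by (intro lborel_integral_translate[of "\<lambda>x. \<bar>f x\<bar> powr p"]) measurable

lemma local_mass_translate:
  assumes "test_fun \<Omega> f" "A \<in> sets borel"
  shows "local_mass p ((+) h -` A) (\<lambda>x. f (h + x)) = local_mass p A f"
proof -
  have [measurable]: "f \<in> borel_measurable borel" by (rule test_fun_borel_measurable(1)[OF assms(1)])
  note assms(2)[measurable]
  have "local_mass p ((+) h -` A) (\<lambda>x. f (h + x)) = (\<integral>x. indicator A (h + x) * \<bar>f (h + x)\<bar> powr p \<partial>lborel)"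
    unfolding local_mass_def by (intro Bochner_Integration.integral_cong) (auto simp: indicator_def)
  also have "\<dots> = local_mass p A f"
    unfolding local_mass_def
    by (rule lborel_integral_translate[of "\<lambda>x. indicator A x * \<bar>f x\<bar> powr p"]) measurable
  finally show ?thesis .
qed

lemma local_mass_eq_0:
  assumes "\<And>x. x \<in> A \<Longrightarrow> f x = 0" shows "local_mass p A f = 0"
proof -
  have "(\<lambda>x. indicator A x * \<bar>f x\<bar> powr p) = (\<lambda>x. 0)" using assms by (auto simp: indicator_def)
  then show ?thesis by (simp add: local_mass_def)
qed

lemma local_mass_mono:
  assumes "test_fun \<Omega> f" "p > 0" "A \<in> sets borel" "B \<in> sets borel" "A \<subseteq> B"
  shows "local_mass p A f \<le> local_mass p B f"
  unfolding local_mass_def using assms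
  by (intro integral_mono local_mass_integrable[OF assms(1,2)]) (auto simp: indicator_def)

text \<open>The pointwise parallelogram identity for the gradients, integrated; it holds with
  equality.\<close>

lemma dirichlet_add_le:
  assumes "test_fun \<Omega> f" "test_fun \<Omega> g"
  shows "dirichlet (\<lambda>x. f x + g x) + dirichlet (\<lambda>x. f x - g x) = 2 * dirichlet f + 2 * dirichlet g"
proof -
  note s = assms[THEN test_fun_smooth]
  have "dirichlet (\<lambda>x. f x + g x) + dirichlet (\<lambda>x. f x - g x) =
     (\<integral>x. (norm (grad f x + grad g x))\<^sup>2 + (norm (grad f x - grad g x))\<^sup>2 \<partial>lborel)"
    using test_fun_integrable(2)[OF test_fun_add[OF assms]] test_fun_integrable(2)[OF test_fun_diff[OF assms]]
    by (simp add: dirichlet_def grad_add[OF s] grad_diff[OF s])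
  also have "\<dots> = (\<integral>x. 2 * (norm (grad f x))\<^sup>2 + 2 * (norm (grad g x))\<^sup>2 \<partial>lborel)"
    by (intro Bochner_Integration.integral_cong) (auto simp: power2_norm_eq_inner algebra_simps inner_commute)
  also have "\<dots> = 2 * dirichlet f + 2 * dirichlet g"
    using test_fun_integrable(2)[OF assms(1)] test_fun_integrable(2)[OF assms(2)] by (simp add: dirichlet_def)
  finally show ?thesis .
qed

section \<open>Local control on cubes, centering and tails\<close>

definition cube :: "real \<Rightarrow> (real^'n::finite) set" where
  "cube R = cbox (\<chi> i. -R) (\<chi> i. R)"

lemma mem_cube: "x \<in> cube R \<longleftrightarrow> (\<forall>i. \<bar>x $ i\<bar> \<le> R)"
  unfolding cube_def mem_box_cart by (simp add: abs_le_iff) (metis minus_le_iff)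

lemma cube_borel [measurable]: "cube R \<in> sets borel"
  by (simp add: cube_def)

lemma emeasure_cube:
  assumes "R \<ge> 0" shows "emeasure lborel (cube R :: (real^'n::finite) set) = ennreal ((2 * R) ^ CARD('n))"
proof -
  have "\<forall>i\<in>Basis. (\<chi> i. -R) \<bullet> i \<le> (\<chi> i. R :: real^'n) \<bullet> i"
    using assms by (auto simp: Basis_vec_def inner_axis)
  moreover have "(\<Prod>i\<in>Basis. ((\<chi> i. R) - (\<chi> i. -R) :: real^'n) \<bullet> i) = (\<Prod>i\<in>(Basis :: (real^'n) set). 2 * R)"
    by (intro prod.cong) (auto simp: Basis_vec_def inner_axis)
  ultimately show ?thesis unfolding cube_def by (subst emeasure_lborel_cbox) auto
qed

text \<open>\<open>f\<close> splits into its averaging error, which the energy controls with a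
  factor \<open>r\<^sup>2\<close>, and its averages. A bound on the averages at one fine scale
  therefore gives a local \<open>L^2\<close> bound, the substitute for the Rellich theorem.\<close>

lemma integral_square_cube_le:
  fixes f :: "real^'n::finite \<Rightarrow> real"
  assumes f: "test_fun \<Omega> f" and r: "r > 0" and R: "R \<ge> 0"
    and a: "\<And>x. x \<in> cube R \<Longrightarrow> \<bar>cell_avg r f x\<bar> \<le> a"
  shows "(\<integral>x. indicator (cube R) x * (f x)\<^sup>2 \<partial>lborel) \<le>
    2 * (2 ^ CARD('n) * (real CARD('n))\<^sup>2 * r\<^sup>2) * dirichlet f + 2 * a\<^sup>2 * (2 * R) ^ CARD('n)"
proof -
  have collect: "ennreal 2 * (ennreal c * ennreal d) + ennreal u * ennreal v = ennreal (2 * c * d + u * v)"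
    if "c \<ge> 0" "d \<ge> 0" "u \<ge> 0" "v \<ge> 0" for c d u v
    using that by (simp add: ennreal_mult mult.assoc)
  note [measurable] = test_fun_borel_measurable(1)[OF f]
  obtain C where C: "\<And>x. \<bar>f x\<bar> \<le> C" using test_fun_bounded[OF f] by metis
  let ?c = "2 ^ CARD('n) * (real CARD('n))\<^sup>2 * r\<^sup>2"
  have int: "integrable lborel (\<lambda>x. indicator (cube R) x * (f x)\<^sup>2)"
    by (intro integrable_indicator_mult test_fun_integrable[OF f]) auto
  have "ennreal (\<integral>x. indicator (cube R) x * (f x)\<^sup>2 \<partial>lborel)
      = (\<integral>\<^sup>+ x. ennreal (indicator (cube R) x * (f x)\<^sup>2) \<partial>lborel)"
    by (rule nn_integral_eq_integral[symmetric, OF int]) auto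
  also have "\<dots> \<le> (\<integral>\<^sup>+ x. ennreal 2 * ennreal ((f x - cell_avg r f x)\<^sup>2) + ennreal (2 * a\<^sup>2) * indicator (cube R) x \<partial>lborel)"
  proof (intro nn_integral_mono)
    fix x :: "real^'n"
    show "ennreal (indicator (cube R) x * (f x)\<^sup>2) \<le>
      ennreal 2 * ennreal ((f x - cell_avg r f x)\<^sup>2) + ennreal (2 * a\<^sup>2) * indicator (cube R) x"
    proof (cases "x \<in> cube R")
      case True
      have "(f x)\<^sup>2 = ((f x - cell_avg r f x) + cell_avg r f x)\<^sup>2" by simp
      also have "\<dots> \<le> 2 * (f x - cell_avg r f x)\<^sup>2 + 2 * (cell_avg r f x)\<^sup>2"
        using sum_squares_bound[of "f x - cell_avg r f x" "cell_avg r f x"] unfolding power2_sum by linarith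
      also have "\<dots> \<le> 2 * (f x - cell_avg r f x)\<^sup>2 + 2 * a\<^sup>2"
        using power_mono[OF a[OF True], of 2] by simp
      finally have "ennreal ((f x)\<^sup>2) \<le> ennreal (2 * (f x - cell_avg r f x)\<^sup>2 + 2 * a\<^sup>2)"
        by (rule ennreal_leI)
      then show ?thesis using True by (simp add: ennreal_mult')
    qed simp
  qed
  also have "\<dots> = ennreal 2 * (\<integral>\<^sup>+ x. ennreal ((f x - cell_avg r f x)\<^sup>2) \<partial>lborel) + ennreal (2 * a\<^sup>2) * emeasure lborel (cube R :: (real^'n) set)"
    by (subst nn_integral_add) (auto simp: nn_integral_cmult nn_integral_cmult_indicator)
  also have "\<dots> \<le> ennreal 2 * (ennreal ?c * ennreal (dirichlet f)) + ennreal (2 * a\<^sup>2) * ennreal ((2 * R) ^ CARD('n))"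
    using nn_integral_cell_avg_error_le[OF test_fun_smooth[OF f] C r]
    by (intro add_mono mult_left_mono) (auto simp: nn_integral_dirichlet[OF f] emeasure_cube[OF R])
  also have "\<dots> = ennreal (2 * ?c * dirichlet f + 2 * a\<^sup>2 * (2 * R) ^ CARD('n))"
    using dirichlet_nonneg[of f] R by (intro collect) auto
  finally show ?thesis
    using dirichlet_nonneg[of f] R by (subst (asm) ennreal_le_iff) auto
qed

text \<open>Split at the level \<open>T\<close> where \<open>T powr (p - q) = \<eta>\<close>: above
  it \<open>|t| powr (p - q) \<le> \<eta>\<close>, below it
  \<open>|t| powr (p - 2) \<le> T powr (p - 2)\<close>.\<close>

lemma abs_powr_le_interpolate:
  fixes p q \<eta> :: real
  assumes "2 < p" "p < q" "\<eta> > 0"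
  obtains C where "C > 0" "\<And>t :: real. \<bar>t\<bar> powr p \<le> \<eta> * \<bar>t\<bar> powr q + C * t\<^sup>2"
proof -
  define T where "T = \<eta> powr (1 / (p - q))"
  have T: "T > 0" "T powr (p - q) = \<eta>" using assms by (auto simp: T_def powr_powr)
  show ?thesis
  proof (rule that[of "T powr (p - 2)"])
    show "T powr (p - 2) > 0" using T by simp
    fix t :: real
    show "\<bar>t\<bar> powr p \<le> \<eta> * \<bar>t\<bar> powr q + T powr (p - 2) * t\<^sup>2"
    proof (cases "\<bar>t\<bar> \<le> T")
      case True
      have "\<bar>t\<bar> powr p = \<bar>t\<bar> powr (p - 2) * t\<^sup>2"
        using powr_add[of "\<bar>t\<bar>" "p - 2" 2] by (simp add: abs_powr_2)
      also have "\<dots> \<le> T powr (p - 2) * t\<^sup>2"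
        using True assms by (intro mult_right_mono powr_mono2) auto
      finally show ?thesis using assms by (simp add: add_increasing)
    next
      case False
      have "\<bar>t\<bar> powr p = \<bar>t\<bar> powr (p - q) * \<bar>t\<bar> powr q"
        using powr_add[of "\<bar>t\<bar>" "p - q" q] by simp
      also have "\<dots> \<le> T powr (p - q) * \<bar>t\<bar> powr q"
        using False assms T(1) by (intro mult_right_mono powr_mono2') auto
      finally show ?thesis using T by (simp add: add_increasing2)
    qed
  qed
qed

context cylinder begin

text \<open>In each unbounded direction the origin is a median of the mass up to a slack of 1. The
  slack avoids any appeal to continuity of the mass in the cutting position.\<close>

definition centered :: "(real^'n \<Rightarrow> real) \<Rightarrow> bool" where
  "centered f \<longleftrightarrow> (\<forall>i\<in>Z. 1 / 2 \<le> local_mass p {x. x $ i \<le> 1} f \<and> 1 / 2 \<le> local_mass p {x. -1 \<le> x $ i} f)"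

text \<open>An approximate median \<open>t\<close> is the supremum of the positions with at most
  half of the mass on their left. Only the free coordinates are shifted, so \<open>D\<close> is
  preserved.\<close>

lemma center:
  assumes \<phi>: "test_fun D \<phi>" "power_mass p \<phi> = 1"
  obtains \<psi> where "test_fun D \<psi>" "power_mass p \<psi> = 1" "dirichlet \<psi> = dirichlet \<phi>" "centered \<psi>"
proof -
  have p0: "p > 0" using p_gt_2 by simp
  note int = test_fun_integrable(3)[OF \<phi>(1) p0]
  obtain K where K: "compact K" "\<And>x. x \<notin> K \<Longrightarrow> \<phi> x = 0" using test_fun_support[OF \<phi>(1)] by metis
  obtain T where T: "\<And>x. x \<in> K \<Longrightarrow> norm x \<le> T" using compact_imp_bounded[OF K(1)] by (auto simp: bounded_iff)
  have Ti: "\<phi> x = 0" if "\<bar>x $ i\<bar> > T" for i x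
    using that component_le_norm_cart[of x i] T[of x] K(2)[of x] by fastforce
  have ex: "\<exists>t. 1 / 2 \<le> local_mass p {x. x $ i \<le> t + 1} \<phi> \<and> 1 / 2 \<le> local_mass p {x. t - 1 \<le> x $ i} \<phi>" for i
  proof -
    define M where "M t = local_mass p {x. x $ i \<le> t} \<phi>" for t
    have mono: "M s \<le> M t" if "s \<le> t" for s t
      unfolding M_def using that by (intro local_mass_mono[OF \<phi>(1) p0]) auto
    have lo: "M (- T - 1) = 0"
      unfolding M_def by (intro local_mass_eq_0 Ti[where i = i]) auto
    have "M T = power_mass p \<phi>"
      unfolding M_def local_mass_def power_mass_def
    proof (intro Bochner_Integration.integral_cong refl)
      fix x show "indicator {x. x $ i \<le> T} x * \<bar>\<phi> x\<bar> powr p = \<bar>\<phi> x\<bar> powr p"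
        using Ti[where i = i and x = x] by (cases "x $ i \<le> T") auto
    qed
    then have hi: "M T = 1" using \<phi>(2) by simp
    define A where "A = {t. M t \<le> 1 / 2}"
    have A: "A \<noteq> {}" "bdd_above A"
    proof -
      show "A \<noteq> {}" using lo by (auto simp: A_def intro: exI[of _ "- T - 1"])
      have "t \<le> T" if "t \<in> A" for t using that hi mono[of T t] by (force simp: A_def)
      then show "bdd_above A" by (auto simp: bdd_above_def)
    qed
    define t where "t = Sup A"
    have "t + 1 \<notin> A" using cSup_upper[OF _ A(2), of "t + 1"] by (auto simp: t_def)
    then have 1: "1 / 2 \<le> M (t + 1)" by (simp add: A_def)
    obtain s where "s \<in> A" "t - 1 < s" using less_cSupD[OF A(1), of "t - 1"] by (auto simp: t_def)
    then have 2: "M (t - 1) \<le> 1 / 2" using mono[of "t - 1" s] by (simp add: A_def)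
    have "1 \<le> M (t - 1) + local_mass p {x. t - 1 \<le> x $ i} \<phi>"
    proof -
      have "power_mass p \<phi> \<le> (\<integral>x. indicator {x. x $ i \<le> t - 1} x * \<bar>\<phi> x\<bar> powr p
          + indicator {x. t - 1 \<le> x $ i} x * \<bar>\<phi> x\<bar> powr p \<partial>lborel)"
        unfolding power_mass_def
        by (intro integral_mono int Bochner_Integration.integrable_add local_mass_integrable[OF \<phi>(1) p0])
          (auto simp: indicator_def)
      also have "\<dots> = M (t - 1) + local_mass p {x. t - 1 \<le> x $ i} \<phi>"
        unfolding M_def local_mass_def
        by (intro Bochner_Integration.integral_add local_mass_integrable[OF \<phi>(1) p0]) auto
      finally show ?thesis using \<phi>(2) by simp
    qed
    then show ?thesis using 1 2 unfolding M_def by (intro exI[of _ t]) auto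
  qed
  then obtain t where t: "\<And>i. 1 / 2 \<le> local_mass p {x. x $ i \<le> t i + 1} \<phi>"
    "\<And>i. 1 / 2 \<le> local_mass p {x. t i - 1 \<le> x $ i} \<phi>" by metis
  define h :: "real^'n" where "h = (\<chi> i. if i \<in> Z then t i else 0)"
  show ?thesis
  proof (rule that[of "\<lambda>x. \<phi> (h + x)"])
    show "test_fun D (\<lambda>x. \<phi> (h + x))"
    proof (rule test_fun_translate[OF \<phi>(1)])
      fix x assume "h + x \<in> D"
      then show "x \<in> D" using D_translate[of h x] by (simp add: h_def)
    qed
    show "power_mass p (\<lambda>x. \<phi> (h + x)) = 1" using power_mass_translate[OF \<phi>(1)] \<phi>(2) by simp
    show "dirichlet (\<lambda>x. \<phi> (h + x)) = dirichlet \<phi>" by (rule dirichlet_translate[OF \<phi>(1)])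
    have "1 / 2 \<le> local_mass p {x. x $ i \<le> 1} (\<lambda>x. \<phi> (h + x)) \<and>
       1 / 2 \<le> local_mass p {x. -1 \<le> x $ i} (\<lambda>x. \<phi> (h + x))" if "i \<in> Z" for i
    proof -
      have "{x. x $ i \<le> 1} = (+) h -` {x. x $ i \<le> t i + 1}" "{x. -1 \<le> x $ i} = (+) h -` {x. t i - 1 \<le> x $ i}"
        using that by (auto simp: h_def)
      then show ?thesis
        using t[of i] local_mass_translate[OF \<phi>(1), of "{x. x $ i \<le> t i + 1}" p h]
          local_mass_translate[OF \<phi>(1), of "{x. t i - 1 \<le> x $ i}" p h] by simp
    qed
    then show "centered (\<lambda>x. \<phi> (h + x))" by (simp add: centered_def)
  qed
qed

text \<open>In a free direction half of the mass lies on either side up to the slack, so a tail of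
  mass \<open>\<epsilon>\<close> at distance \<open>R1\<close> would be a forbidden splitting. In a
  bounded direction \<open>D\<close> itself ends. Two tails for each coordinate give the factor
  \<open>2 * CARD('n)\<close>.\<close>

lemma tight:
  assumes \<epsilon>: "0 < \<epsilon>" "\<epsilon> \<le> 1 / 2"
  obtains R \<delta> :: real where "R > 0" "\<delta> > 0"
    "\<And>\<psi>. test_fun D \<psi> \<Longrightarrow> power_mass p \<psi> = 1 \<Longrightarrow> dirichlet \<psi> \<le> level + \<delta> \<Longrightarrow> centered \<psi> \<Longrightarrow>
      local_mass p (- cube R) \<psi> \<le> 2 * real CARD('n) * \<epsilon>"
proof -
  have p0: "p > 0" using p_gt_2 by simp
  obtain R1 \<delta> where R1: "R1 > 0" "\<delta> > 0" and
    split: "\<And>\<phi> i c. test_fun D \<phi> \<Longrightarrow> power_mass p \<phi> = 1 \<Longrightarrow> dirichlet \<phi> \<le> level + \<delta> \<Longrightarrow>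
       \<epsilon> \<le> local_mass p {x. x $ i \<le> c} \<phi> \<Longrightarrow> local_mass p {x. c + R1 \<le> x $ i} \<phi> < \<epsilon>"
    using no_splitting[of \<epsilon>] \<epsilon> by auto
  define R where "R = max (R1 + 1) (b + 1)"
  have "local_mass p (- cube R) \<psi> \<le> 2 * real CARD('n) * \<epsilon>"
    if \<psi>: "test_fun D \<psi>" "power_mass p \<psi> = 1" "dirichlet \<psi> \<le> level + \<delta>" "centered \<psi>" for \<psi>
  proof -
    note I = local_mass_integrable[OF \<psi>(1) p0]
    have one: "local_mass p {x. R \<le> x $ i} \<psi> \<le> \<epsilon> \<and> local_mass p {x. x $ i \<le> - R} \<psi> \<le> \<epsilon>" for i
    proof (cases "i \<in> Z")
      case True
      have c: "1 / 2 \<le> local_mass p {x. x $ i \<le> 1} \<psi>" "1 / 2 \<le> local_mass p {x. -1 \<le> x $ i} \<psi>"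
        using \<psi>(4) True by (auto simp: centered_def)
      have "local_mass p {x. R \<le> x $ i} \<psi> \<le> local_mass p {x. 1 + R1 \<le> x $ i} \<psi>"
        by (intro local_mass_mono[OF \<psi>(1) p0]) (auto simp: R_def)
      moreover have "local_mass p {x. 1 + R1 \<le> x $ i} \<psi> < \<epsilon>"
        using c \<epsilon> by (intro split \<psi>) auto
      moreover have "local_mass p {x. x $ i \<le> - R} \<psi> \<le> local_mass p {x. x $ i \<le> - 1 - R1} \<psi>"
        by (intro local_mass_mono[OF \<psi>(1) p0]) (auto simp: R_def)
      moreover have "local_mass p {x. x $ i \<le> - 1 - R1} \<psi> < \<epsilon>"
      \<comment> \<open>\<open>split\<close> only excludes mass to the right of a given half-space,
        so it is applied to the left tail itself: the mass to the right of -1 would have to be below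
        \<open>\<epsilon>\<close>.\<close>
      proof (rule ccontr)
        assume "\<not> ?thesis"
        then have "local_mass p {x. (- 1 - R1) + R1 \<le> x $ i} \<psi> < \<epsilon>" by (intro split \<psi>) auto
        then show False using c \<epsilon> by simp
      qed
      ultimately show ?thesis by linarith
    next
      case False
      have 0: "\<psi> x = 0" if "R \<le> \<bar>x $ i\<bar>" for x
      proof -
        have "x \<notin> D" using D_bounded[of x i] False that by (auto simp: R_def)
        then show ?thesis using test_fun_support[OF \<psi>(1)] by (metis subsetD)
      qed
      have "local_mass p {x. R \<le> x $ i} \<psi> = 0" "local_mass p {x. x $ i \<le> - R} \<psi> = 0"
        by (intro local_mass_eq_0 0; simp)+
      then show ?thesis using \<epsilon> by simp
    qed
    have "local_mass p (- cube R) \<psi> \<le> (\<integral>x. (\<Sum>i\<in>UNIV. indicator {x. R \<le> x $ i} x * \<bar>\<psi> x\<bar> powr p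
        + indicator {x. x $ i \<le> - R} x * \<bar>\<psi> x\<bar> powr p) \<partial>lborel)"
      unfolding local_mass_def
    proof (intro integral_mono Bochner_Integration.integrable_sum Bochner_Integration.integrable_add I)
      fix x :: "real^'n"
      show "indicator (- cube R) x * \<bar>\<psi> x\<bar> powr p \<le> (\<Sum>i\<in>UNIV. indicator {x. R \<le> x $ i} x * \<bar>\<psi> x\<bar> powr p
        + indicator {x. x $ i \<le> - R} x * \<bar>\<psi> x\<bar> powr p)"
      proof (cases "x \<in> cube R")
        case False
        then obtain i where i: "\<not> \<bar>x $ i\<bar> \<le> R" by (auto simp: mem_cube)
        then have "\<bar>\<psi> x\<bar> powr p \<le> indicator {x. R \<le> x $ i} x * \<bar>\<psi> x\<bar> powr p
          + indicator {x. x $ i \<le> - R} x * \<bar>\<psi> x\<bar> powr p" by (auto simp: indicator_def)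
        also have "\<dots> \<le> (\<Sum>i\<in>UNIV. indicator {x. R \<le> x $ i} x * \<bar>\<psi> x\<bar> powr p
          + indicator {x. x $ i \<le> - R} x * \<bar>\<psi> x\<bar> powr p)"
          by (rule member_le_sum[of i UNIV "\<lambda>i. indicator {x. R \<le> x $ i} x * \<bar>\<psi> x\<bar> powr p
          + indicator {x. x $ i \<le> - R} x * \<bar>\<psi> x\<bar> powr p"]) auto
        finally show ?thesis using False by simp
      qed (auto intro!: sum_nonneg)
    qed auto
    also have "\<dots> = (\<Sum>i\<in>UNIV. local_mass p {x. R \<le> x $ i} \<psi> + local_mass p {x. x $ i \<le> - R} \<psi>)"
      unfolding local_mass_def
      by (subst Bochner_Integration.integral_sum) (auto intro!: sum.cong Bochner_Integration.integral_add Bochner_Integration.integrable_add I)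
    also have "\<dots> \<le> (\<Sum>i\<in>(UNIV::'n set). \<epsilon> + \<epsilon>)"
      using one by (intro sum_mono add_mono) auto
    finally show ?thesis by simp
  qed
  moreover have "R > 0" using R1 by (simp add: R_def)
  ultimately show ?thesis using that R1(2) by blast
qed

end

text \<open>Integrals over all grid cells of all sides \<open>1 / Suc j\<close>, a cell being named
  by integer multiples of its side. The index type is countable, as the diagonal subsequence
  requires.\<close>

definition cell_integral :: "nat \<times> ('n::finite \<Rightarrow> int) \<Rightarrow> (real^'n \<Rightarrow> real) \<Rightarrow> real" where
  "cell_integral jk f = (\<integral>y. indicator (cell (1 / real (Suc (fst jk))) (\<chi> i. of_int (snd jk i) / real (Suc (fst jk)))) y * f y \<partial>lborel)"

lemma cell_avg_eq_cell_integral: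
  fixes f :: "real^'n::finite \<Rightarrow> real"
  shows "cell_avg (1 / real (Suc j)) f x = cell_integral (j, \<lambda>i. \<lfloor>x $ i * real (Suc j)\<rfloor>) f * real (Suc j) ^ CARD('n)"
proof -
  have "cell (1 / real (Suc j)) x = cell (1 / real (Suc j)) (\<chi> i. of_int \<lfloor>x $ i * real (Suc j)\<rfloor> / real (Suc j))"
    by (simp add: cell_def)
  then have "cell_avg (1 / real (Suc j)) f x =
      cell_integral (j, \<lambda>i. \<lfloor>x $ i * real (Suc j)\<rfloor>) f / (1 / real (Suc j)) ^ CARD('n)"
    unfolding cell_avg_def cell_integral_def fst_conv snd_conv by (rule arg_cong)
  then show ?thesis by (simp only: power_one_over) simp
qed

lemma cell_integral_diff:
  assumes f: "test_fun \<Omega> f" and g: "test_fun \<Omega> g"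
  shows "cell_integral jk (\<lambda>x. f x - g x) = cell_integral jk f - cell_integral jk g"
proof -
  obtain C1 C2 where "\<And>x. \<bar>f x\<bar> \<le> C1" "\<And>x. \<bar>g x\<bar> \<le> C2" using test_fun_bounded f g by metis
  then have "integrable lborel (\<lambda>y. indicator (cell (1 / real (Suc (fst jk))) x) y * f y)"
    "integrable lborel (\<lambda>y. indicator (cell (1 / real (Suc (fst jk))) x) y * g y)" for x
    using test_fun_borel_measurable(1) f g by (auto intro!: indicator_cell_integrable)
  then show ?thesis unfolding cell_integral_def by (simp add: right_diff_distrib)
qed

text \<open>Cauchy-Schwarz on a cell of volume at most 1. The bound does not depend on the cell, so
  the Poincare inequality bounds all cell integrals of a minimizing sequence at once.\<close>

lemma cell_integral_bound:
  fixes f :: "real^'n::finite \<Rightarrow> real"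
  assumes f: "test_fun \<Omega> f"
  shows "\<bar>cell_integral jk f\<bar> \<le> power_mass 2 f + 1"
proof -
  define r where "r = 1 / real (Suc (fst jk))"
  define x :: "real^'n" where "x = (\<chi> i. of_int (snd jk i) / real (Suc (fst jk)))"
  have r: "r > 0" "r \<le> 1" by (auto simp: r_def)
  obtain C where C: "\<And>x. \<bar>f x\<bar> \<le> C" using test_fun_bounded f by metis
  have i1: "integrable lborel (\<lambda>y. indicator (cell r x) y * f y)"
    by (rule indicator_cell_integrable[OF test_fun_borel_measurable(1)[OF f] C r(1)])
  have i2: "integrable lborel (\<lambda>y. indicator (cell r x) y * (f y)\<^sup>2)"
    by (intro integrable_indicator_mult test_fun_integrable(1)[OF f]) simp
  have "(\<integral>y. indicator (cell r x) y * f y \<partial>lborel)\<^sup>2 \<le> r ^ CARD('n) * (\<integral>y. indicator (cell r x) y * (f y)\<^sup>2 \<partial>lborel)"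
    using square_integral_indicator_le[of "cell r x" lborel f] i1 i2 r
    by (simp add: measure_cell emeasure_cell)
  also have "\<dots> \<le> 1 * (\<integral>y. indicator (cell r x) y * (f y)\<^sup>2 \<partial>lborel)"
    using r by (intro mult_right_mono power_le_one integral_nonneg_AE) auto
  also have "\<dots> \<le> 1 * (\<integral>y. (f y)\<^sup>2 \<partial>lborel)"
    using i2 test_fun_integrable(1)[OF f] by (intro mult_left_mono integral_mono) (auto simp: indicator_def)
  also have "\<dots> = power_mass 2 f" by (simp add: power_mass_def abs_powr_2)
  finally have sq: "(cell_integral jk f)\<^sup>2 \<le> power_mass 2 f" by (simp add: cell_integral_def r_def x_def)
  have "2 * \<bar>cell_integral jk f\<bar> * 1 \<le> \<bar>cell_integral jk f\<bar>\<^sup>2 + 1\<^sup>2" by (rule sum_squares_bound)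
  then show ?thesis using sq power_mass_nonneg[of 2 f] by simp
qed

context cylinder begin

text \<open>Centering makes the tails uniformly small, a diagonal subsequence makes all cell
  integrals converge, and convergence of averages gives local \<open>L^2\<close> control. An
  exponent \<open>q\<close> between \<open>p\<close> and the critical one then interpolates from
  \<open>L^2\<close> to \<open>L^p\<close>.\<close>

theorem minimizing_sequence:
  obtains \<psi> where "\<And>n::nat. test_fun D (\<psi> n)" "\<And>n. power_mass p (\<psi> n) = 1" "(\<lambda>n. dirichlet (\<psi> n)) \<longlonglongrightarrow> level"
    "\<And>e. e > 0 \<Longrightarrow> \<exists>n0. \<forall>m\<ge>n0. \<forall>n\<ge>n0. power_mass p (\<lambda>x. \<psi> m x - \<psi> n x) \<le> e"
proof -
  have p0: "p > 0" using p_gt_2 by simp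
  have "\<exists>\<psi>. test_fun D \<psi> \<and> power_mass p \<psi> = 1 \<and> dirichlet \<psi> \<le> level + 1 / real (Suc n) \<and> centered \<psi>" for n
  proof -
    have "Inf {dirichlet \<phi> |\<phi>. test_fun D \<phi> \<and> power_mass p \<phi> = 1} < level + 1 / real (Suc n)"
      by (simp add: level_def)
    from cInf_lessD[OF _ this] normalized_test_fun_exists
    obtain \<phi> where \<phi>: "test_fun D \<phi>" "power_mass p \<phi> = 1" "dirichlet \<phi> < level + 1 / real (Suc n)" by blast
    then show ?thesis using center[OF \<phi>(1,2)] by (metis less_imp_le)
  qed
  then obtain \<psi> where \<psi>: "\<And>n. test_fun D (\<psi> n)" "\<And>n. power_mass p (\<psi> n) = 1"
    "\<And>n. dirichlet (\<psi> n) \<le> level + 1 / real (Suc n)" "\<And>n. centered (\<psi> n)" by metis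
  have d1: "dirichlet (\<psi> n) \<le> level + 1" for n
  proof -
    have "1 / real (Suc n) \<le> 1" by simp
    with \<psi>(3)[of n] show ?thesis by linarith
  qed
  have "norm (cell_integral jk (\<psi> n)) \<le> poincare_const * (level + 1) + 1" for n jk
    using cell_integral_bound[OF \<psi>(1), of jk n] order_trans[OF poincare[OF \<psi>(1), of n] mult_left_mono[OF d1[of n]]]
      poincare_const_pos by simp
  \<comment> \<open>Diagonal subsequence: for each of the countably many cells the bounded integrals
    converge along \<open>k\<close>.\<close>
  then obtain k where k: "strict_mono (k :: nat \<Rightarrow> nat)"
    "\<And>jk. jk \<in> UNIV \<Longrightarrow> \<exists>l. (\<lambda>n. cell_integral jk (\<psi> (k n))) \<longlonglongrightarrow> l"
    using function_convergent_subsequence[of "UNIV :: (nat \<times> ('n \<Rightarrow> int)) set" "\<lambda>n jk. cell_integral jk (\<psi> n)"]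
    by (metis uncountable_def countableI_type)
  then obtain L where L: "\<And>jk. (\<lambda>n. cell_integral jk (\<psi> (k n))) \<longlonglongrightarrow> L jk" by (metis UNIV_I)
  define \<omega> where "\<omega> n = \<psi> (k n)" for n
  have t\<omega>: "test_fun D (\<omega> n)" "power_mass p (\<omega> n) = 1" "centered (\<omega> n)" for n
    using \<psi> by (auto simp: \<omega>_def)
  have d\<omega>: "dirichlet (\<omega> n) \<le> level + 1" for n using d1 by (simp add: \<omega>_def)
  have dir\<omega>: "(\<lambda>n. dirichlet (\<omega> n)) \<longlonglongrightarrow> level"
  proof (rule tendsto_sandwich)
    show "\<forall>\<^sub>F n in sequentially. level \<le> dirichlet (\<omega> n)" using level_le t\<omega> by simp
    have "1 / real (Suc (k n)) \<le> 1 / real (Suc n)" for n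
      using seq_suble[OF k(1), of n] by (simp add: frac_le)
    then show "\<forall>\<^sub>F n in sequentially. dirichlet (\<omega> n) \<le> level + 1 / real (Suc n)"
      using \<psi>(3) unfolding \<omega>_def by (intro always_eventually allI) (meson add_left_mono order_trans)
    have "(\<lambda>n. level + 1 / real (Suc n)) \<longlonglongrightarrow> level + 0" by (intro tendsto_add tendsto_const LIMSEQ_Suc[OF lim_1_over_n])
    then show "(\<lambda>n. level + 1 / real (Suc n)) \<longlonglongrightarrow> level" by simp
  qed auto
  have "\<exists>n0. \<forall>m\<ge>n0. \<forall>n\<ge>n0. power_mass p (\<lambda>x. \<omega> m x - \<omega> n x) \<le> e" if e: "e > 0" for e
  proof -
    let ?N = "real CARD('n)"
    define pc where "pc = 2 * ?N / (?N - 2)"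
    \<comment> \<open>Strictly between \<open>p\<close> and the critical exponent, so that the
      Sobolev inequality still holds at \<open>q\<close>.\<close>
    define q where "q = (p + pc) / 2"
    have q: "p < q" "q < pc" "2 \<le> q" using p_lt p_gt_2 by (auto simp: q_def pc_def)
    \<comment> \<open>The parallelogram identity bounds the energy of a difference by
      \<open>2 * (level + 1) + 2 * (level + 1)\<close>.\<close>
    define K where "K = 4 * (level + 1)"
    have K: "K > 0" using level_pos by (simp add: K_def)
    obtain Cq where Cq: "Cq > 0" "\<And>\<phi>. test_fun D \<phi> \<Longrightarrow> dirichlet \<phi> \<le> K \<Longrightarrow> power_mass q \<phi> \<le> Cq"
      using sobolev[OF q(3) _ K] q(2) unfolding pc_def by blast
    obtain C2 where C2: "C2 > 0" "\<And>a b :: real. \<bar>a + b\<bar> powr p \<le> (1 + 1) * \<bar>a\<bar> powr p + C2 * \<bar>b\<bar> powr p"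
      using abs_add_powr_le[of p 1] p_gt_2 by auto
    have \<eta>0: "e / (4 * Cq) > 0" using e Cq(1) by simp
    obtain C\<eta> where C\<eta>: "C\<eta> > 0" "\<And>t :: real. \<bar>t\<bar> powr p \<le> e / (4 * Cq) * \<bar>t\<bar> powr q + C\<eta> * t\<^sup>2"
      using abs_powr_le_interpolate[OF p_gt_2 q(1) \<eta>0] by blast
    \<comment> \<open>\<open>e\<close> is spent in four equal shares: the tails outside the cube,
      the \<open>L^q\<close> term, the averaging error, and the cell averages. The constant
      \<open>X\<close> settles the first.\<close>
    define X where "X = 4 * (2 + C2) * (2 * ?N)"
    have X: "X > 0" unfolding X_def using C2(1) by (intro mult_pos_pos) auto
    define \<epsilon>1 where "\<epsilon>1 = min (1 / 2) (e / X)"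
    have "\<epsilon>1 \<le> 1 / 2" unfolding \<epsilon>1_def by (rule min.cobounded1)
    moreover have "0 < \<epsilon>1" unfolding \<epsilon>1_def using e X by simp
    ultimately have \<epsilon>1: "0 < \<epsilon>1" "\<epsilon>1 \<le> 1 / 2" by blast+
    have "\<epsilon>1 \<le> e / X" by (simp add: \<epsilon>1_def)
    then have "\<epsilon>1 * X \<le> e" using X by (simp add: pos_le_divide_eq)
    then have \<epsilon>1_le: "(2 + C2) * (2 * ?N * \<epsilon>1) \<le> e / 4" by (simp add: X_def algebra_simps)
    obtain R \<delta>1 where R: "R > 0" "\<delta>1 > 0" and
      tail: "\<And>\<psi>. test_fun D \<psi> \<Longrightarrow> power_mass p \<psi> = 1 \<Longrightarrow> dirichlet \<psi> \<le> level + \<delta>1 \<Longrightarrow> centered \<psi> \<Longrightarrow>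
        local_mass p (- cube R) \<psi> \<le> 2 * ?N * \<epsilon>1"
      using tight[OF \<epsilon>1] by metis
    define Cs where "Cs = C\<eta> * (2 * (2 ^ CARD('n) * ?N\<^sup>2) * K)"
    have Cs: "Cs > 0" using C\<eta>(1) K by (auto simp: Cs_def)
    obtain j where j: "inverse (real (Suc j)) < min 1 (e / (4 * Cs))"
      using reals_Archimedean[of "min 1 (e / (4 * Cs))"] e Cs by auto
    define r where "r = 1 / real (Suc j)"
    have r: "r > 0" "r \<le> 1" "r < e / (4 * Cs)" using j by (auto simp: r_def inverse_eq_divide)
    have "r\<^sup>2 \<le> r" using r by (simp add: power2_eq_square mult_left_le_one_le)
    then have "Cs * r\<^sup>2 \<le> Cs * (e / (4 * Cs))" using r Cs by (intro mult_left_mono) auto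
    then have rs: "Cs * r\<^sup>2 \<le> e / 4" using Cs by simp
    define V where "V = real (Suc j) ^ CARD('n)"
    have V: "V > 0" by (simp add: V_def)
    define a2 where "a2 = e / (4 * (C\<eta> * (2 * (2 * R) ^ CARD('n))))"
    have a2: "a2 > 0" using e C\<eta>(1) R(1) by (simp add: a2_def)
    define a where "a = sqrt a2"
    have a: "a > 0" "a\<^sup>2 = a2" using a2 by (auto simp: a_def)
    have aC: "C\<eta> * (2 * a\<^sup>2 * (2 * R) ^ CARD('n)) = e / 4"
      using C\<eta>(1) R(1) unfolding a(2) a2_def by simp
    \<comment> \<open>Contains the indices of all cells meeting \<open>cube R\<close>, with a margin
      of 1 for rounding; being finite, it allows one \<open>n0\<close> for all of them.\<close>
    define I where "I = PiE (UNIV :: 'n set) (\<lambda>_. {- \<lceil>R * real (Suc j)\<rceil> - 1 .. \<lceil>R * real (Suc j)\<rceil> + 1})"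
    have finI: "finite I" unfolding I_def by (intro finite_PiE) auto
    \<comment> \<open>The tolerance \<open>a / (2 * V)\<close> leaves \<open>a / V\<close> for a
      difference of two terms, and \<open>a\<close> after division by the cell volume
      \<open>1 / V\<close>.\<close>
    have "\<forall>\<^sub>F n in sequentially. \<forall>kk\<in>I. \<bar>cell_integral (j, kk) (\<omega> n) - L (j, kk)\<bar> < a / (2 * V)"
    proof (rule eventually_ball_finite[OF finI], rule ballI)
      fix kk assume "kk \<in> I"
      have "a / (2 * V) > 0" using a V by simp
      from tendstoD[OF L[of "(j, kk)"] this]
      show "\<forall>\<^sub>F n in sequentially. \<bar>cell_integral (j, kk) (\<omega> n) - L (j, kk)\<bar> < a / (2 * V)"
        by (simp add: \<omega>_def dist_real_def)
    qed
    moreover have "\<forall>\<^sub>F n in sequentially. dirichlet (\<omega> n) < level + \<delta>1"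
      using order_tendstoD(2)[OF dir\<omega>] R(2) by simp
    ultimately have "\<forall>\<^sub>F n in sequentially. dirichlet (\<omega> n) < level + \<delta>1 \<and>
        (\<forall>kk\<in>I. \<bar>cell_integral (j, kk) (\<omega> n) - L (j, kk)\<bar> < a / (2 * V))"
      by (simp add: eventually_conj)
    then obtain n0 where n0: "\<And>n. n \<ge> n0 \<Longrightarrow> dirichlet (\<omega> n) < level + \<delta>1"
      "\<And>n kk. n \<ge> n0 \<Longrightarrow> kk \<in> I \<Longrightarrow> \<bar>cell_integral (j, kk) (\<omega> n) - L (j, kk)\<bar> < a / (2 * V)"
      unfolding eventually_sequentially by blast
    have "power_mass p (\<lambda>x. \<omega> m x - \<omega> n x) \<le> e" if mn: "m \<ge> n0" "n \<ge> n0" for m n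
    proof -
      define f where "f x = \<omega> m x - \<omega> n x" for x
      have f: "test_fun D f" unfolding f_def[abs_def] by (intro test_fun_diff t\<omega>)
      have "v \<le> K" if "u + v = 2 * dirichlet (\<omega> m) + 2 * dirichlet (\<omega> n)" "0 \<le> u" for u v
        using that d\<omega>[of m] d\<omega>[of n] by (simp add: K_def)
      from this[OF dirichlet_add_le[OF t\<omega>(1) t\<omega>(1)] dirichlet_nonneg]
      have df: "dirichlet f \<le> K" unfolding f_def[abs_def] .
      have avg: "\<bar>cell_avg r f x\<bar> \<le> a" if x: "x \<in> cube R" for x
      proof -
        define kk where "kk = (\<lambda>i. \<lfloor>x $ i * real (Suc j)\<rfloor>)"
        have "kk i \<in> {- \<lceil>R * real (Suc j)\<rceil> - 1 .. \<lceil>R * real (Suc j)\<rceil> + 1}" for i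
        proof -
          have "\<bar>x $ i * real (Suc j)\<bar> \<le> R * real (Suc j)"
            unfolding abs_mult using x by (intro mult_mono) (auto simp: mem_cube)
          then show ?thesis unfolding kk_def atLeastAtMost_iff by linarith
        qed
        then have kk: "kk \<in> I" by (auto simp: I_def)
        have "cell_avg r f x = (cell_integral (j, kk) (\<omega> m) - cell_integral (j, kk) (\<omega> n)) * V"
          unfolding r_def V_def cell_avg_eq_cell_integral kk_def f_def[abs_def]
          by (subst cell_integral_diff[OF t\<omega>(1) t\<omega>(1)]) simp
        moreover have "\<bar>cell_integral (j, kk) (\<omega> m) - cell_integral (j, kk) (\<omega> n)\<bar> \<le> a / V"
          using n0(2)[OF mn(1) kk] n0(2)[OF mn(2) kk] V by (simp add: field_simps abs_less_iff abs_le_iff)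
        ultimately have "\<bar>cell_avg r f x\<bar> \<le> a / V * V"
          using V by (simp only: abs_mult abs_of_pos) (intro mult_right_mono, auto)
        then show ?thesis using V by simp
      qed
      have i2: "integrable lborel (\<lambda>x. indicator (cube R) x * (f x)\<^sup>2)"
        by (intro integrable_indicator_mult test_fun_integrable[OF f]) simp
      have iq: "integrable lborel (\<lambda>x. \<bar>f x\<bar> powr q)" using q by (intro test_fun_integrable[OF f]) auto
      have ip: "integrable lborel (\<lambda>x. indicator A x * \<bar>\<omega> n x\<bar> powr p)" if "A \<in> sets borel" for A n
        by (rule local_mass_integrable[OF t\<omega>(1) p0 that])
      have "power_mass p f \<le> (\<integral>x. (2 * (indicator (- cube R) x * \<bar>\<omega> m x\<bar> powr p)
          + C2 * (indicator (- cube R) x * \<bar>\<omega> n x\<bar> powr p))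
          + (e / (4 * Cq) * \<bar>f x\<bar> powr q + C\<eta> * (indicator (cube R) x * (f x)\<^sup>2)) \<partial>lborel)"
        unfolding power_mass_def
      proof (intro integral_mono Bochner_Integration.integrable_add integrable_mult_right ip i2 iq test_fun_integrable(3)[OF f p0])
        fix x
        show "\<bar>f x\<bar> powr p \<le> (2 * (indicator (- cube R) x * \<bar>\<omega> m x\<bar> powr p)
          + C2 * (indicator (- cube R) x * \<bar>\<omega> n x\<bar> powr p))
          + (e / (4 * Cq) * \<bar>f x\<bar> powr q + C\<eta> * (indicator (cube R) x * (f x)\<^sup>2))"
        proof (cases "x \<in> cube R")
          case True then show ?thesis using C\<eta>(2)[of "f x"] by simp
        next
          case False
          have "e / (4 * Cq) * \<bar>f x\<bar> powr q \<ge> 0" using \<eta>0 by (intro mult_nonneg_nonneg) auto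
          then show ?thesis using False C2(2)[of "\<omega> m x" "- \<omega> n x"] by (simp add: f_def)
        qed
      qed auto
      also have "\<dots> = (2 * local_mass p (- cube R) (\<omega> m) + C2 * local_mass p (- cube R) (\<omega> n))
          + (e / (4 * Cq) * power_mass q f + C\<eta> * (\<integral>x. indicator (cube R) x * (f x)\<^sup>2 \<partial>lborel))"
        unfolding local_mass_def power_mass_def using ip[of "- cube R"] i2 iq by simp
      also have "\<dots> \<le> e / 4 + (e / 4 + (e / 4 + e / 4))"
      proof (intro add_mono)
        have t: "local_mass p (- cube R) (\<omega> n) \<le> 2 * ?N * \<epsilon>1" if "n \<ge> n0" for n
          using n0(1)[OF that] by (intro tail t\<omega>) auto
        have "2 * local_mass p (- cube R) (\<omega> m) + C2 * local_mass p (- cube R) (\<omega> n)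
            \<le> 2 * (2 * ?N * \<epsilon>1) + C2 * (2 * ?N * \<epsilon>1)"
          using t[OF mn(1)] t[OF mn(2)] C2(1) by (intro add_mono mult_left_mono) auto
        then show "2 * local_mass p (- cube R) (\<omega> m) + C2 * local_mass p (- cube R) (\<omega> n) \<le> e / 4"
          using \<epsilon>1_le unfolding distrib_right by linarith
        have "e / (4 * Cq) * power_mass q f \<le> e / (4 * Cq) * Cq"
          using Cq(2)[OF f df] \<eta>0 by (intro mult_left_mono) auto
        then show "e / (4 * Cq) * power_mass q f \<le> e / 4" using Cq(1) by simp
        have "C\<eta> * (\<integral>x. indicator (cube R) x * (f x)\<^sup>2 \<partial>lborel) \<le>
          C\<eta> * (2 * (2 ^ CARD('n) * ?N\<^sup>2 * r\<^sup>2) * dirichlet f + 2 * a\<^sup>2 * (2 * R) ^ CARD('n))"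
          using C\<eta>(1) R(1) by (intro mult_left_mono integral_square_cube_le[OF f r(1) _ avg]) auto
        also have "\<dots> \<le> C\<eta> * (2 * (2 ^ CARD('n) * ?N\<^sup>2 * r\<^sup>2) * K + 2 * a\<^sup>2 * (2 * R) ^ CARD('n))"
          using C\<eta>(1) df by (intro mult_left_mono add_right_mono) auto
        also have "\<dots> = Cs * r\<^sup>2 + C\<eta> * (2 * a\<^sup>2 * (2 * R) ^ CARD('n))"
          by (simp add: Cs_def algebra_simps)
        also have "\<dots> \<le> e / 4 + e / 4" using rs aC by simp
        finally show "C\<eta> * (\<integral>x. indicator (cube R) x * (f x)\<^sup>2 \<partial>lborel) \<le> e / 4 + e / 4" .
      qed
      finally show ?thesis by (simp add: f_def[abs_def])
    qed
    then show ?thesis by blast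
  qed
  then show ?thesis using that[of \<omega>] t\<omega>(1,2) dir\<omega> by blast
qed

text \<open>Since \<open>level\<close> is approached along the midpoints as well, the parallelogram identity upgrades
  convergence in \<open>L^p\<close> to convergence of the gradients.\<close>

theorem minimizing_sequence_gradients:
  assumes \<psi>: "\<And>n::nat. test_fun D (\<psi> n)" "\<And>n. power_mass p (\<psi> n) = 1" "(\<lambda>n. dirichlet (\<psi> n)) \<longlonglongrightarrow> level"
    and cauchy: "\<And>e. e > 0 \<Longrightarrow> \<exists>n0. \<forall>m\<ge>n0. \<forall>n\<ge>n0. power_mass p (\<lambda>x. \<psi> m x - \<psi> n x) \<le> e"
    and e: "e > 0"
  shows "\<exists>n0. \<forall>m\<ge>n0. \<forall>n\<ge>n0. dirichlet (\<lambda>x. \<psi> m x - \<psi> n x) \<le> e"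
proof -
  have p0: "p > 0" using p_gt_2 by simp
  define \<gamma> where "\<gamma> = e / 16"
  have \<gamma>: "\<gamma> > 0" using e by (simp add: \<gamma>_def)
  \<comment> \<open>Chosen so that mass at least \<open>\<kappa>\<close> forces energy at least
    \<open>level * (level / (level + \<gamma>))\<close>, which is at least
    \<open>level - \<gamma>\<close>.\<close>
  define \<kappa> where "\<kappa> = (level / (level + \<gamma>)) powr (p / 2)"
  have \<kappa>0: "\<kappa> > 0" using level_pos \<gamma> by (auto simp: \<kappa>_def)
  have \<kappa>1: "\<kappa> < 1"
    unfolding \<kappa>_def using level_pos \<gamma> p0 powr_less_mono2[of "p / 2" "level / (level + \<gamma>)" 1] by simp
  \<comment> \<open>With this \<open>\<delta>\<close> the product
    \<open>(1 + \<delta>) * \<kappa>\<close> is the mean of \<open>\<kappa>\<close> and 1, which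
    leaves room for the mass of the difference.\<close>
  define \<delta> where "\<delta> = (1 / \<kappa> - 1) / 2"
  have \<delta>: "\<delta> > 0" using \<kappa>0 \<kappa>1 by (simp add: \<delta>_def)
  have \<kappa>\<delta>: "(1 + \<delta>) * \<kappa> < 1" using \<kappa>0 \<kappa>1 by (simp add: \<delta>_def field_simps)
  obtain C where C: "C > 0" "\<And>a b :: real. \<bar>a + b\<bar> powr p \<le> (1 + \<delta>) * \<bar>a\<bar> powr p + C * \<bar>b\<bar> powr p"
    using abs_add_powr_le[of p \<delta>] p_gt_2 \<delta> by auto
  obtain n1 where n1: "\<And>m n. m \<ge> n1 \<Longrightarrow> n \<ge> n1 \<Longrightarrow> power_mass p (\<lambda>x. \<psi> m x - \<psi> n x) \<le> (1 - (1 + \<delta>) * \<kappa>) / C"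
    using cauchy[of "(1 - (1 + \<delta>) * \<kappa>) / C"] \<kappa>\<delta> C(1) by auto
  obtain n2 where n2: "\<And>n. n \<ge> n2 \<Longrightarrow> dirichlet (\<psi> n) < level + \<gamma>"
    using order_tendstoD(2)[OF \<psi>(3), of "level + \<gamma>"] \<gamma> unfolding eventually_sequentially by auto
  have "dirichlet (\<lambda>x. \<psi> m x - \<psi> n x) \<le> e" if mn: "m \<ge> max n1 n2" "n \<ge> max n1 n2" for m n
  proof -
    define s where "s x = (1 / 2) * (\<psi> m x + \<psi> n x)" for x
    define d where "d x = (1 / 2) * (\<psi> m x - \<psi> n x)" for x
    have ts: "test_fun D s" unfolding s_def[abs_def] by (intro test_fun_cmult test_fun_add \<psi>)
    have td: "test_fun D d" unfolding d_def[abs_def] by (intro test_fun_cmult test_fun_diff \<psi>)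
    \<comment> \<open>\<open>\<psi> m\<close> is the midpoint \<open>s\<close> plus the half
      difference \<open>d\<close>; since \<open>d\<close> has small mass, the midpoint keeps mass at
      least \<open>\<kappa>\<close>.\<close>
    have "1 = power_mass p (\<psi> m)" using \<psi>(2) by simp
    also have "\<dots> \<le> (\<integral>x. (1 + \<delta>) * \<bar>s x\<bar> powr p + C * \<bar>d x\<bar> powr p \<partial>lborel)"
      unfolding power_mass_def
    proof (intro integral_mono Bochner_Integration.integrable_add integrable_mult_right
        test_fun_integrable(3)[OF ts p0] test_fun_integrable(3)[OF td p0] test_fun_integrable(3)[OF \<psi>(1) p0])
      fix x
      have "\<psi> m x = s x + d x" by (simp add: s_def d_def field_simps)
      then show "\<bar>\<psi> m x\<bar> powr p \<le> (1 + \<delta>) * \<bar>s x\<bar> powr p + C * \<bar>d x\<bar> powr p" using C(2)[of "s x" "d x"] by simp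
    qed
    also have "\<dots> = (1 + \<delta>) * power_mass p s + C * power_mass p d"
      unfolding power_mass_def using test_fun_integrable(3)[OF ts p0] test_fun_integrable(3)[OF td p0] by simp
    also have "C * power_mass p d \<le> C * ((1 - (1 + \<delta>) * \<kappa>) / C)"
    proof -
      have "power_mass p d = (1 / 2) powr p * power_mass p (\<lambda>x. \<psi> m x - \<psi> n x)"
        unfolding d_def[abs_def] power_mass_cmult by simp
      also have "\<dots> \<le> 1 * power_mass p (\<lambda>x. \<psi> m x - \<psi> n x)"
        using p0 power_mass_nonneg[of p "\<lambda>x. \<psi> m x - \<psi> n x"]
        by (intro mult_right_mono) (auto intro: powr_le1)
      also have "\<dots> \<le> (1 - (1 + \<delta>) * \<kappa>) / C" using n1 mn by simp
      finally show ?thesis using C(1) by (intro mult_left_mono) auto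
    qed
    also have "C * ((1 - (1 + \<delta>) * \<kappa>) / C) = 1 - (1 + \<delta>) * \<kappa>" using C(1) by simp
    finally have "(1 + \<delta>) * \<kappa> \<le> (1 + \<delta>) * power_mass p s" by simp
    then have ks: "\<kappa> \<le> power_mass p s" using \<delta> by simp
    have "level - \<gamma> \<le> level * (level / (level + \<gamma>))"
      using level_pos \<gamma> by (simp add: field_simps)
    also have "level / (level + \<gamma>) = \<kappa> powr (2 / p)"
      using level_pos \<gamma> p0 by (simp add: \<kappa>_def powr_powr)
    also have "level * \<kappa> powr (2 / p) \<le> level * power_mass p s powr (2 / p)"
      using level_pos ks \<kappa>0 p0 by (intro mult_left_mono powr_mono2) auto
    also have "\<dots> \<le> dirichlet s" by (rule level_inequality[OF ts])
    also have "\<dots> = dirichlet (\<lambda>x. \<psi> m x + \<psi> n x) / 4"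
      unfolding s_def[abs_def] by (subst dirichlet_cmult) (auto intro: test_fun_smooth[OF test_fun_add] \<psi> simp: power2_eq_square)
    finally have 1: "4 * (level - \<gamma>) \<le> dirichlet (\<lambda>x. \<psi> m x + \<psi> n x)" by simp
    have 2: "dirichlet (\<psi> m) < level + \<gamma>" "dirichlet (\<psi> n) < level + \<gamma>" using n2 mn by auto
    \<comment> \<open>The right side of the parallelogram identity is below
      \<open>4 * (level + \<gamma>)\<close>, so at most \<open>8 * \<gamma>\<close> remains for the
      difference.\<close>
    have "v \<le> 8 * \<gamma>" if "u + v = 2 * dirichlet (\<psi> m) + 2 * dirichlet (\<psi> n)" "4 * (level - \<gamma>) \<le> u" for u v
      using that 2 by (simp add: algebra_simps)
    from this[OF dirichlet_add_le[OF \<psi>(1) \<psi>(1)] 1]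
    have "dirichlet (\<lambda>x. \<psi> m x - \<psi> n x) \<le> 8 * \<gamma>" .
    then show ?thesis using e by (simp add: \<gamma>_def)
  qed
  then show ?thesis by blast
qed

end

section \<open>Existence of a minimizer\<close>

lemma nn_integral_Fatou_limit:
  fixes f :: "nat \<Rightarrow> 'a \<Rightarrow> real"
  assumes f: "\<And>n. f n \<in> borel_measurable M"
    and lim: "AE x in M. (\<lambda>n. f n x) \<longlonglongrightarrow> g x"
    and bound: "\<forall>\<^sub>F n in sequentially. (\<integral>\<^sup>+ x. ennreal (f n x) \<partial>M) \<le> ennreal (c n)" and c: "c \<longlonglongrightarrow> l"
  shows "(\<integral>\<^sup>+ x. ennreal (g x) \<partial>M) \<le> ennreal l"
proof -
  have "(\<integral>\<^sup>+ x. ennreal (g x) \<partial>M) \<le> (\<integral>\<^sup>+ x. liminf (\<lambda>n. ennreal (f n x)) \<partial>M)"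
  proof (rule nn_integral_mono_AE)
    show "AE x in M. ennreal (g x) \<le> liminf (\<lambda>n. ennreal (f n x))"
      using lim
    proof eventually_elim
      case (elim x)
      from lim_imp_Liminf[OF _ tendsto_ennrealI[OF elim]] show ?case by simp
    qed
  qed
  also have "\<dots> \<le> liminf (\<lambda>n. \<integral>\<^sup>+ x. ennreal (f n x) \<partial>M)"
    using f by (intro nn_integral_liminf) measurable
  also have "\<dots> \<le> liminf (\<lambda>n. ennreal (c n))" by (rule Liminf_mono[OF bound])
  also have "\<dots> = ennreal l" using lim_imp_Liminf[OF _ tendsto_ennrealI[OF c]] by simp
  finally show ?thesis .
qed

text \<open>Riesz-Fischer: a fast subsequence with squared errors \<open>(1 / 8) ^ k\<close> remains
  summable after weighting with \<open>4 ^ k\<close>, so almost everywhere consecutive terms differ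
  by at most a constant times \<open>(1 / 2) ^ k\<close>. Fatou's lemma passes from the subsequence
  to convergence of the whole sequence.\<close>

theorem L2_complete:
  fixes F :: "nat \<Rightarrow> 'a \<Rightarrow> 'b::euclidean_space"
  assumes F [measurable]: "\<And>n. F n \<in> borel_measurable M"
    and cauchy: "\<And>e::real. e > 0 \<Longrightarrow> \<exists>n0. \<forall>m\<ge>n0. \<forall>n\<ge>n0. (\<integral>\<^sup>+ x. ennreal ((norm (F m x - F n x))\<^sup>2) \<partial>M) \<le> ennreal e"
  obtains u r where "u \<in> borel_measurable M" "strict_mono (r :: nat \<Rightarrow> nat)"
    "AE x in M. (\<lambda>n. F (r n) x) \<longlonglongrightarrow> u x"
    "(\<lambda>n. \<integral>\<^sup>+ x. ennreal ((norm (F n x - u x))\<^sup>2) \<partial>M) \<longlonglongrightarrow> 0"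
proof -
  have "\<exists>n0. \<forall>m\<ge>n0. \<forall>n\<ge>n0. (\<integral>\<^sup>+ x. ennreal ((norm (F m x - F n x))\<^sup>2) \<partial>M) \<le> ennreal ((1 / 8) ^ k)" for k :: nat
    by (rule cauchy) simp
  then obtain N where "\<forall>k. \<forall>m\<ge>N k. \<forall>n\<ge>N k. (\<integral>\<^sup>+ x. ennreal ((norm (F m x - F n x))\<^sup>2) \<partial>M) \<le> ennreal ((1 / 8) ^ k)"
    by metis
  then have N: "\<And>k m n. m \<ge> N k \<Longrightarrow> n \<ge> N k \<Longrightarrow>
     (\<integral>\<^sup>+ x. ennreal ((norm (F m x - F n x))\<^sup>2) \<partial>M) \<le> ennreal ((1 / 8) ^ k)" by blast
  \<comment> \<open>Partial sums with \<open>Suc\<close> are strictly increasing and dominate each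
    \<open>N k\<close>.\<close>
  define r where "r k = (\<Sum>i\<le>k. Suc (N i))" for k
  have r: "strict_mono r" by (rule strict_monoI_Suc) (simp add: r_def)
  have rN: "r k \<ge> N k" for k
    unfolding r_def using member_le_sum[of k "{..k}" "\<lambda>i. Suc (N i)"] by simp
  define G where "G k x = norm (F (r (Suc k)) x - F (r k) x)" for k x
  have Gm [measurable]: "G k \<in> borel_measurable M" for k unfolding G_def[abs_def] by measurable
  have "(\<integral>\<^sup>+ x. (\<Sum>k. ennreal (4 ^ k) * ennreal ((G k x)\<^sup>2)) \<partial>M)
      = (\<Sum>k. \<integral>\<^sup>+ x. ennreal (4 ^ k) * ennreal ((G k x)\<^sup>2) \<partial>M)"
    by (rule nn_integral_suminf) measurable
  also have "\<dots> \<le> (\<Sum>k. ennreal ((1 / 2) ^ k))"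
  proof (intro suminf_le)
    fix k
    have "r (Suc k) \<ge> N k" using rN[of k] strict_mono_leD[OF r, of k "Suc k"] by simp
    then have "(\<integral>\<^sup>+ x. ennreal ((G k x)\<^sup>2) \<partial>M) \<le> ennreal ((1 / 8) ^ k)"
      unfolding G_def using rN by (intro N)
    then have "ennreal (4 ^ k) * (\<integral>\<^sup>+ x. ennreal ((G k x)\<^sup>2) \<partial>M) \<le> ennreal (4 ^ k) * ennreal ((1 / 8) ^ k)"
      by (intro mult_left_mono) auto
    also have "\<dots> = ennreal ((1 / 2) ^ k)"
      by (subst ennreal_mult'[symmetric]) (auto simp: power_mult_distrib[symmetric])
    finally show "(\<integral>\<^sup>+ x. ennreal (4 ^ k) * ennreal ((G k x)\<^sup>2) \<partial>M) \<le> ennreal ((1 / 2) ^ k)"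
      by (subst nn_integral_cmult) auto
  qed auto
  also have "\<dots> = ennreal (\<Sum>k. (1 / 2) ^ k)"
    by (intro suminf_ennreal_eq summable_sums summable_geometric) auto
  finally have "(\<integral>\<^sup>+ x. (\<Sum>k. ennreal (4 ^ k) * ennreal ((G k x)\<^sup>2)) \<partial>M) \<noteq> \<infinity>"
    by (auto simp: top_unique)
  then have fin: "AE x in M. (\<Sum>k. ennreal (4 ^ k) * ennreal ((G k x)\<^sup>2)) \<noteq> \<infinity>"
    by (intro nn_integral_PInf_AE) auto
  have conv: "AE x in M. convergent (\<lambda>n. F (r n) x)"
    using fin
  proof eventually_elim
    case (elim x)
    define C where "C = enn2real (\<Sum>k. ennreal (4 ^ k) * ennreal ((G k x)\<^sup>2))"
    have Gle: "G k x \<le> sqrt C * (1 / 2) ^ k" for k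
    proof -
      have "ennreal (4 ^ k) * ennreal ((G k x)\<^sup>2) \<le> (\<Sum>k. ennreal (4 ^ k) * ennreal ((G k x)\<^sup>2))"
        using sum_le_suminf[of "\<lambda>k. ennreal (4 ^ k) * ennreal ((G k x)\<^sup>2)" "{k}"] by simp
      also have "\<dots> = ennreal C" using elim by (simp add: C_def ennreal_enn2real_if)
      finally have "ennreal (4 ^ k * (G k x)\<^sup>2) \<le> ennreal C" by (simp add: ennreal_mult')
      then have "4 ^ k * (G k x)\<^sup>2 \<le> C" by (subst (asm) ennreal_le_iff) (auto simp: C_def)
      moreover have "(2 ^ k * G k x)\<^sup>2 = (2 ^ k * 2 ^ k) * (G k x)\<^sup>2" by (simp add: power2_eq_square)
      moreover have "2 ^ k * 2 ^ k = (4 :: real) ^ k" by (simp add: power_mult_distrib[symmetric])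
      ultimately have "(2 ^ k * G k x)\<^sup>2 \<le> C" by simp
      then have "2 ^ k * G k x \<le> sqrt C" by (rule real_le_rsqrt)
      then show ?thesis by (simp add: power_one_over field_simps)
    qed
    have "summable (\<lambda>k. F (r (Suc k)) x - F (r k) x)"
    proof (rule summable_comparison_test')
      show "summable (\<lambda>k. sqrt C * (1 / 2) ^ k)" by (intro summable_mult summable_geometric) simp
      show "norm (F (r (Suc k)) x - F (r k) x) \<le> sqrt C * (1 / 2) ^ k" for k
        using Gle[of k] unfolding G_def .
    qed
    then have "convergent (\<lambda>n. \<Sum>k<n. F (r (Suc k)) x - F (r k) x)" by (simp add: summable_iff_convergent)
    then have "convergent (\<lambda>n. F (r n) x - F (r 0) x)" by (simp only: sum_lessThan_telescope[of "\<lambda>n. F (r n) x"])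
    then have "convergent (\<lambda>n. F (r n) x - F (r 0) x + F (r 0) x)" by (intro convergent_add convergent_const)
    then show ?case by simp
  qed
  define u where "u x = lim (\<lambda>n. F (r n) x)" for x
  have um: "u \<in> borel_measurable M" unfolding u_def[abs_def] by measurable
  have lim: "AE x in M. (\<lambda>n. F (r n) x) \<longlonglongrightarrow> u x"
    using conv by eventually_elim (simp add: u_def convergent_LIMSEQ_iff)
  have "(\<lambda>n. \<integral>\<^sup>+ x. ennreal ((norm (F n x - u x))\<^sup>2) \<partial>M) \<longlonglongrightarrow> 0"
  proof (rule order_tendstoI)
    fix e :: ennreal assume "e > 0"
    then obtain e' where e': "0 < e'" "e' < e" using dense by blast
    then have "e' < \<infinity>" using less_top_ennreal order_less_trans by (metis infinity_ennreal_def top.not_eq_extremum)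
    define d where "d = enn2real e'"
    have d: "d > 0" "ennreal d < e"
      using e' \<open>e' < \<infinity>\<close> by (auto simp: d_def enn2real_positive_iff)
    obtain n0 where n0: "\<And>m n. m \<ge> n0 \<Longrightarrow> n \<ge> n0 \<Longrightarrow> (\<integral>\<^sup>+ x. ennreal ((norm (F m x - F n x))\<^sup>2) \<partial>M) \<le> ennreal d"
      using cauchy[OF d(1)] by blast
    have "(\<integral>\<^sup>+ x. ennreal ((norm (F m x - u x))\<^sup>2) \<partial>M) < e" if "m \<ge> n0" for m
    proof (rule le_less_trans[OF _ d(2)])
      show "(\<integral>\<^sup>+ x. ennreal ((norm (F m x - u x))\<^sup>2) \<partial>M) \<le> ennreal d"
      proof (rule nn_integral_Fatou_limit[where f = "\<lambda>n x. (norm (F m x - F (r n) x))\<^sup>2" and c = "\<lambda>n. d"])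
        show "AE x in M. (\<lambda>n. (norm (F m x - F (r n) x))\<^sup>2) \<longlonglongrightarrow> (norm (F m x - u x))\<^sup>2"
          using lim by eventually_elim (intro tendsto_intros)
        have "r n \<ge> n0" if "n \<ge> n0" for n using seq_suble[OF r, of n] that by simp
        then show "\<forall>\<^sub>F n in sequentially. (\<integral>\<^sup>+ x. ennreal ((norm (F m x - F (r n) x))\<^sup>2) \<partial>M) \<le> ennreal d"
          using n0 \<open>m \<ge> n0\<close> unfolding eventually_sequentially by blast
      qed auto
    qed
    then show "\<forall>\<^sub>F n in sequentially. (\<integral>\<^sup>+ x. ennreal ((norm (F n x - u x))\<^sup>2) \<partial>M) < e"
      unfolding eventually_sequentially by blast
  qed auto
  with um r lim show ?thesis using that by blast
qed

lemma integrable_square_norm_limit: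
  fixes A B :: "'a \<Rightarrow> 'b::euclidean_space"
  assumes [measurable]: "A \<in> borel_measurable M" "B \<in> borel_measurable M"
    and A: "integrable M (\<lambda>x. (norm (A x))\<^sup>2)" and fin: "(\<integral>\<^sup>+ x. ennreal ((norm (A x - B x))\<^sup>2) \<partial>M) < \<infinity>"
  shows "integrable M (\<lambda>x. (norm (A x - B x))\<^sup>2)" "integrable M (\<lambda>x. (norm (B x))\<^sup>2)"
proof -
  show D: "integrable M (\<lambda>x. (norm (A x - B x))\<^sup>2)"
    using fin by (intro integrableI_nonneg) auto
  show "integrable M (\<lambda>x. (norm (B x))\<^sup>2)"
  proof (rule Bochner_Integration.integrable_bound)
    show "integrable M (\<lambda>x. 2 * (norm (A x))\<^sup>2 + 2 * (norm (A x - B x))\<^sup>2)" using A D by simp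
    show "AE x in M. norm ((norm (B x))\<^sup>2) \<le> norm (2 * (norm (A x))\<^sup>2 + 2 * (norm (A x - B x))\<^sup>2)"
    proof (intro AE_I2)
      fix x
      have "norm (B x) \<le> norm (A x) + norm (A x - B x)"
        using norm_triangle_ineq4[of "A x" "A x - B x"] by simp
      then have "(norm (B x))\<^sup>2 \<le> (norm (A x) + norm (A x - B x))\<^sup>2" by (intro power_mono) auto
      also have "\<dots> \<le> 2 * (norm (A x))\<^sup>2 + 2 * (norm (A x - B x))\<^sup>2"
        using sum_squares_bound[of "norm (A x)" "norm (A x - B x)"] by (simp add: power2_sum)
      finally show "norm ((norm (B x))\<^sup>2) \<le> norm (2 * (norm (A x))\<^sup>2 + 2 * (norm (A x - B x))\<^sup>2)" by simp
    qed
  qed measurable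
qed

text \<open>The inequality \<open>| |A|^2 - |B|^2 | \<le> (1 + 1 / \<delta>) * |A - B|^2 + \<delta>
  * |B|^2\<close> reduces convergence of the squared norms to that of the differences;
  \<open>\<delta>\<close> is taken small against the integral of \<open>|B|^2\<close>.\<close>

lemma integral_square_norm_tendsto:
  fixes A :: "nat \<Rightarrow> 'a \<Rightarrow> 'b::euclidean_space"
  assumes [measurable]: "\<And>n. A n \<in> borel_measurable M" "B \<in> borel_measurable M"
    and A: "\<And>n. integrable M (\<lambda>x. (norm (A n x))\<^sup>2)"
    and B: "integrable M (\<lambda>x. (norm (B x))\<^sup>2)"
    and lim: "(\<lambda>n. \<integral>\<^sup>+ x. ennreal ((norm (A n x - B x))\<^sup>2) \<partial>M) \<longlonglongrightarrow> 0"
  shows "(\<lambda>n. \<integral>x. (norm (A n x))\<^sup>2 \<partial>M) \<longlonglongrightarrow> (\<integral>x. (norm (B x))\<^sup>2 \<partial>M)"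
proof (rule LIMSEQ_I)
  fix e :: real assume e: "e > 0"
  let ?b = "\<integral>x. (norm (B x))\<^sup>2 \<partial>M"
  have b: "?b \<ge> 0" by (intro integral_nonneg_AE) auto
  have "\<exists>\<delta>>0. \<delta> * \<beta> < e" if "\<beta> \<ge> 0" for \<beta>
    using that e by (intro exI[of _ "e / (\<beta> + 1)"]) (auto simp: field_simps)
  from this[OF b] obtain \<delta> where \<delta>: "\<delta> > 0" "\<delta> * ?b < e" by blast
  define K where "K = 1 + 1 / \<delta>"
  have K: "K > 0" using \<delta>(1) by (simp add: K_def add_pos_pos)
  have "(e - \<delta> * ?b) / K > 0" using K \<delta> by simp
  then have "ennreal ((e - \<delta> * ?b) / K) > 0" by (simp add: ennreal_less_zero_iff)
  from order_tendstoD(2)[OF lim this] obtain n0 where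
    n0: "\<And>n. n \<ge> n0 \<Longrightarrow> (\<integral>\<^sup>+ x. ennreal ((norm (A n x - B x))\<^sup>2) \<partial>M) < ennreal ((e - \<delta> * ?b) / K)"
    unfolding eventually_sequentially by blast
  have "norm ((\<integral>x. (norm (A n x))\<^sup>2 \<partial>M) - ?b) < e" if n: "n \<ge> n0" for n
  proof -
    have "(\<integral>\<^sup>+ x. ennreal ((norm (A n x - B x))\<^sup>2) \<partial>M) < \<infinity>"
      using order_less_le_trans[OF n0[OF n] top_greatest] by simp
    from integrable_square_norm_limit(1)[OF _ _ A this]
    have D: "integrable M (\<lambda>x. (norm (A n x - B x))\<^sup>2)" by simp
    have "ennreal (\<integral>x. (norm (A n x - B x))\<^sup>2 \<partial>M) < ennreal ((e - \<delta> * ?b) / K)"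
      using n0[OF n] by (subst (asm) nn_integral_eq_integral[OF D]) auto
    then have d: "(\<integral>x. (norm (A n x - B x))\<^sup>2 \<partial>M) < (e - \<delta> * ?b) / K"
      by (subst (asm) ennreal_less_iff) (auto intro!: integral_nonneg_AE)
    have "norm ((\<integral>x. (norm (A n x))\<^sup>2 \<partial>M) - ?b) = \<bar>\<integral>x. (norm (A n x))\<^sup>2 - (norm (B x))\<^sup>2 \<partial>M\<bar>"
      using A B by simp
    also have "\<dots> \<le> (\<integral>x. \<bar>(norm (A n x))\<^sup>2 - (norm (B x))\<^sup>2\<bar> \<partial>M)" by (rule integral_abs_bound)
    also have "\<dots> \<le> (\<integral>x. K * (norm (A n x - B x))\<^sup>2 + \<delta> * (norm (B x))\<^sup>2 \<partial>M)"
    proof (intro integral_mono)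
      fix x
      define s where "s = norm (A n x - B x)"
      define t where "t = norm (B x)"
      have st: "s \<ge> 0" "t \<ge> 0" by (auto simp: s_def t_def)
      have 1: "norm (A n x) \<le> t + s" using norm_triangle_ineq[of "B x" "A n x - B x"] by (simp add: s_def t_def)
      have 2: "t \<le> norm (A n x) + s" using norm_triangle_ineq4[of "A n x" "A n x - B x"] by (simp add: s_def t_def)
      have "\<bar>norm (A n x) - t\<bar> \<le> s" using 1 2 by linarith
      then have "\<bar>norm (A n x) - t\<bar> * (norm (A n x) + t) \<le> s * ((t + s) + t)"
        using 1 st by (intro mult_mono) auto
      moreover have "\<bar>(norm (A n x))\<^sup>2 - t\<^sup>2\<bar> = \<bar>norm (A n x) - t\<bar> * (norm (A n x) + t)"
        using st by (simp add: power2_eq_square square_diff_square_factored abs_mult mult.commute)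
      ultimately have "\<bar>(norm (A n x))\<^sup>2 - t\<^sup>2\<bar> \<le> s\<^sup>2 + 2 * (s * t)"
        by (simp add: power2_eq_square algebra_simps)
      also have "2 * (s * t) \<le> s\<^sup>2 / \<delta> + \<delta> * t\<^sup>2"
      proof -
        have "0 \<le> (s / sqrt \<delta> - sqrt \<delta> * t)\<^sup>2" by simp
        also have "\<dots> = s\<^sup>2 / \<delta> + \<delta> * t\<^sup>2 - 2 * (s * t)"
          using \<delta>(1) by (simp add: power2_diff power_divide power_mult_distrib)
        finally show ?thesis by simp
      qed
      finally show "\<bar>(norm (A n x))\<^sup>2 - (norm (B x))\<^sup>2\<bar> \<le> K * (norm (A n x - B x))\<^sup>2 + \<delta> * (norm (B x))\<^sup>2"
        by (simp add: K_def s_def t_def algebra_simps)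
    qed (use A B D in auto)
    also have "\<dots> = K * (\<integral>x. (norm (A n x - B x))\<^sup>2 \<partial>M) + \<delta> * ?b" using D B by simp
    also have "\<dots> < K * ((e - \<delta> * ?b) / K) + \<delta> * ?b"
      by (rule add_strict_right_mono[OF mult_strict_left_mono[OF d K]])
    finally show ?thesis using K by simp
  qed
  then show "\<exists>n0. \<forall>n\<ge>n0. norm ((\<integral>x. (norm (A n x))\<^sup>2 \<partial>M) - ?b) < e" by blast
qed

text \<open>Convexity of the power function. Young's inequality with conjugate exponents
  \<open>p\<close> and \<open>p / (p - 1)\<close> is the tangent inequality for absolute values;
  \<open>a * (a + c) \<le> |a| * |a + c|\<close> then restores the signs.\<close>

lemma abs_powr_tangent:
  fixes p a c :: real
  assumes p: "p > 1"
  shows "\<bar>a + c\<bar> powr p \<ge> \<bar>a\<bar> powr p + p * (\<bar>a\<bar> powr (p - 2) * a * c)"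
proof (cases "a = 0")
  case False
  define y where "y = \<bar>a\<bar>"
  define x where "x = \<bar>a + c\<bar>"
  have y: "y > 0" using False by (simp add: y_def)
  define q where "q = p / (p - 1)"
  have q: "q > 1" "1 / p + 1 / q = 1" "(p - 1) * q = p" "1 / q = (p - 1) / p" using p by (auto simp: q_def field_simps)
  have "x * y powr (p - 1) \<le> x powr p / p + (y powr (p - 1)) powr q / q"
    using p q y by (intro Youngs_inequality) (auto simp: x_def)
  also have "(y powr (p - 1)) powr q / q = y powr p * ((p - 1) / p)"
    unfolding powr_powr q(3) q(4)[symmetric] by simp
  finally have "p * (x * y powr (p - 1)) \<le> x powr p + y powr p * (p - 1)"
    using p by (simp add: field_simps)
  moreover have "y powr p = y * y powr (p - 1)" using y by (simp add: powr_diff)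
  ultimately have "x powr p \<ge> y powr p + p * (y powr (p - 1) * (x - y))" by (simp add: algebra_simps)
  moreover have "y powr (p - 1) * (x - y) \<ge> \<bar>a\<bar> powr (p - 2) * a * c"
  proof -
    have e: "y powr (p - 1) = y powr (p - 2) * y" using y powr_add[of y "p - 2" 1] by simp
    have "a * c \<le> y * (x - y)"
    proof -
      have "a * (a + c) \<le> \<bar>a\<bar> * \<bar>a + c\<bar>" by (metis abs_ge_self abs_mult)
      moreover have "a * a = y * y" by (simp add: y_def)
      moreover have "a * c = a * (a + c) - a * a" by (simp add: distrib_left)
      moreover have "y * (x - y) = \<bar>a\<bar> * \<bar>a + c\<bar> - y * y"
        unfolding right_diff_distrib by (simp add: x_def y_def)
      ultimately show ?thesis by simp
    qed
    then have "y powr (p - 2) * (a * c) \<le> y powr (p - 2) * (y * (x - y))" by (intro mult_left_mono) auto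
    then show ?thesis unfolding e by (simp add: y_def mult.assoc)
  qed
  ultimately show ?thesis using p mult_left_mono[of "\<bar>a\<bar> powr (p - 2) * a * c" "y powr (p - 1) * (x - y)" p]
    unfolding x_def y_def by linarith
qed simp

text \<open>Every factor is bounded through the larger of \<open>|a|\<close> and \<open>|c|\<close>,
  and the total degree is \<open>p\<close>.\<close>

lemma abs_powr_mult_le:
  fixes p a c :: real
  assumes "p > 2"
  shows "\<bar>\<bar>a\<bar> powr (p - 2) * a * c\<bar> \<le> \<bar>a\<bar> powr p + \<bar>c\<bar> powr p"
proof -
  define t where "t = max \<bar>a\<bar> \<bar>c\<bar>"
  have t: "t \<ge> 0" by (simp add: t_def)
  have "\<bar>\<bar>a\<bar> powr (p - 2) * a * c\<bar> = \<bar>a\<bar> powr (p - 2) * (\<bar>a\<bar> * \<bar>c\<bar>)" by (simp add: abs_mult)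
  also have "\<dots> \<le> t powr (p - 2) * (t * t)"
    using assms by (intro mult_mono powr_mono2) (auto simp: t_def le_max_iff_disj)
  also have "\<dots> = t powr p"
    using powr_add[of t "p - 2" 2] abs_powr_2[of t] t by (simp add: power2_eq_square)
  also have "\<dots> \<le> \<bar>a\<bar> powr p + \<bar>c\<bar> powr p"
    by (simp add: t_def max_def)
  finally show ?thesis .
qed

lemma integrable_inner_square:
  fixes f g :: "'a \<Rightarrow> 'b::euclidean_space"
  assumes [measurable]: "f \<in> borel_measurable M" "g \<in> borel_measurable M"
    and "integrable M (\<lambda>x. (norm (f x))\<^sup>2)" "integrable M (\<lambda>x. (norm (g x))\<^sup>2)"
  shows "integrable M (\<lambda>x. f x \<bullet> g x)"
proof (rule Bochner_Integration.integrable_bound)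
  show "integrable M (\<lambda>x. (norm (f x))\<^sup>2 + (norm (g x))\<^sup>2)" using assms by simp
  show "AE x in M. norm (f x \<bullet> g x) \<le> norm ((norm (f x))\<^sup>2 + (norm (g x))\<^sup>2)"
  proof (intro AE_I2)
    fix x
    have "\<bar>f x \<bullet> g x\<bar> \<le> norm (f x) * norm (g x)" by (rule Cauchy_Schwarz_ineq2)
    moreover have "2 * norm (f x) * norm (g x) \<le> (norm (f x))\<^sup>2 + (norm (g x))\<^sup>2" by (rule sum_squares_bound)
    moreover have "norm (f x) * norm (g x) \<ge> 0" by simp
    ultimately have "\<bar>f x \<bullet> g x\<bar> \<le> (norm (f x))\<^sup>2 + (norm (g x))\<^sup>2" by argo
    then show "norm (f x \<bullet> g x) \<le> norm ((norm (f x))\<^sup>2 + (norm (g x))\<^sup>2)" by simp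
  qed
qed measurable

text \<open>\<open>ennreal\<close> sends negative values to 0, so the right side integrates the
  positive part.\<close>

lemma ennreal_integral_le_nn_integral:
  fixes f :: "'a \<Rightarrow> real"
  assumes "integrable M f" shows "ennreal (\<integral>x. f x \<partial>M) \<le> (\<integral>\<^sup>+ x. ennreal (f x) \<partial>M)"
proof -
  have "(\<integral>x. f x \<partial>M) \<le> (\<integral>x. max 0 (f x) \<partial>M)" using assms by (intro integral_mono) auto
  then have "ennreal (\<integral>x. f x \<partial>M) \<le> (\<integral>\<^sup>+ x. ennreal (max 0 (f x)) \<partial>M)"
    using assms by (subst nn_integral_eq_integral) (auto intro: ennreal_leI)
  moreover have "ennreal (max 0 t) = ennreal t" for t :: real by (simp add: max_def ennreal_neg)
  ultimately show ?thesis by simp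
qed

lemma integrable_powr_test_product:
  fixes u f :: "'a \<Rightarrow> real" and p :: real
  assumes "p > 2" and [measurable]: "u \<in> borel_measurable M" "f \<in> borel_measurable M"
    and "integrable M (\<lambda>x. \<bar>u x\<bar> powr p)" "integrable M (\<lambda>x. \<bar>f x\<bar> powr p)"
  shows "integrable M (\<lambda>x. \<bar>u x\<bar> powr (p - 2) * u x * f x)"
proof (rule Bochner_Integration.integrable_bound)
  show "integrable M (\<lambda>x. \<bar>u x\<bar> powr p + \<bar>f x\<bar> powr p)" using assms by simp
  show "AE x in M. norm (\<bar>u x\<bar> powr (p - 2) * u x * f x) \<le> norm (\<bar>u x\<bar> powr p + \<bar>f x\<bar> powr p)"
    using abs_powr_mult_le[OF assms(1)] by (intro AE_I2) simp
qed measurable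

lemma nn_integral_cutoff_tendsto_0:
  fixes F :: "nat \<Rightarrow> 'a \<Rightarrow> 'b::euclidean_space"
  assumes "\<And>n x. x \<notin> D \<Longrightarrow> F n x = 0"
    and lim: "(\<lambda>n. \<integral>\<^sup>+ x. ennreal ((norm (F n x - u x))\<^sup>2) \<partial>M) \<longlonglongrightarrow> 0"
  shows "(\<lambda>n. \<integral>\<^sup>+ x. ennreal ((norm (F n x - (if x \<in> D then u x else 0)))\<^sup>2) \<partial>M) \<longlonglongrightarrow> 0"
proof (rule tendsto_sandwich[OF _ _ tendsto_const lim])
  show "\<forall>\<^sub>F n in sequentially. (\<integral>\<^sup>+ x. ennreal ((norm (F n x - (if x \<in> D then u x else 0)))\<^sup>2) \<partial>M)
      \<le> (\<integral>\<^sup>+ x. ennreal ((norm (F n x - u x))\<^sup>2) \<partial>M)"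
    using assms(1) by (intro always_eventually allI nn_integral_mono ennreal_leI) auto
qed auto

lemma ennreal_tendsto_0_finite:
  assumes "f \<longlonglongrightarrow> (0::ennreal)" shows "\<exists>n::nat. f n < \<infinity>"
  using order_tendstoD(2)[OF assms, of 1] unfolding eventually_sequentially
  by (metis ennreal_one_less_top infinity_ennreal_def le_refl less_trans zero_less_one)

context cylinder begin

text \<open>The sequence and its gradients converge in \<open>L^2\<close>, and Fatou's lemma gives
  terms arbitrarily close to \<open>u\<close> in \<open>L^p\<close>, so the constraint survives. For
  the equation the mass is never differentiated under the integral: convexity bounds the mass of
  \<open>u + t * \<phi>\<close> from below by \<open>1 + p * t * A\<close>, and the resulting
  one-variable inequality is an equality at \<open>t = 0\<close>.\<close>

theorem ground_state:
  obtains u w \<psi> where "u \<in> borel_measurable borel" "w \<in> borel_measurable borel"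
    "\<And>n::nat. test_fun D (\<psi> n)"
    "(\<lambda>n. \<integral>\<^sup>+ x. ennreal ((norm (\<psi> n x - u x))\<^sup>2) \<partial>lborel) \<longlonglongrightarrow> 0"
    "(\<lambda>n. \<integral>\<^sup>+ x. ennreal ((norm (grad (\<psi> n) x - w x))\<^sup>2) \<partial>lborel) \<longlonglongrightarrow> 0"
    "integrable lborel (\<lambda>x. (u x)\<^sup>2)" "integrable lborel (\<lambda>x. (norm (w x))\<^sup>2)"
    "integrable lborel (\<lambda>x. \<bar>u x\<bar> powr p)" "(\<integral>x. \<bar>u x\<bar> powr p \<partial>lborel) = 1"
    "\<And>\<phi>. test_fun D \<phi> \<Longrightarrow> (\<integral>x. w x \<bullet> grad \<phi> x \<partial>lborel) = level * (\<integral>x. \<bar>u x\<bar> powr (p - 2) * u x * \<phi> x \<partial>lborel)"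
    "\<And>x. x \<notin> D \<Longrightarrow> u x = 0" "\<And>x. x \<notin> D \<Longrightarrow> w x = 0"
proof -
  have p0: "p > 0" using p_gt_2 by simp
  obtain \<psi> where \<psi>: "\<And>n::nat. test_fun D (\<psi> n)" "\<And>n. power_mass p (\<psi> n) = 1" "(\<lambda>n. dirichlet (\<psi> n)) \<longlonglongrightarrow> level"
    and cp: "\<And>e. e > 0 \<Longrightarrow> \<exists>n0. \<forall>m\<ge>n0. \<forall>n\<ge>n0. power_mass p (\<lambda>x. \<psi> m x - \<psi> n x) \<le> e"
    using minimizing_sequence by blast
  have cg: "\<exists>n0. \<forall>m\<ge>n0. \<forall>n\<ge>n0. dirichlet (\<lambda>x. \<psi> m x - \<psi> n x) \<le> e" if "e > 0" for e
    by (rule minimizing_sequence_gradients[OF \<psi> cp that])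
  note s\<psi> = test_fun_smooth[OF \<psi>(1)]
  note d\<psi> = test_fun_diff[OF \<psi>(1) \<psi>(1)]
  have m\<psi> [measurable]: "\<psi> n \<in> borel_measurable borel" "grad (\<psi> n) \<in> borel_measurable borel" for n
    using test_fun_borel_measurable[OF \<psi>(1)] by blast+
  have out: "\<psi> n x = 0" "grad (\<psi> n) x = 0" if "x \<notin> D" for n x
    using test_fun_support[OF \<psi>(1)[of n]] that by (metis subsetD)+
  have gradC: "\<exists>n0. \<forall>m\<ge>n0. \<forall>n\<ge>n0. (\<integral>\<^sup>+ x. ennreal ((norm (grad (\<psi> m) x - grad (\<psi> n) x))\<^sup>2) \<partial>lborel) \<le> ennreal e"
    if "e > 0" for e :: real
  proof -
    have "(\<integral>\<^sup>+ x. ennreal ((norm (grad (\<psi> m) x - grad (\<psi> n) x))\<^sup>2) \<partial>lborel) = ennreal (dirichlet (\<lambda>x. \<psi> m x - \<psi> n x))" for m n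
      using nn_integral_dirichlet[OF d\<psi>[of m n]] by (simp add: grad_diff[OF s\<psi> s\<psi>])
    then show ?thesis using cg[OF that] ennreal_leI by metis
  qed
  have funC: "\<exists>n0. \<forall>m\<ge>n0. \<forall>n\<ge>n0. (\<integral>\<^sup>+ x. ennreal ((norm (\<psi> m x - \<psi> n x))\<^sup>2) \<partial>lborel) \<le> ennreal e"
    if "e > 0" for e :: real
  proof -
    have "(\<integral>\<^sup>+ x. ennreal ((norm (\<psi> m x - \<psi> n x))\<^sup>2) \<partial>lborel) \<le> ennreal (poincare_const * dirichlet (\<lambda>x. \<psi> m x - \<psi> n x))" for m n
      using nn_integral_power_mass[OF d\<psi>[of m n], of 2] ennreal_leI[OF poincare[OF d\<psi>[of m n]]] by (simp add: abs_powr_2)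
    moreover have "e / poincare_const > 0" using that poincare_const_pos by simp
    from cg[OF this] obtain n0 where "\<forall>m\<ge>n0. \<forall>n\<ge>n0. dirichlet (\<lambda>x. \<psi> m x - \<psi> n x) \<le> e / poincare_const"
      by blast
    then have "\<forall>m\<ge>n0. \<forall>n\<ge>n0. poincare_const * dirichlet (\<lambda>x. \<psi> m x - \<psi> n x) \<le> e"
      using poincare_const_pos by (simp add: pos_le_divide_eq mult.commute)
    ultimately show ?thesis by (meson ennreal_leI order_trans)
  qed
  obtain u0 r where u0 [measurable]: "u0 \<in> borel_measurable lborel" and r: "strict_mono (r :: nat \<Rightarrow> nat)"
    and ae0: "AE x in lborel. (\<lambda>n. \<psi> (r n) x) \<longlonglongrightarrow> u0 x"
    and lim0: "(\<lambda>n. \<integral>\<^sup>+ x. ennreal ((norm (\<psi> n x - u0 x))\<^sup>2) \<partial>lborel) \<longlonglongrightarrow> 0"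
    using L2_complete[of \<psi> lborel, OF _ funC] by auto
  obtain w0 where w0 [measurable]: "w0 \<in> borel_measurable lborel"
    and wlim0: "(\<lambda>n. \<integral>\<^sup>+ x. ennreal ((norm (grad (\<psi> n) x - w0 x))\<^sup>2) \<partial>lborel) \<longlonglongrightarrow> 0"
    using L2_complete[of "\<lambda>n. grad (\<psi> n)" lborel, OF _ gradC] by auto
  have D [measurable]: "D \<in> sets borel" using open_D by simp
  \<comment> \<open>Setting the limits to 0 off \<open>D\<close> keeps them limits, because all
    \<open>\<psi> n\<close> vanish there, and secures the support everywhere rather than almost
    everywhere.\<close>
  define u where "u x = (if x \<in> D then u0 x else 0)" for x
  define w where "w x = (if x \<in> D then w0 x else 0)" for x
  have um [measurable]: "u \<in> borel_measurable borel" and wm [measurable]: "w \<in> borel_measurable borel"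
    using u0 w0 unfolding u_def[abs_def] w_def[abs_def] by measurable
  have ulim: "(\<lambda>n. \<integral>\<^sup>+ x. ennreal ((norm (\<psi> n x - u x))\<^sup>2) \<partial>lborel) \<longlonglongrightarrow> 0"
    unfolding u_def by (rule nn_integral_cutoff_tendsto_0[OF out(1) lim0])
  have wlim: "(\<lambda>n. \<integral>\<^sup>+ x. ennreal ((norm (grad (\<psi> n) x - w x))\<^sup>2) \<partial>lborel) \<longlonglongrightarrow> 0"
    unfolding w_def by (rule nn_integral_cutoff_tendsto_0[OF out(2) wlim0])
  have ae: "AE x in lborel. (\<lambda>n. \<psi> (r n) x) \<longlonglongrightarrow> u x"
    using ae0 by eventually_elim (auto simp: u_def out)
  obtain n1 where n1: "(\<integral>\<^sup>+ x. ennreal ((norm (\<psi> n1 x - u x))\<^sup>2) \<partial>lborel) < \<infinity>" using ennreal_tendsto_0_finite[OF ulim] by blast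
  obtain n2 where n2: "(\<integral>\<^sup>+ x. ennreal ((norm (grad (\<psi> n2) x - w x))\<^sup>2) \<partial>lborel) < \<infinity>" using ennreal_tendsto_0_finite[OF wlim] by blast
  have u2: "integrable lborel (\<lambda>x. (u x)\<^sup>2)"
    using integrable_square_norm_limit(2)[OF _ _ _ n1] test_fun_integrable(1)[OF \<psi>(1)] by simp
  have w2: "integrable lborel (\<lambda>x. (norm (w x))\<^sup>2)"
    using integrable_square_norm_limit(2)[OF _ _ _ n2] test_fun_integrable(2)[OF \<psi>(1)] by simp
  have Lp: "\<exists>m. integrable lborel (\<lambda>x. \<bar>\<psi> m x - u x\<bar> powr p) \<and> (\<integral>x. \<bar>\<psi> m x - u x\<bar> powr p \<partial>lborel) \<le> e" if e: "e > 0" for e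
  proof -
    obtain m where m: "\<And>n. n \<ge> m \<Longrightarrow> power_mass p (\<lambda>x. \<psi> m x - \<psi> n x) \<le> e" using cp[OF e] by blast
    have le: "(\<integral>\<^sup>+ x. ennreal (\<bar>\<psi> m x - u x\<bar> powr p) \<partial>lborel) \<le> ennreal e"
    proof (rule nn_integral_Fatou_limit[where f = "\<lambda>n x. \<bar>\<psi> m x - \<psi> (r n) x\<bar> powr p" and c = "\<lambda>n. e"])
      show "AE x in lborel. (\<lambda>n. \<bar>\<psi> m x - \<psi> (r n) x\<bar> powr p) \<longlonglongrightarrow> \<bar>\<psi> m x - u x\<bar> powr p"
        using ae by eventually_elim (use p0 in \<open>auto intro!: tendsto_powr' tendsto_intros\<close>)
      have "(\<integral>\<^sup>+ x. ennreal (\<bar>\<psi> m x - \<psi> (r n) x\<bar> powr p) \<partial>lborel) \<le> ennreal e" if "n \<ge> m" for n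
        unfolding nn_integral_power_mass[OF d\<psi> p0] using seq_suble[OF r, of n] that
        by (intro ennreal_leI m) simp
      then show "\<forall>\<^sub>F n in sequentially. (\<integral>\<^sup>+ x. ennreal (\<bar>\<psi> m x - \<psi> (r n) x\<bar> powr p) \<partial>lborel) \<le> ennreal e"
        unfolding eventually_sequentially by blast
    qed auto
    then have i: "integrable lborel (\<lambda>x. \<bar>\<psi> m x - u x\<bar> powr p)"
      by (intro integrableI_nonneg) (auto simp: less_top[symmetric] top_unique)
    have "(\<integral>x. \<bar>\<psi> m x - u x\<bar> powr p \<partial>lborel) \<le> e"
      using le e by (subst (asm) nn_integral_eq_integral[OF i]) (auto simp: ennreal_le_iff)
    with i show ?thesis by blast
  qed
  \<comment> \<open>Lower semicontinuity of the mass along the almost everywhere convergent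
    subsequence, for \<open>u\<close> itself with \<open>t = 0\<close> and for its
    variations.\<close>
  have Fatou: "(\<integral>\<^sup>+ x. ennreal (\<bar>u x + t * f x\<bar> powr p) \<partial>lborel) \<le> ennreal l"
    if f: "test_fun D f" and c: "\<And>n. power_mass p (\<lambda>x. \<psi> n x + t * f x) \<le> c n" "c \<longlonglongrightarrow> l" for f t c l
  proof (rule nn_integral_Fatou_limit[where f = "\<lambda>n x. \<bar>\<psi> (r n) x + t * f x\<bar> powr p" and c = "\<lambda>n. c (r n)"])
    note [measurable] = test_fun_borel_measurable(1)[OF f]
    show "(\<lambda>x. \<bar>\<psi> (r n) x + t * f x\<bar> powr p) \<in> borel_measurable lborel" for n by measurable
    show "AE x in lborel. (\<lambda>n. \<bar>\<psi> (r n) x + t * f x\<bar> powr p) \<longlonglongrightarrow> \<bar>u x + t * f x\<bar> powr p"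
      using ae by eventually_elim (use p0 in \<open>auto intro!: tendsto_powr' tendsto_intros\<close>)
    show "\<forall>\<^sub>F n in sequentially. (\<integral>\<^sup>+ x. ennreal (\<bar>\<psi> (r n) x + t * f x\<bar> powr p) \<partial>lborel) \<le> ennreal (c (r n))"
      using c(1) by (intro always_eventually allI)
        (simp add: nn_integral_power_mass[OF test_fun_add[OF \<psi>(1) test_fun_cmult[OF f]] p0] ennreal_leI)
    show "(\<lambda>n. c (r n)) \<longlonglongrightarrow> l" using LIMSEQ_subseq_LIMSEQ[OF c(2) r] by (simp add: o_def)
  qed
  have up: "(\<integral>\<^sup>+ x. ennreal (\<bar>u x\<bar> powr p) \<partial>lborel) \<le> ennreal 1"
    using Fatou[OF test_fun_zero, of 0 "\<lambda>n. 1" 1] \<psi>(2) by simp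
  have ip: "integrable lborel (\<lambda>x. \<bar>u x\<bar> powr p)"
    using up by (intro integrableI_nonneg) (auto simp: less_top[symmetric] top_unique)
  have up': "(\<integral>x. \<bar>u x\<bar> powr p \<partial>lborel) \<le> 1"
    using up by (subst (asm) nn_integral_eq_integral[OF ip]) (auto simp: ennreal_le_1)
  \<comment> \<open>Near-triangle inequality around \<open>u\<close>: a nearby
    \<open>\<psi> m\<close> has mass 1, so \<open>u\<close> cannot have lost mass.\<close>
  have lo: "1 \<le> (1 + \<delta>) * (\<integral>x. \<bar>u x\<bar> powr p \<partial>lborel)" if \<delta>: "\<delta> > 0" for \<delta>
  proof (rule field_le_epsilon)
    fix e :: real assume e: "e > 0"
    obtain C where C: "C > 0" "\<And>a b :: real. \<bar>a + b\<bar> powr p \<le> (1 + \<delta>) * \<bar>a\<bar> powr p + C * \<bar>b\<bar> powr p"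
      using abs_add_powr_le[of p \<delta>] p_gt_2 \<delta> by auto
    obtain m where m: "integrable lborel (\<lambda>x. \<bar>\<psi> m x - u x\<bar> powr p)" "(\<integral>x. \<bar>\<psi> m x - u x\<bar> powr p \<partial>lborel) \<le> e / C"
      using Lp[of "e / C"] e C(1) by auto
    have "1 = power_mass p (\<psi> m)" using \<psi>(2) by simp
    also have "\<dots> \<le> (\<integral>x. (1 + \<delta>) * \<bar>u x\<bar> powr p + C * \<bar>\<psi> m x - u x\<bar> powr p \<partial>lborel)"
      unfolding power_mass_def
      using C(2)[of "u x" "\<psi> m x - u x" for x]
      by (intro integral_mono Bochner_Integration.integrable_add integrable_mult_right ip m(1) test_fun_integrable(3)[OF \<psi>(1) p0]) simp
    also have "\<dots> = (1 + \<delta>) * (\<integral>x. \<bar>u x\<bar> powr p \<partial>lborel) + C * (\<integral>x. \<bar>\<psi> m x - u x\<bar> powr p \<partial>lborel)"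
      using ip m(1) by simp
    also have "\<dots> \<le> (1 + \<delta>) * (\<integral>x. \<bar>u x\<bar> powr p \<partial>lborel) + C * (e / C)"
      using m(2) C(1) by (intro add_left_mono mult_left_mono) auto
    finally show "1 \<le> (1 + \<delta>) * (\<integral>x. \<bar>u x\<bar> powr p \<partial>lborel) + e" using C(1) by simp
  qed
  have "1 \<le> (\<integral>x. \<bar>u x\<bar> powr p \<partial>lborel)"
  proof (rule field_le_epsilon)
    fix e :: real assume e: "e > 0"
    have "1 \<le> (\<integral>x. \<bar>u x\<bar> powr p \<partial>lborel) + e * (\<integral>x. \<bar>u x\<bar> powr p \<partial>lborel)"
      using lo[OF e] by (simp only: distrib_right mult_1)
    also have "\<dots> \<le> (\<integral>x. \<bar>u x\<bar> powr p \<partial>lborel) + e * 1"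
      using up' e by (intro add_left_mono mult_left_mono) auto
    finally show "1 \<le> (\<integral>x. \<bar>u x\<bar> powr p \<partial>lborel) + e" by simp
  qed
  with up' have one: "(\<integral>x. \<bar>u x\<bar> powr p \<partial>lborel) = 1" by simp
  have "(\<integral>x. w x \<bullet> grad \<phi> x \<partial>lborel) = level * (\<integral>x. \<bar>u x\<bar> powr (p - 2) * u x * \<phi> x \<partial>lborel)"
    if \<phi>: "test_fun D \<phi>" for \<phi>
  proof -
    note [measurable] = test_fun_borel_measurable[OF \<phi>]
    define A where "A = (\<integral>x. \<bar>u x\<bar> powr (p - 2) * u x * \<phi> x \<partial>lborel)"
    define B where "B = (\<integral>x. w x \<bullet> grad \<phi> x \<partial>lborel)"
    define C where "C = dirichlet \<phi>"
    define W where "W t = (\<integral>x. (norm (w x + t *\<^sub>R grad \<phi> x))\<^sup>2 \<partial>lborel)" for t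
    have t\<phi>: "test_fun D (\<lambda>x. \<psi> n x + t * \<phi> x)" for n t
      by (intro test_fun_add test_fun_cmult \<psi> \<phi>)
    have gr: "grad (\<lambda>x. \<psi> n x + t * \<phi> x) x = grad (\<psi> n) x + t *\<^sub>R grad \<phi> x" for n t x
      using grad_add[OF s\<psi> smooth_fun_cmult[OF test_fun_smooth[OF \<phi>]]] grad_cmult[OF test_fun_smooth[OF \<phi>]] by simp
    have iwg: "integrable lborel (\<lambda>x. w x \<bullet> grad \<phi> x)"
      by (intro integrable_inner_square w2 test_fun_integrable(2)[OF \<phi>]) auto
    have iA: "integrable lborel (\<lambda>x. \<bar>u x\<bar> powr (p - 2) * u x * \<phi> x)"
      by (intro integrable_powr_test_product p_gt_2 ip test_fun_integrable(3)[OF \<phi> p0]) auto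
    have expand: "(norm (w x + t *\<^sub>R grad \<phi> x))\<^sup>2 =
        (norm (w x))\<^sup>2 + (2 * t) * (w x \<bullet> grad \<phi> x) + t\<^sup>2 * (norm (grad \<phi> x))\<^sup>2" for t x
      unfolding power2_norm_eq_inner
      by (simp add: inner_add_left inner_add_right inner_commute power2_eq_square algebra_simps)
    have iW: "integrable lborel (\<lambda>x. (norm (w x + t *\<^sub>R grad \<phi> x))\<^sup>2)" for t
      unfolding expand using w2 iwg test_fun_integrable(2)[OF \<phi>] by simp
    have Wlim: "(\<lambda>n. dirichlet (\<lambda>x. \<psi> n x + t * \<phi> x)) \<longlonglongrightarrow> W t" for t
      unfolding dirichlet_def W_def gr
    proof (rule integral_square_norm_tendsto)
      show "integrable lborel (\<lambda>x. (norm (grad (\<psi> n) x + t *\<^sub>R grad \<phi> x))\<^sup>2)" for n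
        using test_fun_integrable(2)[OF t\<phi>[of n t]] by (simp add: gr)
      show "(\<lambda>n. \<integral>\<^sup>+ x. ennreal ((norm (grad (\<psi> n) x + t *\<^sub>R grad \<phi> x - (w x + t *\<^sub>R grad \<phi> x)))\<^sup>2) \<partial>lborel) \<longlonglongrightarrow> 0"
        using wlim by simp
    qed (use iW in auto)
    have W0: "(\<integral>x. (norm (w x))\<^sup>2 \<partial>lborel) = level"
      using LIMSEQ_unique[OF Wlim[of 0]] \<psi>(3) by (simp add: W_def)
    have W: "W t = level + 2 * t * B + t\<^sup>2 * C" for t
      unfolding W_def expand B_def C_def dirichlet_def W0[symmetric]
      using w2 iwg test_fun_integrable(2)[OF \<phi>] by simp
    have Wnn: "W t \<ge> 0" for t unfolding W_def by (intro integral_nonneg_AE) auto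
    \<comment> \<open>The level inequality for the perturbed sequence in the limit, with the mass
      replaced by its tangent lower bound \<open>1 + p * t * A\<close>.\<close>
    have key: "level * (1 + p * t * A) powr (2 / p) \<le> W t" if t: "1 + p * t * A \<ge> 0" for t
    proof -
      have "(\<integral>\<^sup>+ x. ennreal (\<bar>u x + t * \<phi> x\<bar> powr p) \<partial>lborel) \<le> ennreal ((W t / level) powr (p / 2))"
      proof (rule Fatou[OF \<phi>])
        show "power_mass p (\<lambda>x. \<psi> n x + t * \<phi> x) \<le> (dirichlet (\<lambda>x. \<psi> n x + t * \<phi> x) / level) powr (p / 2)" for n
        proof -
          have "power_mass p (\<lambda>x. \<psi> n x + t * \<phi> x) powr (2 / p) \<le> dirichlet (\<lambda>x. \<psi> n x + t * \<phi> x) / level"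
            using level_inequality[OF t\<phi>[of n t]] level_pos by (simp add: pos_le_divide_eq mult.commute)
          then have "(power_mass p (\<lambda>x. \<psi> n x + t * \<phi> x) powr (2 / p)) powr (p / 2)
              \<le> (dirichlet (\<lambda>x. \<psi> n x + t * \<phi> x) / level) powr (p / 2)"
            using p0 by (intro powr_mono2) auto
          then show ?thesis using p0 power_mass_nonneg by (simp add: powr_powr)
        qed
        show "(\<lambda>n. (dirichlet (\<lambda>x. \<psi> n x + t * \<phi> x) / level) powr (p / 2)) \<longlonglongrightarrow> (W t / level) powr (p / 2)"
          using level_pos p0 dirichlet_nonneg
          by (intro tendsto_powr' tendsto_divide Wlim tendsto_const) (auto intro!: always_eventually divide_nonneg_pos)
      qed
      moreover have "ennreal (1 + p * t * A) \<le> (\<integral>\<^sup>+ x. ennreal (\<bar>u x + t * \<phi> x\<bar> powr p) \<partial>lborel)"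
      proof -
        have e: "1 + p * t * A = (\<integral>x. \<bar>u x\<bar> powr p + (p * t) * (\<bar>u x\<bar> powr (p - 2) * u x * \<phi> x) \<partial>lborel)"
          unfolding A_def using ip iA one by simp
        have "ennreal (1 + p * t * A) \<le> (\<integral>\<^sup>+ x. ennreal (\<bar>u x\<bar> powr p + (p * t) * (\<bar>u x\<bar> powr (p - 2) * u x * \<phi> x)) \<partial>lborel)"
          unfolding e using ip iA by (intro ennreal_integral_le_nn_integral) auto
        also have "\<dots> \<le> (\<integral>\<^sup>+ x. ennreal (\<bar>u x + t * \<phi> x\<bar> powr p) \<partial>lborel)"
        proof (intro nn_integral_mono ennreal_leI)
          fix x
          show "\<bar>u x\<bar> powr p + (p * t) * (\<bar>u x\<bar> powr (p - 2) * u x * \<phi> x) \<le> \<bar>u x + t * \<phi> x\<bar> powr p"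
          proof -
            have "(p * t) * (\<bar>u x\<bar> powr (p - 2) * u x * \<phi> x) = p * (\<bar>u x\<bar> powr (p - 2) * u x * (t * \<phi> x))"
              by (simp only: mult_ac)
            then show ?thesis using p_gt_2 by (simp only:) (intro abs_powr_tangent, simp)
          qed
        qed
        finally show ?thesis .
      qed
      ultimately have "ennreal (1 + p * t * A) \<le> ennreal ((W t / level) powr (p / 2))"
        by (rule order_trans[rotated])
      then have "1 + p * t * A \<le> (W t / level) powr (p / 2)"
        by (subst (asm) ennreal_le_iff) auto
      then have "(1 + p * t * A) powr (2 / p) \<le> ((W t / level) powr (p / 2)) powr (2 / p)"
        using t p0 by (intro powr_mono2) auto
      also have "\<dots> = W t / level" using p0 Wnn level_pos by (simp add: powr_powr)
      finally show ?thesis using level_pos by (simp add: pos_le_divide_eq mult.commute)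
    qed
    \<comment> \<open>\<open>h\<close> vanishes at 0 and is nonnegative nearby; its derivative there
      is \<open>2 * B - 2 * level * A\<close>, so minimality is the equation sought.\<close>
    define h where "h t = W t - level * (1 + p * t * A) powr (2 / p)" for t
    have "(h has_real_derivative 2 * B - level * (2 * A)) (at 0)"
      unfolding h_def[abs_def] W using p0
      by (auto intro!: derivative_eq_intros simp: field_simps)
    \<comment> \<open>Keeps \<open>|p * t * A|\<close> below 1, so that the hypothesis of
      \<open>key\<close> holds.\<close>
    moreover define d where "d = 1 / (p * (\<bar>A\<bar> + 1))"
    have d: "d > 0" using p0 by (simp add: d_def add_nonneg_pos)
    moreover have "\<forall>t. \<bar>0 - t\<bar> < d \<longrightarrow> h 0 \<le> h t"
    proof (intro allI impI)
      fix t assume "\<bar>0 - t\<bar> < d"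
      then have "\<bar>t\<bar> * (p * (\<bar>A\<bar> + 1)) < 1"
        using p0 by (simp add: d_def pos_less_divide_eq add_nonneg_pos)
      moreover have "\<bar>p * t * A\<bar> \<le> \<bar>t\<bar> * (p * (\<bar>A\<bar> + 1))"
        using p0 by (simp add: abs_mult algebra_simps)
      ultimately have "1 + p * t * A \<ge> 0" by (simp add: abs_le_iff)
      then show "h 0 \<le> h t" using key[of t] by (simp add: h_def W)
    qed
    ultimately have "2 * B - level * (2 * A) = 0" by (rule DERIV_local_min)
    then show ?thesis unfolding A_def B_def by simp
  qed
  then show ?thesis
    using that[OF um wm \<psi>(1) ulim wlim u2 w2 ip one] by (simp add: u_def w_def)
qed

end

section \<open>Orthogonal changes of variables\<close>

lemma nn_integral_lborel_reflect:
  fixes f :: "'a::euclidean_space \<Rightarrow> ennreal"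
  assumes [measurable]: "f \<in> borel_measurable borel"
  shows "(\<integral>\<^sup>+ y. f (c - y) \<partial>lborel) = (\<integral>\<^sup>+ y. f y \<partial>lborel)"
proof -
  have "(\<integral>\<^sup>+ y. f y \<partial>lborel) = (\<integral>\<^sup>+ y. f y \<partial>density (distr lborel borel (\<lambda>x. c + (-1) *\<^sub>R x)) (\<lambda>_. \<bar>-1 :: real\<bar> ^ DIM('a)))"
    using lborel_affine[of "-1" c] by simp
  also have "\<dots> = (\<integral>\<^sup>+ y. f (c - y) \<partial>lborel)"
    by (simp add: nn_integral_density nn_integral_distr)
  finally show ?thesis by simp
qed

text \<open>Integrating \<open>f (T x) g (y + T x)\<close> in both orders shows that the image measure is a multiple of
  Lebesgue measure; the unit ball fixes the factor.\<close>

lemma nn_integral_lborel_isometry: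
  fixes T :: "'a::euclidean_space \<Rightarrow> 'a" and f :: "'a \<Rightarrow> ennreal"
  assumes T: "linear T" "\<And>x. norm (T x) = norm x" "\<And>y. T (S y) = y"
    and f [measurable]: "f \<in> borel_measurable borel"
  shows "(\<integral>\<^sup>+ x. f (T x) \<partial>lborel) = (\<integral>\<^sup>+ x. f x \<partial>lborel)"
proof -
  have [measurable]: "T \<in> borel_measurable borel"
    using T(1) by (intro borel_measurable_continuous_onI linear_continuous_on) (simp add: linear_conv_bounded_linear)
  define g :: "'a \<Rightarrow> ennreal" where "g = indicator (ball 0 1)"
  have [measurable]: "g \<in> borel_measurable borel" unfolding g_def by (intro borel_measurable_indicator) simp
  have gT: "g (T x) = g x" for x by (simp add: g_def T(2) indicator_def)
  \<comment> \<open>A translation of the domain by \<open>- S y\<close> is a translation by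
    \<open>- y\<close> after \<open>T\<close>.\<close>
  have shift: "(\<integral>\<^sup>+ x. h (T x) \<partial>lborel) = (\<integral>\<^sup>+ x. h (T x - y) \<partial>lborel)" if [measurable]: "h \<in> borel_measurable borel" for h :: "'a \<Rightarrow> ennreal" and y
  proof -
    have "(\<integral>\<^sup>+ x. h (T x) \<partial>lborel) = (\<integral>\<^sup>+ x. h (T (- S y + x)) \<partial>lborel)"
      by (rule nn_integral_lborel_translate[symmetric]) measurable
    also have "\<dots> = (\<integral>\<^sup>+ x. h (T x - y) \<partial>lborel)"
      by (simp add: linear_diff[OF T(1)] T(3))
    finally show ?thesis .
  qed
  let ?I = "integral\<^sup>N lborel :: ('a \<Rightarrow> ennreal) \<Rightarrow> ennreal"
  have "(\<integral>\<^sup>+ x. f (T x) \<partial>lborel) * ?I g = (\<integral>\<^sup>+ x. f (T x) * ?I g \<partial>lborel)"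
    by (rule nn_integral_multc[symmetric]) measurable
  also have "\<dots> = (\<integral>\<^sup>+ x. (\<integral>\<^sup>+ y. f (T x) * g (T x + y) \<partial>lborel) \<partial>lborel)"
    by (intro nn_integral_cong) (simp add: nn_integral_cmult nn_integral_lborel_translate)
  also have "\<dots> = (\<integral>\<^sup>+ y. (\<integral>\<^sup>+ x. f (T x) * g (T x + y) \<partial>lborel) \<partial>lborel)"
    by (rule lborel_pair.Fubini') measurable
  also have "\<dots> = (\<integral>\<^sup>+ y. (\<integral>\<^sup>+ x. f (T x - y) * g (T x - y + y) \<partial>lborel) \<partial>lborel)"
    by (intro nn_integral_cong shift) measurable
  \<comment> \<open>The unit ball is invariant under \<open>T\<close>, so \<open>g\<close> no longer
    sees the map, and the integral of \<open>f\<close> will split off.\<close>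
  also have "\<dots> = (\<integral>\<^sup>+ y. (\<integral>\<^sup>+ x. f (T x - y) * g x \<partial>lborel) \<partial>lborel)" by (simp add: gT)
  also have "\<dots> = (\<integral>\<^sup>+ x. (\<integral>\<^sup>+ y. f (T x - y) * g x \<partial>lborel) \<partial>lborel)"
    by (rule lborel_pair.Fubini') measurable
  also have "\<dots> = (\<integral>\<^sup>+ x. ?I f * g x \<partial>lborel)"
    by (intro nn_integral_cong) (simp add: nn_integral_multc nn_integral_lborel_reflect)
  also have "\<dots> = ?I f * ?I g" by (rule nn_integral_cmult) measurable
  finally have eq: "?I g * (\<integral>\<^sup>+ x. f (T x) \<partial>lborel) = ?I g * ?I f" by (simp add: mult.commute)
  have g: "?I g = emeasure lborel (ball 0 1 :: 'a set)" by (simp add: g_def)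
  \<comment> \<open>The common factor is the volume of the unit ball, finite and nonzero, so it may
    be cancelled.\<close>
  have "?I g \<noteq> top" using emeasure_lborel_ball_finite[of "0::'a" 1] unfolding g by simp
  moreover have "?I g \<noteq> 0"
    unfolding g using content_ball_pos[of 1 "0::'a"] by (auto simp: measure_def)
  ultimately show ?thesis using eq by (simp add: ennreal_mult_cancel_left)
qed

lemma lborel_isometry:
  fixes T :: "'a::euclidean_space \<Rightarrow> 'a"
  assumes T: "linear T" "\<And>x. norm (T x) = norm x" "\<And>y. T (S y) = y"
  shows "distr lborel borel T = lborel"
proof (rule measure_eqI)
  fix A assume "A \<in> sets (distr lborel borel T)"
  then have A [measurable]: "A \<in> sets borel" by simp
  have [measurable]: "T \<in> borel_measurable borel"
    using T(1) by (intro borel_measurable_continuous_onI linear_continuous_on) (simp add: linear_conv_bounded_linear)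
  have "emeasure (distr lborel borel T) A = (\<integral>\<^sup>+ x. indicator A x \<partial>distr lborel borel T)" by simp
  also have "\<dots> = (\<integral>\<^sup>+ x. indicator A (T x) \<partial>lborel)" by (rule nn_integral_distr) measurable
  also have "\<dots> = (\<integral>\<^sup>+ x. indicator A x \<partial>lborel)" by (rule nn_integral_lborel_isometry[OF T]) measurable
  also have "\<dots> = emeasure lborel A" by simp
  finally show "emeasure (distr lborel borel T) A = emeasure lborel A" .
qed simp

lemma lborel_isometry_integral:
  fixes T :: "'a::euclidean_space \<Rightarrow> 'a" and f :: "'a \<Rightarrow> real"
  assumes T: "linear T" "\<And>x. norm (T x) = norm x" "\<And>y. T (S y) = y"
    and f [measurable]: "f \<in> borel_measurable borel"
  shows "(\<integral>x. f (T x) \<partial>lborel) = (\<integral>x. f x \<partial>lborel)"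
    "integrable lborel (\<lambda>x. f (T x)) \<longleftrightarrow> integrable lborel f"
proof -
  have [measurable]: "T \<in> borel_measurable borel"
    using T(1) by (intro borel_measurable_continuous_onI linear_continuous_on) (simp add: linear_conv_bounded_linear)
  show "(\<integral>x. f (T x) \<partial>lborel) = (\<integral>x. f x \<partial>lborel)"
    using integral_distr[of T lborel borel f] by (simp add: lborel_isometry[OF T])
  show "integrable lborel (\<lambda>x. f (T x)) \<longleftrightarrow> integrable lborel f"
    using integrable_distr_eq[of T lborel borel f] by (simp add: lborel_isometry[OF T])
qed

lemma test_fun_comp_linear:
  fixes T S :: "real^'n::finite \<Rightarrow> real^'n"
  assumes f: "test_fun \<Omega> f" and T: "linear T" and S: "linear S" "\<And>x. S (T x) = x"
    and \<Omega>: "\<And>x. x \<in> \<Omega> \<Longrightarrow> S x \<in> \<Omega>'"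
  shows "test_fun \<Omega>' (\<lambda>x. f (T x))"
proof -
  obtain K where K: "compact K" "K \<subseteq> \<Omega>" "\<And>x. x \<notin> K \<Longrightarrow> f x = 0"
    using test_fun_support[OF f] by metis
  show ?thesis
  proof (rule test_funI)
    show "smooth_fun (\<lambda>x. f (T x))"
      using smooth_fun_comp_affine[OF test_fun_smooth[OF f] T, of 0] by simp
    show "compact (S ` K)"
      using K(1) S(1) by (intro compact_continuous_image linear_continuous_on) (simp_all add: linear_conv_bounded_linear)
    show "S ` K \<subseteq> \<Omega>'" using K(2) \<Omega> by auto
    show "f (T x) = 0" if "x \<notin> S ` K" for x
    proof (rule K(3))
      show "T x \<notin> K" using that S(2)[of x] by (metis image_eqI)
    qed
  qed
qed

lemma inner_isometry:
  assumes "linear T" "\<And>x. norm (T x) = norm x" shows "T x \<bullet> T y = x \<bullet> y"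
proof -
  have "(norm (T x + T y))\<^sup>2 = (norm (x + y))\<^sup>2"
    using assms(2)[of "x + y"] by (simp add: linear_add[OF assms(1)])
  moreover have "(norm (T x))\<^sup>2 = (norm x)\<^sup>2" "(norm (T y))\<^sup>2 = (norm y)\<^sup>2" by (simp_all add: assms(2))
  ultimately show ?thesis by (simp add: power2_norm_eq_inner inner_add_left inner_add_right inner_commute)
qed

text \<open>An isometry is inverted by its adjoint, so the inner product form of the chain rule
  pulls the gradient back by \<open>S\<close>.\<close>

lemma grad_comp_isometry:
  assumes f: "smooth_fun f" and T: "linear T" and S: "linear S" "\<And>x. norm (S x) = norm x" "\<And>x. S (T x) = x"
  shows "grad (\<lambda>x. f (T x)) x = S (grad f (T x))"
proof -
  have "grad (\<lambda>x. f (T x)) x \<bullet> v = S (grad f (T x)) \<bullet> v" for v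
    unfolding grad_comp_linear_inner[OF f T]
    using inner_isometry[OF S(1,2), of "grad f (T x)" "T v"] by (simp add: S(3))
  then show ?thesis by (metis vector_eq_rdot)
qed

section \<open>The dihedral groups\<close>

text \<open>Normal form for \<open>O(2)\<close>: for \<open>\<sigma> = 1\<close> the rotation by
  \<open>\<theta>\<close>, for \<open>\<sigma> = -1\<close> complex conjugation followed by that
  rotation. Both generators and all their products take this form, and \<open>\<sigma>\<close> is
  the determinant.\<close>

definition rotm :: "real \<Rightarrow> real \<Rightarrow> real^2^2" where
  "rotm \<theta> \<sigma> = vector [vector [cos \<theta>, - \<sigma> * sin \<theta>], vector [sin \<theta>, \<sigma> * cos \<theta>]]"

lemma rotm_nth [simp]:
  "rotm \<theta> \<sigma> $ 1 $ 1 = cos \<theta>" "rotm \<theta> \<sigma> $ 1 $ 2 = - \<sigma> * sin \<theta>"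
  "rotm \<theta> \<sigma> $ 2 $ 1 = sin \<theta>" "rotm \<theta> \<sigma> $ 2 $ 2 = \<sigma> * cos \<theta>"
  by (simp_all add: rotm_def)

lemma rotm_mult:
  assumes "\<sigma> = 1 \<or> \<sigma> = -1"
  shows "rotm \<theta> \<sigma> ** rotm \<theta>' \<sigma>' = rotm (\<theta> + \<sigma> * \<theta>') (\<sigma> * \<sigma>')"
  using assms
  by (auto simp: vec_eq_iff forall_2 matrix_matrix_mult_def sum_2 cos_add sin_add cos_diff sin_diff algebra_simps)

lemma rotm_0_1: "rotm 0 1 = mat 1"
  by (simp add: vec_eq_iff forall_2 mat_def)

text \<open>Conjugation reverses the sense of rotation, so reflections are their own inverses. As
  \<open>matrix_inv\<close> is defined by choice, its value is identified through uniqueness of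
  two-sided inverses.\<close>

lemma rotm_inverse:
  assumes "\<sigma> = 1 \<or> \<sigma> = -1"
  shows "matrix_inv (rotm \<theta> \<sigma>) = rotm (- \<sigma> * \<theta>) \<sigma>"
    "rotm \<theta> \<sigma> ** rotm (- \<sigma> * \<theta>) \<sigma> = mat 1" "rotm (- \<sigma> * \<theta>) \<sigma> ** rotm \<theta> \<sigma> = mat 1"
proof -
  show 1: "rotm \<theta> \<sigma> ** rotm (- \<sigma> * \<theta>) \<sigma> = mat 1" and 2: "rotm (- \<sigma> * \<theta>) \<sigma> ** rotm \<theta> \<sigma> = mat 1"
    using assms by (auto simp: rotm_mult rotm_0_1)
  show "matrix_inv (rotm \<theta> \<sigma>) = rotm (- \<sigma> * \<theta>) \<sigma>"
  proof -
    have "\<exists>B. rotm \<theta> \<sigma> ** B = mat 1 \<and> B ** rotm \<theta> \<sigma> = mat 1" using 1 2 by blast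
    then have "rotm \<theta> \<sigma> ** matrix_inv (rotm \<theta> \<sigma>) = mat 1 \<and> matrix_inv (rotm \<theta> \<sigma>) ** rotm \<theta> \<sigma> = mat 1"
      unfolding matrix_inv_def by (rule someI_ex)
    then have "matrix_inv (rotm \<theta> \<sigma>) ** rotm \<theta> \<sigma> = mat 1" by blast
    then have "matrix_inv (rotm \<theta> \<sigma>) ** (rotm \<theta> \<sigma> ** rotm (- \<sigma> * \<theta>) \<sigma>) = rotm (- \<sigma> * \<theta>) \<sigma>"
      by (simp add: matrix_mul_assoc)
    then show ?thesis unfolding 1 by simp
  qed
qed

lemma rotm_eq_iff:
  assumes "\<sigma> = 1 \<or> \<sigma> = -1" "\<sigma>' = 1 \<or> \<sigma>' = -1"
  shows "rotm \<theta> \<sigma> = rotm \<theta>' \<sigma>' \<longleftrightarrow> \<sigma> = \<sigma>' \<and> (\<exists>n::int. \<theta> = \<theta>' + 2 * pi * n)"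
proof -
  have "rotm \<theta> \<sigma> = rotm \<theta>' \<sigma>' \<longleftrightarrow> sin \<theta> = sin \<theta>' \<and> cos \<theta> = cos \<theta>' \<and> \<sigma> * sin \<theta> = \<sigma>' * sin \<theta>' \<and> \<sigma> * cos \<theta> = \<sigma>' * cos \<theta>'"
    by (auto simp: vec_eq_iff forall_2)
  also have "\<dots> \<longleftrightarrow> \<sigma> = \<sigma>' \<and> sin \<theta> = sin \<theta>' \<and> cos \<theta> = cos \<theta>'"
    using sin_cos_squared_add[of \<theta>] by (cases "sin \<theta> = 0") auto
  finally show ?thesis by (simp add: sin_cos_eq_iff)
qed

lemma det_rotm: "det (rotm \<theta> \<sigma>) = \<sigma>"
proof -
  have "det (rotm \<theta> \<sigma>) = cos \<theta> * (\<sigma> * cos \<theta>) - (- \<sigma> * sin \<theta>) * sin \<theta>"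
    unfolding det_2 rotm_nth ..
  also have "\<dots> = \<sigma> * ((cos \<theta>)\<^sup>2 + (sin \<theta>)\<^sup>2)" by algebra
  finally show ?thesis by simp
qed

definition dihedral :: "nat \<Rightarrow> int \<times> real \<Rightarrow> real^2^2" where
  "dihedral k = (\<lambda>(j, \<sigma>). rotm (2 * pi * of_int j / real k) \<sigma>)"

lemma rot_refl_rotm: "rot_k k = rotm (2 * pi / real k) 1" "refl_k k = rotm (2 * pi / real k) (-1)"
  by (simp_all add: rot_k_def refl_k_def rotm_def Let_def)

text \<open>Normal form of the dihedral group: the elements with angle a multiple of
  \<open>2 * pi / k\<close> and \<open>\<sigma>\<close> a sign are closed under all generating
  rules, and the index matters only modulo \<open>k\<close>. Finiteness and the order
  \<open>2 * k\<close> follow; the order becomes the factor in the energy.\<close>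

lemma Gk_eq:
  assumes "k \<ge> 1" shows "Gk k = dihedral k ` ({0..<int k} \<times> {1, -1})"
proof
  define H where "H = {rotm (2 * pi * of_int j / real k) \<sigma> | j \<sigma>. \<sigma> = 1 \<or> \<sigma> = -1}"
  have HI: "rotm (2 * pi * of_int j / real k) \<sigma> \<in> H" if "\<sigma> = 1 \<or> \<sigma> = -1" for j \<sigma> using that by (auto simp: H_def)
  have "g \<in> H" if "g \<in> Gk k" for g
    using that
  proof induction
    case gen_id show ?case using HI[of 1 0] by (simp add: rotm_0_1)
  next
    case gen_alpha show ?case using HI[of 1 1] by (simp add: rot_refl_rotm)
  next
    case gen_beta show ?case using HI[of "-1" 1] by (simp add: rot_refl_rotm)
  next
    case (gen_mult g h)
    then obtain j \<sigma> j' \<sigma>' where "\<sigma> = 1 \<or> \<sigma> = -1" "\<sigma>' = 1 \<or> \<sigma>' = -1"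
      "g = rotm (2 * pi * of_int j / real k) \<sigma>" "h = rotm (2 * pi * of_int j' / real k) \<sigma>'" unfolding H_def by blast
    then show ?case using HI[of "\<sigma> * \<sigma>'" "j + j'"] HI[of "\<sigma> * \<sigma>'" "j - j'"]
      by (auto simp: rotm_mult add_divide_distrib[symmetric] diff_divide_distrib[symmetric] algebra_simps)
  next
    case (gen_inv g)
    then obtain j \<sigma> where "\<sigma> = 1 \<or> \<sigma> = -1" "g = rotm (2 * pi * of_int j / real k) \<sigma>" unfolding H_def by blast
    then show ?case using HI[of \<sigma> "- j"] HI[of \<sigma> j] by (auto simp: rotm_inverse)
  qed
  moreover have "H \<subseteq> dihedral k ` ({0..<int k} \<times> {1, -1})"
  proof
    fix g assume "g \<in> H"
    then obtain j \<sigma> where g: "\<sigma> = 1 \<or> \<sigma> = -1" "g = rotm (2 * pi * of_int j / real k) \<sigma>" by (auto simp: H_def)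
    have "j = j mod int k + int k * (j div int k)" by simp
    then have "real_of_int j = real_of_int (j mod int k) + real k * real_of_int (j div int k)"
      by (metis of_int_add of_int_mult of_int_of_nat_eq)
    then have "2 * pi * of_int j / real k = 2 * pi * of_int (j mod int k) / real k + 2 * pi * of_int (j div int k)"
      using assms by (simp add: field_simps)
    then have "g = dihedral k (j mod int k, \<sigma>)"
      using g(1) rotm_eq_iff[OF g(1) g(1)] unfolding g(2) dihedral_def by auto
    moreover have "(j mod int k, \<sigma>) \<in> {0..<int k} \<times> {1, -1}" using g(1) assms by auto
    ultimately show "g \<in> dihedral k ` ({0..<int k} \<times> {1, -1})" by blast
  qed
  ultimately show "Gk k \<subseteq> dihedral k ` ({0..<int k} \<times> {1, -1})" by blast
  have rot: "rotm (2 * pi * real n / real k) 1 \<in> Gk k" for n :: nat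
  proof (induction n)
    case 0 show ?case using Gk.gen_id by (simp add: rotm_0_1)
  next
    case (Suc n)
    have "rotm (2 * pi / real k) 1 ** rotm (2 * pi * real n / real k) 1 \<in> Gk k"
      using Gk.gen_mult[OF Gk.gen_alpha Suc] by (simp add: rot_refl_rotm)
    then show ?case by (simp add: rotm_mult add_divide_distrib distrib_left)
  qed
  \<comment> \<open>\<open>\<beta>\<close> is conjugation followed by \<open>\<alpha>\<close>, so
    removing the rotation leaves conjugation.\<close>
  have "matrix_inv (rotm (2 * pi / real k) 1) ** rotm (2 * pi / real k) (-1) \<in> Gk k"
    using Gk.gen_mult[OF Gk.gen_inv[OF Gk.gen_alpha] Gk.gen_beta, of k] by (simp add: rot_refl_rotm)
  then have conj: "rotm 0 (-1) \<in> Gk k" by (simp add: rotm_inverse rotm_mult)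
  show "dihedral k ` ({0..<int k} \<times> {1, -1}) \<subseteq> Gk k"
  proof
    fix g assume "g \<in> dihedral k ` ({0..<int k} \<times> {1, -1})"
    then obtain js where js: "g = dihedral k js" "js \<in> {0..<int k} \<times> {1, -1}" by blast
    obtain j \<sigma> where "js = (j, \<sigma>)" by (cases js)
    with js have j: "0 \<le> j" and g: "\<sigma> = 1 \<or> \<sigma> = -1" "g = rotm (2 * pi * of_int j / real k) \<sigma>"
      by (auto simp: dihedral_def)
    have r: "rotm (2 * pi * of_int j / real k) 1 \<in> Gk k" using rot[of "nat j"] j by simp
    from Gk.gen_mult[OF r conj] have "rotm (2 * pi * of_int j / real k) (-1) \<in> Gk k" by (simp add: rotm_mult)
    with r g show "g \<in> Gk k" by auto
  qed
qed

text \<open>Equal angles modulo \<open>2 * pi\<close> force the indices to agree modulo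
  \<open>k\<close>, and they lie in one residue system. The sign separates rotations from
  reflections.\<close>

lemma inj_on_dihedral:
  assumes "k \<ge> 1" shows "inj_on (dihedral k) ({0..<int k} \<times> {1, -1})"
proof (rule inj_onI, clarify)
  fix i j :: int and \<sigma> \<tau> :: real
  assume ij: "i \<in> {0..<int k}" "j \<in> {0..<int k}" and s: "\<sigma> \<in> {1, -1}" "\<tau> \<in> {1, -1}"
    and eq: "dihedral k (i, \<sigma>) = dihedral k (j, \<tau>)"
  obtain n :: int where n: "\<sigma> = \<tau>" "2 * pi * of_int i / real k = 2 * pi * of_int j / real k + 2 * pi * of_int n"
    using eq s rotm_eq_iff[of \<sigma> \<tau>] unfolding dihedral_def by auto
  have "2 * pi * of_int i = 2 * pi * (of_int j + of_int n * real k)"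
    using n(2) assms by (simp add: field_simps)
  then have "real_of_int i = of_int (j + n * int k)" by simp
  then have i: "i = j + n * int k" by (simp only: of_int_eq_iff)
  have "n = 0"
  proof (rule ccontr)
    assume "n \<noteq> 0"
    then have "\<bar>n * int k\<bar> \<ge> int k" using assms by (simp add: abs_mult)
    then show False using ij i by auto
  qed
  with i n(1) show "i = j \<and> \<sigma> = \<tau>" by simp
qed

lemma finite_Gk: "k \<ge> 1 \<Longrightarrow> finite (Gk k)"
  by (simp add: Gk_eq)

lemma card_Gk:
  assumes "k \<ge> 1" shows "card (Gk k) = 2 * k"
  using card_image[OF inj_on_dihedral[OF assms]] by (simp add: Gk_eq[OF assms] card_cartesian_product)

lemma Gk_cases:
  assumes "g \<in> Gk k" "k \<ge> 1"
  obtains j \<sigma> where "g = rotm (2 * pi * of_int j / real k) \<sigma>" "\<sigma> = 1 \<or> \<sigma> = -1"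
  using assms by (auto simp: Gk_eq dihedral_def)

lemma Gk_inverse:
  assumes "g \<in> Gk k" "k \<ge> 1"
  shows "g ** matrix_inv g = mat 1" "matrix_inv g ** g = mat 1" "det g * det g = 1" "det (matrix_inv g) = det g"
proof -
  obtain j \<sigma> where g: "g = rotm (2 * pi * of_int j / real k) \<sigma>" and s: "\<sigma> = 1 \<or> \<sigma> = -1"
    using Gk_cases[OF assms] by blast
  show "g ** matrix_inv g = mat 1" "matrix_inv g ** g = mat 1"
    unfolding g rotm_inverse(1)[OF s] by (rule rotm_inverse(2,3)[OF s])+
  show "det g * det g = 1" "det (matrix_inv g) = det g"
    unfolding g rotm_inverse(1)[OF s] det_rotm using s by auto
qed

lemma tendsto_cmult_ennreal_0:
  assumes "f \<longlonglongrightarrow> (0::ennreal)" shows "(\<lambda>n. ennreal c * f n) \<longlonglongrightarrow> 0"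
  using ennreal_tendsto_cmult[OF _ assms, of "ennreal c"] by simp

context cylinder begin

text \<open>Rescaling the minimizer by \<open>level powr (1 / (p - 2))\<close> removes the multiplier.\<close>

lemma solution_on_cylinder:
  obtains u w \<psi> where "u \<in> borel_measurable borel" "w \<in> borel_measurable borel"
    "\<And>n::nat. test_fun D (\<psi> n)"
    "(\<lambda>n. \<integral>\<^sup>+ x. ennreal ((norm (\<psi> n x - u x))\<^sup>2) \<partial>lborel) \<longlonglongrightarrow> 0"
    "(\<lambda>n. \<integral>\<^sup>+ x. ennreal ((norm (grad (\<psi> n) x - w x))\<^sup>2) \<partial>lborel) \<longlonglongrightarrow> 0"
    "integrable lborel (\<lambda>x. (u x)\<^sup>2)" "integrable lborel (\<lambda>x. (norm (w x))\<^sup>2)"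
    "integrable lborel (\<lambda>x. \<bar>u x\<bar> powr p)" "(\<integral>x. \<bar>u x\<bar> powr p \<partial>lborel) = level powr (p / (p - 2))"
    "\<And>\<phi>. test_fun D \<phi> \<Longrightarrow> (\<integral>x. w x \<bullet> grad \<phi> x \<partial>lborel) = (\<integral>x. \<bar>u x\<bar> powr (p - 2) * u x * \<phi> x \<partial>lborel)"
    "\<And>x. x \<notin> D \<Longrightarrow> u x = 0" "\<And>x. x \<notin> D \<Longrightarrow> w x = 0"
proof -
  obtain u w \<psi> where m [measurable]: "u \<in> borel_measurable borel" "w \<in> borel_measurable borel" and
    \<psi>: "\<And>n::nat. test_fun D (\<psi> n)" and
    lim: "(\<lambda>n. \<integral>\<^sup>+ x. ennreal ((norm (\<psi> n x - u x))\<^sup>2) \<partial>lborel) \<longlonglongrightarrow> 0"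
      "(\<lambda>n. \<integral>\<^sup>+ x. ennreal ((norm (grad (\<psi> n) x - w x))\<^sup>2) \<partial>lborel) \<longlonglongrightarrow> 0" and
    int: "integrable lborel (\<lambda>x. (u x)\<^sup>2)" "integrable lborel (\<lambda>x. (norm (w x))\<^sup>2)"
      "integrable lborel (\<lambda>x. \<bar>u x\<bar> powr p)" and one: "(\<integral>x. \<bar>u x\<bar> powr p \<partial>lborel) = 1" and
    eq: "\<And>\<phi>. test_fun D \<phi> \<Longrightarrow> (\<integral>x. w x \<bullet> grad \<phi> x \<partial>lborel) = level * (\<integral>x. \<bar>u x\<bar> powr (p - 2) * u x * \<phi> x \<partial>lborel)" and
    out: "\<And>x. x \<notin> D \<Longrightarrow> u x = 0" "\<And>x. x \<notin> D \<Longrightarrow> w x = 0"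
    by (rule ground_state) (rule that)
  define c where "c = level powr (1 / (p - 2))"
  have c: "c > 0" "c powr (p - 2) = level" "c powr p = level powr (p / (p - 2))"
    using level_pos p_gt_2 by (auto simp: c_def powr_powr)
  have m\<psi> [measurable]: "\<psi> n \<in> borel_measurable borel" "grad (\<psi> n) \<in> borel_measurable borel" for n
    using test_fun_borel_measurable[OF \<psi>] by blast+
  show ?thesis
  proof (rule that[of "\<lambda>x. c * u x" "\<lambda>x. c *\<^sub>R w x" "\<lambda>n x. c * \<psi> n x"])
    show "test_fun D (\<lambda>x. c * \<psi> n x)" for n by (intro test_fun_cmult \<psi>)
    have "(\<integral>\<^sup>+ x. ennreal ((norm (c * \<psi> n x - c * u x))\<^sup>2) \<partial>lborel)
        = ennreal (c\<^sup>2) * (\<integral>\<^sup>+ x. ennreal ((norm (\<psi> n x - u x))\<^sup>2) \<partial>lborel)" for n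
      by (subst nn_integral_cmult[symmetric])
        (auto simp: right_diff_distrib[symmetric] power_mult_distrib ennreal_mult' abs_mult)
    then show "(\<lambda>n. \<integral>\<^sup>+ x. ennreal ((norm (c * \<psi> n x - c * u x))\<^sup>2) \<partial>lborel) \<longlonglongrightarrow> 0"
      using tendsto_cmult_ennreal_0[OF lim(1)] by simp
    have "(\<integral>\<^sup>+ x. ennreal ((norm (grad (\<lambda>x. c * \<psi> n x) x - c *\<^sub>R w x))\<^sup>2) \<partial>lborel)
        = ennreal (c\<^sup>2) * (\<integral>\<^sup>+ x. ennreal ((norm (grad (\<psi> n) x - w x))\<^sup>2) \<partial>lborel)" for n
      by (subst nn_integral_cmult[symmetric])
        (auto simp: grad_cmult[OF test_fun_smooth[OF \<psi>]] scaleR_diff_right[symmetric] power_mult_distrib ennreal_mult')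
    then show "(\<lambda>n. \<integral>\<^sup>+ x. ennreal ((norm (grad (\<lambda>x. c * \<psi> n x) x - c *\<^sub>R w x))\<^sup>2) \<partial>lborel) \<longlonglongrightarrow> 0"
      using tendsto_cmult_ennreal_0[OF lim(2)] by simp
    show "integrable lborel (\<lambda>x. (c * u x)\<^sup>2)" "integrable lborel (\<lambda>x. (norm (c *\<^sub>R w x))\<^sup>2)"
      using int by (simp_all add: power_mult_distrib)
    show "integrable lborel (\<lambda>x. \<bar>c * u x\<bar> powr p)" "(\<integral>x. \<bar>c * u x\<bar> powr p \<partial>lborel) = level powr (p / (p - 2))"
      using int(3) one c by (simp_all add: abs_mult powr_mult)
    show "(\<integral>x. (c *\<^sub>R w x) \<bullet> grad \<phi> x \<partial>lborel) = (\<integral>x. \<bar>c * u x\<bar> powr (p - 2) * (c * u x) * \<phi> x \<partial>lborel)"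
      if \<phi>: "test_fun D \<phi>" for \<phi>
    proof -
      have pt: "\<bar>c * u x\<bar> powr (p - 2) * (c * u x) * \<phi> x = (c * level) * (\<bar>u x\<bar> powr (p - 2) * u x * \<phi> x)" for x
      proof -
        have "\<bar>c * u x\<bar> powr (p - 2) = level * \<bar>u x\<bar> powr (p - 2)" using c by (simp add: abs_mult powr_mult)
        then show ?thesis by (simp only: mult_ac)
      qed
      show ?thesis unfolding pt using eq[OF \<phi>] by simp
    qed
  qed (use out in auto)
qed

end

subsection \<open>The sectors\<close>

lemma act_nth:
  "act e g x $ j = (if j = e 0 then g $ 1 $ 1 * x $ e 0 + g $ 1 $ 2 * x $ e 1
     else if j = e 1 then g $ 2 $ 1 * x $ e 0 + g $ 2 $ 2 * x $ e 1 else x $ j)"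
  by (simp add: act_def Let_def matrix_vector_mult_def sum_2)

lemma linear_act: "linear (act e g)"
  by (rule linearI) (auto simp: vec_eq_iff act_nth algebra_simps)

declare One_nat_def [simp del] \<comment> \<open>it would rewrite the coordinate label \<open>e 1\<close>\<close>

locale annular =
  fixes e :: "nat \<Rightarrow> 'n::finite" and m :: nat and a b p :: real
  assumes e: "bij_betw e {..<CARD('n)} UNIV" and dim: "CARD('n) \<ge> 3"
    and m: "1 \<le> m" "m \<le> CARD('n) - 2" and ab: "0 < a" "a < b"
    and p_gt_2: "2 < p" and p_lt: "p < 2 * real CARD('n) / (real CARD('n) - 2)"
begin

section \<open>The group action on the annular domain\<close>

abbreviation \<Omega> where "\<Omega> \<equiv> annular_dom e m a b"

lemma e_inj: "i < CARD('n) \<Longrightarrow> j < CARD('n) \<Longrightarrow> e i = e j \<longleftrightarrow> i = j"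
  using e by (auto simp: bij_betw_def inj_on_def)

lemma e01: "e 0 \<noteq> e 1"
  using e_inj[of 0 1] dim by simp

lemma act_mult: "act e (g ** h) x = act e g (act e h x)"
  using e01 by (auto simp: vec_eq_iff act_nth matrix_matrix_mult_def sum_2 algebra_simps)

lemma act_1: "act e (mat 1) x = x"
  by (simp add: vec_eq_iff act_nth mat_def)

lemma rotm_sum_squares:
  assumes "\<sigma> = 1 \<or> \<sigma> = -1"
  shows "(cos \<theta> * s + (- \<sigma> * sin \<theta>) * t)\<^sup>2 + (sin \<theta> * s + (\<sigma> * cos \<theta>) * t)\<^sup>2 = s\<^sup>2 + (t::real)\<^sup>2"
proof -
  have "\<sigma>\<^sup>2 = 1" using assms by auto
  moreover have "(sin \<theta>)\<^sup>2 + (cos \<theta>)\<^sup>2 = 1" by simp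
  ultimately show ?thesis by algebra
qed

lemma sum_squares_split:
  assumes "finite I" "e 0 \<in> I" "e 1 \<in> I"
  shows "(\<Sum>j\<in>I. (x $ j)\<^sup>2) = (x $ e 0)\<^sup>2 + (x $ e 1)\<^sup>2 + (\<Sum>j\<in>I - {e 0, e 1}. (x $ j :: real)\<^sup>2)"
proof -
  have "I = insert (e 0) (insert (e 1) (I - {e 0, e 1}))" using assms by auto
  then show ?thesis using assms e01 by (metis (no_types, lifting) Diff_iff add.assoc finite.insertI finite_Diff insertCI insert_iff sum.insert)
qed

text \<open>The index set is arbitrary apart from containing the two rotated coordinates, so the
  lemma yields invariance both of the norm and of the radius that defines the annulus.\<close>

lemma sum_squares_act:
  assumes g: "g \<in> Gk k" "k \<ge> 1" and I: "finite I" "e 0 \<in> I" "e 1 \<in> I"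
  shows "(\<Sum>j\<in>I. (act e g x $ j)\<^sup>2) = (\<Sum>j\<in>I. (x $ j)\<^sup>2)"
proof -
  obtain j \<sigma> where g': "g = rotm (2 * pi * of_int j / real k) \<sigma>" and s: "\<sigma> = 1 \<or> \<sigma> = -1"
    using Gk_cases[OF g] by blast
  have "(act e g x $ e 0)\<^sup>2 + (act e g x $ e 1)\<^sup>2 = (x $ e 0)\<^sup>2 + (x $ e 1)\<^sup>2"
    using rotm_sum_squares[OF s, of _ "x $ e 0" "x $ e 1"] e01 by (simp add: act_nth g')
  moreover have "(\<Sum>j\<in>I - {e 0, e 1}. (act e g x $ j)\<^sup>2) = (\<Sum>j\<in>I - {e 0, e 1}. (x $ j)\<^sup>2)"
    by (intro sum.cong) (auto simp: act_nth)
  ultimately show ?thesis unfolding sum_squares_split[OF I] by simp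
qed

lemma norm_act: "g \<in> Gk k \<Longrightarrow> k \<ge> 1 \<Longrightarrow> norm (act e g x) = norm x"
  using sum_squares_act[of g k UNIV x] by (simp add: norm_vec_def L2_set_def)

lemma radius_sum: "(\<Sum>i\<le>m. (x $ e i)\<^sup>2) = (\<Sum>j\<in>e ` {..m}. (x $ j)\<^sup>2)"
proof -
  have "inj_on e {..m}" using e m dim by (auto simp: inj_on_def e_inj)
  then show ?thesis by (simp add: sum.reindex)
qed

lemma act_in_annulus:
  assumes "g \<in> Gk k" "k \<ge> 1" shows "act e g x \<in> \<Omega> \<longleftrightarrow> x \<in> \<Omega>"
proof -
  have "(\<Sum>j\<in>e ` {..m}. (act e g x $ j)\<^sup>2) = (\<Sum>j\<in>e ` {..m}. (x $ j)\<^sup>2)"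
    using m by (intro sum_squares_act[OF assms]) auto
  then show ?thesis by (simp add: annular_dom_def radius_sum)
qed

section \<open>Walls, sectors and the fundamental domain\<close>

definition wall1 :: "real^'n" where "wall1 = axis (e 1) 1"

text \<open>Inward unit normal of the wall at angle \<open>pi / k\<close>. The opening of the sector
  is half of the rotation angle because the group also contains the reflections across both
  walls.\<close>

definition wall2 :: "nat \<Rightarrow> real^'n" where
  "wall2 k = sin (pi / real k) *\<^sub>R axis (e 0) 1 - cos (pi / real k) *\<^sub>R axis (e 1) 1"

definition sector :: "nat \<Rightarrow> (real^'n) set" where
  "sector k = {x \<in> \<Omega>. 0 < wall1 \<bullet> x \<and> 0 < wall2 k \<bullet> x}"

lemma wall_inner:
  "wall1 \<bullet> x = x $ e 1" "wall2 k \<bullet> x = sin (pi / real k) * x $ e 0 - cos (pi / real k) * x $ e 1"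
  by (simp_all add: wall1_def wall2_def inner_diff_left inner_axis')

lemma norm_wall: "norm wall1 = 1" "norm (wall2 k) = 1"
proof -
  show "norm wall1 = 1" by (simp add: wall1_def)
  have "(norm (wall2 k))\<^sup>2 = (sin (pi / real k))\<^sup>2 + (cos (pi / real k))\<^sup>2"
    unfolding power2_norm_eq_inner wall_inner
    using e01 by (simp add: wall2_def axis_def power2_eq_square)
  then show "norm (wall2 k) = 1" using norm_ge_zero[of "wall2 k"] by (simp add: power2_eq_1_iff)
qed

text \<open>In polar coordinates the two wall functions are \<open>\<rho> * sin t\<close> and
  \<open>\<rho> * sin (pi / k - t)\<close>. Positivity of the first places \<open>t\<close> between
  0 and \<open>pi\<close>, and there positivity of the second forces
  \<open>t < pi / k\<close>.\<close>

lemma sector_polar: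
  assumes k: "k \<ge> 2" and x: "x \<in> sector k"
  obtains \<rho> t where "\<rho> > 0" "0 < t" "t < pi / real k" "x $ e 0 = \<rho> * cos t" "x $ e 1 = \<rho> * sin t"
proof -
  define \<rho> where "\<rho> = sqrt ((x $ e 0)\<^sup>2 + (x $ e 1)\<^sup>2)"
  have x1: "x $ e 1 > 0" and x2: "sin (pi / real k) * x $ e 0 - cos (pi / real k) * x $ e 1 > 0"
    using x by (auto simp: sector_def wall_inner)
  have \<rho>: "\<rho> > 0" using x1 by (simp add: \<rho>_def add_nonneg_pos)
  have "(x $ e 0)\<^sup>2 + (x $ e 1)\<^sup>2 = \<rho>\<^sup>2" by (simp add: \<rho>_def)
  then have "(x $ e 0 / \<rho>)\<^sup>2 + (x $ e 1 / \<rho>)\<^sup>2 = 1"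
    using \<rho> by (simp add: power_divide add_divide_distrib[symmetric])
  moreover have "0 \<le> x $ e 1 / \<rho>" using x1 \<rho> by simp
  ultimately obtain t where t: "0 \<le> t" "t \<le> pi" "x $ e 0 / \<rho> = cos t" "x $ e 1 / \<rho> = sin t"
    using sincos_total_pi by blast
  have e: "x $ e 0 = \<rho> * cos t" "x $ e 1 = \<rho> * sin t" using t(3,4) \<rho> by (auto simp: field_simps)
  have "sin t > 0" using x1 \<rho> unfolding e(2) by (simp add: zero_less_mult_iff)
  then have t0: "t > 0" using t(1) by (cases "t = 0") auto
  have "sin (pi / real k) * x $ e 0 - cos (pi / real k) * x $ e 1 = \<rho> * sin (pi / real k - t)"
    unfolding e sin_diff by (simp add: algebra_simps)
  then have s: "sin (pi / real k - t) > 0" using x2 \<rho> by (simp add: zero_less_mult_iff)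
  have "t < pi / real k"
  proof (rule ccontr)
    assume "\<not> t < pi / real k"
    moreover have "pi / real k \<ge> 0" by simp
    ultimately have "0 \<le> t - pi / real k" "t - pi / real k \<le> pi" using t(2) by linarith+
    then have "sin (t - pi / real k) \<ge> 0" by (rule sin_ge_zero)
    then show False using s sin_minus[of "t - pi / real k"] by simp
  qed
  then show ?thesis using that \<rho> t0 e by blast
qed

lemma polar_in_sector:
  assumes k: "k \<ge> 2" and "x \<in> \<Omega>" "\<rho> > 0" "0 < t" "t < pi / real k" "x $ e 0 = \<rho> * cos t" "x $ e 1 = \<rho> * sin t"
  shows "x \<in> sector k"
proof -
  have "pi / real k \<le> pi / 1" using k by (intro divide_left_mono) auto
  then have "sin t > 0" "sin (pi / real k - t) > 0" using assms by (auto intro!: sin_gt_zero)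
  moreover have "sin (pi / real k) * x $ e 0 - cos (pi / real k) * x $ e 1 = \<rho> * sin (pi / real k - t)"
    unfolding assms(6,7) sin_diff by (simp add: algebra_simps)
  ultimately have "x $ e 1 > 0" "sin (pi / real k) * x $ e 0 - cos (pi / real k) * x $ e 1 > 0"
    unfolding assms(7) using assms(3) by (simp_all only: mult_pos_pos)
  then show ?thesis unfolding sector_def mem_Collect_eq wall_inner using assms(2) by blast
qed

text \<open>Both sectors start at the same wall, so they are nested by their opening angles.\<close>

lemma sector_mono:
  assumes "2 \<le> k" "k \<le> j" shows "sector j \<subseteq> sector k"
proof
  fix x assume x: "x \<in> sector j"
  then obtain \<rho> t where "\<rho> > 0" "0 < t" "t < pi / real j" "x $ e 0 = \<rho> * cos t" "x $ e 1 = \<rho> * sin t"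
    using sector_polar[of j x] assms by auto
  moreover have "pi / real j \<le> pi / real k" using assms by (intro divide_left_mono) auto
  ultimately show "x \<in> sector k"
    using x assms by (intro polar_in_sector[of k x \<rho> t]) (auto simp: sector_def)
qed

text \<open>In units of \<open>pi / k\<close> the angle of a point of the sector lies in \<open>(0, 1)\<close>, while the group moves
  it to \<open>\<pm>\<tau>\<close> plus an even integer.\<close>

lemma sector_fundamental:
  assumes k: "k \<ge> 2" and g: "g \<in> Gk k" and x: "x \<in> sector k" "act e g x \<in> sector k"
  shows "g = mat 1"
proof -
  obtain j \<sigma> where g': "g = rotm (2 * pi * of_int j / real k) \<sigma>" and s: "\<sigma> = 1 \<or> \<sigma> = -1"
    using Gk_cases[OF g] k by auto
  define \<theta> where "\<theta> = 2 * pi * of_int j / real k"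
  obtain \<rho> t where P: "\<rho> > 0" "0 < t" "t < pi / real k" "x $ e 0 = \<rho> * cos t" "x $ e 1 = \<rho> * sin t"
    using sector_polar[OF k x(1)] by blast
  obtain \<rho>' t' where P': "\<rho>' > 0" "0 < t'" "t' < pi / real k" "act e g x $ e 0 = \<rho>' * cos t'" "act e g x $ e 1 = \<rho>' * sin t'"
    using sector_polar[OF k x(2)] by blast
  have g\<theta>: "g = rotm \<theta> \<sigma>" by (simp add: g' \<theta>_def)
  have A: "act e g x $ e 0 = \<rho> * cos (\<theta> + \<sigma> * t)" "act e g x $ e 1 = \<rho> * sin (\<theta> + \<sigma> * t)"
    using s e01 by (auto simp: act_nth g\<theta> P(4,5) cos_add sin_add cos_diff sin_diff algebra_simps)
  have sq: "(r * cos y)\<^sup>2 + (r * sin y)\<^sup>2 = r\<^sup>2" for r y :: real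
    using sin_cos_squared_add[of y] by algebra
  have "\<rho>\<^sup>2 = \<rho>'\<^sup>2"
    using sq[of \<rho> "\<theta> + \<sigma> * t"] sq[of \<rho>' t'] A P'(4,5) by simp
  then have \<rho>: "\<rho> = \<rho>'" using P(1) P'(1) by (simp add: power2_eq_iff)
  have "sin (\<theta> + \<sigma> * t) = sin t' \<and> cos (\<theta> + \<sigma> * t) = cos t'"
    using A P'(1,4,5) \<rho> by simp
  then obtain n :: int where n: "\<theta> + \<sigma> * t = t' + 2 * pi * of_int n" by (auto simp: sin_cos_eq_iff)
  define \<tau> where "\<tau> = t * real k / pi"
  define \<tau>' where "\<tau>' = t' * real k / pi"
  have \<tau>: "0 < \<tau>" "\<tau> < 1" "0 < \<tau>'" "\<tau>' < 1"
    using P(2,3) P'(2,3) k by (auto simp: \<tau>_def \<tau>'_def field_simps)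
  have "\<theta> * (real k / pi) = 2 * of_int j" using k by (simp add: \<theta>_def)
  then have "(\<theta> + \<sigma> * t) * (real k / pi) = 2 * of_int j + \<sigma> * \<tau>"
    unfolding distrib_right by (simp add: \<tau>_def)
  moreover have "(t' + 2 * pi * of_int n) * (real k / pi) = \<tau>' + 2 * of_int n * real k"
    unfolding distrib_right by (simp add: \<tau>'_def)
  ultimately have E: "2 * of_int j + \<sigma> * \<tau> = \<tau>' + 2 * of_int n * real k" using n by simp
  \<comment> \<open>\<open>2 * i\<close> equals \<open>\<tau>' - \<sigma> * \<tau>\<close> with
    \<open>\<tau>\<close> and \<open>\<tau>'\<close> in the open unit interval: for a rotation this
    forces \<open>i = 0\<close>, for a reflection it lies strictly between 0 and 2, where no even
    integer exists.\<close>
  define i where "i = j - n * int k"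
  have i: "2 * real_of_int i = \<tau>' - \<sigma> * \<tau>" using E by (simp add: i_def algebra_simps)
  show ?thesis
  proof (cases "\<sigma> = 1")
    case True
    then have "-1 < real_of_int i" "real_of_int i < 1" using i \<tau> by auto
    then have "i = 0" by linarith
    then have "j = n * int k" by (simp add: i_def)
    then have "2 * pi * of_int j / real k = 0 + 2 * pi * of_int n" using k by simp
    then have "rotm (2 * pi * of_int j / real k) 1 = rotm 0 1"
      using rotm_eq_iff[of 1 1] by blast
    then show ?thesis using g' True by (simp add: rotm_0_1)
  next
    case False
    then have "0 < real_of_int i" "real_of_int i < 1" using i \<tau> s by auto
    then have "0 < i" "i < 1" by simp_all
    then show ?thesis by simp
  qed
qed

text \<open>The element \<open>matrix_inv g ** h\<close> carries one point of the sector to another,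
  so it is the identity.\<close>

lemma sector_disjoint:
  assumes k: "k \<ge> 2" and g: "g \<in> Gk k" "h \<in> Gk k"
    and x: "act e (matrix_inv g) x \<in> sector k" "act e (matrix_inv h) x \<in> sector k"
  shows "g = h"
proof -
  have k1: "k \<ge> 1" using k by simp
  have "act e (matrix_inv g ** h) (act e (matrix_inv h) x) = act e (matrix_inv g) (act e (h ** matrix_inv h) x)"
    by (simp only: act_mult)
  also have "\<dots> = act e (matrix_inv g) x" by (simp add: Gk_inverse(1)[OF g(2) k1] act_1)
  finally have "matrix_inv g ** h = mat 1"
    using sector_fundamental[OF k Gk.gen_mult[OF Gk.gen_inv[OF g(1)] g(2)] x(2)] x(1) by simp
  then have "g ** (matrix_inv g ** h) = g" by simp
  then show ?thesis by (simp add: matrix_mul_assoc Gk_inverse(1)[OF g(1) k1])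
qed

lemma open_annulus: "open \<Omega>"
proof -
  have "continuous_on UNIV (\<lambda>x::real^'n. sqrt (\<Sum>i\<le>m. (x $ e i)\<^sup>2))" by (intro continuous_intros)
  then show ?thesis unfolding annular_dom_def by (intro open_Collect_conj open_Collect_less) auto
qed

lemma open_sector: "open (sector k)"
proof -
  have "sector k = \<Omega> \<inter> {x. 0 < wall1 \<bullet> x} \<inter> {x. 0 < wall2 k \<bullet> x}" by (auto simp: sector_def)
  then show ?thesis by (simp add: open_annulus open_Int open_Collect_less continuous_intros)
qed

lemma sector_nonempty:
  assumes k: "k \<ge> 2" shows "sector k \<noteq> {}"
proof -
  define \<rho> where "\<rho> = (a + b) / 2"
  define t where "t = pi / real k / 2"
  have \<rho>: "a < \<rho>" "\<rho> < b" "\<rho> > 0" using ab by (auto simp: \<rho>_def)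
  define x :: "real^'n" where "x = (\<chi> j. if j = e 0 then \<rho> * cos t else if j = e 1 then \<rho> * sin t else 0)"
  have x: "x $ e 0 = \<rho> * cos t" "x $ e 1 = \<rho> * sin t" using e01 by (auto simp: x_def)
  have "(\<Sum>i\<le>m. (x $ e i)\<^sup>2) = (x $ e 0)\<^sup>2 + (x $ e 1)\<^sup>2 + (\<Sum>j\<in>e ` {..m} - {e 0, e 1}. (x $ j)\<^sup>2)"
    unfolding radius_sum using m by (intro sum_squares_split) auto
  also have "(\<Sum>j\<in>e ` {..m} - {e 0, e 1}. (x $ j)\<^sup>2) = 0" by (intro sum.neutral) (auto simp: x_def)
  also have "(x $ e 0)\<^sup>2 + (x $ e 1)\<^sup>2 + 0 = \<rho>\<^sup>2"
    unfolding x using sin_cos_squared_add[of t] by algebra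
  finally have "x \<in> \<Omega>" using \<rho> by (simp add: annular_dom_def)
  moreover have "0 < t" "t < pi / real k"
  proof -
    have "0 < s / 2 \<and> s / 2 < s" if "s > 0" for s :: real using that by simp
    from this[of "pi / real k"] show "0 < t" "t < pi / real k" using k by (auto simp: t_def)
  qed
  ultimately show ?thesis using polar_in_sector[OF k _ \<rho>(3) _ _ x] by blast
qed

text \<open>The coordinates of \<open>z\<close>: translations along them preserve the sector, and
  all other coordinates are bounded by \<open>b\<close> there.\<close>

definition free_dirs :: "'n set" where "free_dirs = - (e ` {..m})"

lemma cylinder_sector:
  assumes k: "k \<ge> 2" shows "cylinder (sector k) free_dirs b p"
proof
  show "open (sector k)" by (rule open_sector)
  show "sector k \<noteq> {}" by (rule sector_nonempty[OF k])
  show "free_dirs \<noteq> UNIV" by (auto simp: free_dirs_def)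
  show "\<bar>x $ i\<bar> \<le> b" if "x \<in> sector k" "i \<notin> free_dirs" for x i
  proof -
    have "(x $ i)\<^sup>2 \<le> (\<Sum>i\<le>m. (x $ e i)\<^sup>2)"
      unfolding radius_sum using that(2) by (intro member_le_sum) (auto simp: free_dirs_def)
    then have "sqrt ((x $ i)\<^sup>2) \<le> sqrt (\<Sum>i\<le>m. (x $ e i)\<^sup>2)" by (rule real_sqrt_le_mono)
    also have "\<dots> < b" using that(1) by (simp add: sector_def annular_dom_def)
    finally show ?thesis by simp
  qed
  show "h + x \<in> sector k \<longleftrightarrow> x \<in> sector k" if h: "\<And>i. i \<notin> free_dirs \<Longrightarrow> h $ i = 0" for x h :: "real^'n"
  proof -
    have "h $ e i = 0" if "i \<le> m" for i using that h[of "e i"] by (auto simp: free_dirs_def)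
    then have "(h + x) $ e i = x $ e i" if "i \<le> m" for i using that by simp
    moreover have "(h + x) $ e 0 = x $ e 0" "(h + x) $ e 1 = x $ e 1" using calculation m by auto
    ultimately show ?thesis by (simp add: sector_def annular_dom_def wall_inner)
  qed
qed (use dim p_gt_2 p_lt in auto)

end

subsection \<open>Cutting off at the walls\<close>

text \<open>Mean value theorem on the normal segment from the projection of \<open>x\<close> onto
  the wall, where \<open>f\<close> vanishes.\<close>

lemma abs_le_distance_to_wall:
  fixes f :: "real^'n::finite \<Rightarrow> real"
  assumes f: "smooth_fun f" and C: "\<And>x. norm (grad f x) \<le> C" and v: "norm v = 1"
    and wall: "\<And>x. v \<bullet> x = 0 \<Longrightarrow> f x = 0"
  shows "\<bar>f x\<bar> \<le> C * \<bar>v \<bullet> x\<bar>"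
proof -
  define h where "h = (v \<bullet> x) *\<^sub>R v"
  define y where "y = x - h"
  have "v \<bullet> y = 0" using v by (simp add: y_def h_def inner_diff_right dot_square_norm)
  then have y0: "f y = 0" by (rule wall)
  have D: "((\<lambda>t. f (y + t *\<^sub>R h)) has_real_derivative grad f (y + t *\<^sub>R h) \<bullet> h) (at t)" for t
    by (rule smooth_fun_has_directional_derivative[OF f])
  have "\<exists>z>0. z < 1 \<and> f (y + 1 *\<^sub>R h) - f (y + 0 *\<^sub>R h) = (1 - 0) * (grad f (y + z *\<^sub>R h) \<bullet> h)"
    by (rule MVT2) (auto intro: D)
  then obtain z where "f x = grad f (y + z *\<^sub>R h) \<bullet> h" using y0 by (auto simp: y_def)
  then have "\<bar>f x\<bar> \<le> norm (grad f (y + z *\<^sub>R h)) * norm h" using Cauchy_Schwarz_ineq2 by simp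
  also have "\<dots> \<le> C * norm h" by (intro mult_right_mono C) auto
  finally show ?thesis using v by (simp add: h_def)
qed

text \<open>The cutoffs have gradients of order \<open>n\<close>, but only in strips of width of
  order \<open>1 / n\<close> along the walls, where \<open>|f|\<close> is itself of order
  \<open>1 / n\<close>. The products are bounded uniformly in \<open>n\<close>, which is why
  vanishing of \<open>f\<close> on the walls suffices.\<close>

lemma wall_cutoff_tendsto:
  fixes v1 v2 :: "real^'n::finite"
  assumes f: "test_fun \<Omega> f" and v: "norm v1 = 1" "norm v2 = 1"
    and wall: "\<And>x. v1 \<bullet> x = 0 \<Longrightarrow> f x = 0" "\<And>x. v2 \<bullet> x = 0 \<Longrightarrow> f x = 0"
  obtains F K M where "\<And>n::nat. test_fun {x \<in> \<Omega>. 0 < v1 \<bullet> x \<and> 0 < v2 \<bullet> x} (F n)"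
    "compact K" "\<And>n x. x \<notin> K \<Longrightarrow> F n x = 0 \<and> grad (F n) x = 0"
    "\<And>n x. \<bar>F n x\<bar> \<le> \<bar>f x\<bar>" "\<And>n x. norm (grad (F n) x) \<le> M"
    "\<And>x. 0 < v1 \<bullet> x \<Longrightarrow> 0 < v2 \<bullet> x \<Longrightarrow> \<forall>\<^sub>F n in sequentially. F n x = f x \<and> grad (F n) x = grad f x"
proof -
  obtain d B where d: "\<And>t. (smooth_step has_real_derivative d t) (at t)" "\<And>t. \<bar>d t\<bar> \<le> B"
    "\<And>t. t \<notin> {0<..<1} \<Longrightarrow> d t = 0" using smooth_step_has_derivative by blast
  have B0: "B \<ge> 0" using d(2)[of 0] by linarith
  obtain C where C: "C > 0" "\<And>x. \<bar>f x\<bar> \<le> C" "\<And>x. norm (grad f x) \<le> C" using test_fun_bounded[OF f] by metis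
  obtain K where K: "compact K" "K \<subseteq> \<Omega>" "\<And>x. x \<notin> K \<Longrightarrow> f x = 0" "\<And>x. x \<notin> K \<Longrightarrow> grad f x = 0"
    using test_fun_support[OF f] by metis
  note sf = test_fun_smooth[OF f]
  \<comment> \<open>Zero up to signed distance \<open>1 / Suc n\<close> from the wall, and one from
    distance \<open>2 / Suc n\<close> on.\<close>
  define q where "q v n x = smooth_step (-1 + (real (Suc n) *\<^sub>R v) \<bullet> x)" for v :: "real^'n" and n x
  have qs: "smooth_fun (q v n)" for v n unfolding q_def[abs_def] by (rule smooth_fun_step)
  have qg: "grad (q v n) x = d (-1 + (real (Suc n) *\<^sub>R v) \<bullet> x) *\<^sub>R (real (Suc n) *\<^sub>R v)" for v n x
    unfolding q_def[abs_def] by (rule grad_comp_linear_form[OF d(1)])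
  have q01: "0 \<le> q v n x" "q v n x \<le> 1" for v n x unfolding q_def by (rule smooth_step_bounds)+
  have fq: "\<bar>f x\<bar> * norm (grad (q v n) x) \<le> 2 * B * C" if v: "norm v = 1" and wall: "\<And>x. v \<bullet> x = 0 \<Longrightarrow> f x = 0" for v n x
  proof (cases "-1 + (real (Suc n) *\<^sub>R v) \<bullet> x \<in> {0<..<1}")
    case True
    define s where "s = v \<bullet> x"
    have s: "0 < real (Suc n) * s" "real (Suc n) * s < 2" using True by (auto simp: s_def)
    then have s0: "s > 0" by (simp add: zero_less_mult_iff)
    have "\<bar>f x\<bar> \<le> C * \<bar>s\<bar>" unfolding s_def by (rule abs_le_distance_to_wall[OF sf C(3) v wall])
    moreover have "norm (grad (q v n) x) \<le> B * real (Suc n)"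
      unfolding qg norm_scaleR v mult_1_right abs_of_nat by (intro mult_right_mono d(2)) simp
    ultimately have "\<bar>f x\<bar> * norm (grad (q v n) x) \<le> (C * s) * (B * real (Suc n))"
      using s0 C(1) by (intro mult_mono) auto
    also have "\<dots> = (B * C) * (real (Suc n) * s)" by (simp only: mult_ac)
    also have "\<dots> \<le> (B * C) * 2" using s B0 C(1) by (intro mult_left_mono) auto
    finally show ?thesis by simp
  next
    case False
    then show ?thesis using d(3)[OF False] B0 C(1) by (simp add: qg)
  qed
  define s where "s n x = q v1 n x * q v2 n x" for n x
  have ss: "smooth_fun (s n)" for n unfolding s_def[abs_def] by (intro smooth_fun_mult qs)
  have sg: "grad (s n) x = q v1 n x *\<^sub>R grad (q v2 n) x + q v2 n x *\<^sub>R grad (q v1 n) x" for n x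
    unfolding s_def[abs_def] by (rule grad_mult[OF qs qs])
  have s01: "0 \<le> s n x" "s n x \<le> 1" for n x
    unfolding s_def using q01[of v1 n x] q01[of v2 n x] by (auto intro: mult_le_one)
  define F where "F n x = s n x * f x" for n x
  have Fg: "grad (F n) x = s n x *\<^sub>R grad f x + f x *\<^sub>R grad (s n) x" for n x
    unfolding F_def[abs_def] by (rule grad_mult[OF ss sf])
  have Fs: "smooth_fun (F n)" for n unfolding F_def[abs_def] by (intro smooth_fun_mult ss sf)
  show ?thesis
  \<comment> \<open>\<open>C\<close> bounds the gradient of \<open>f\<close>, and each of the two
    walls adds \<open>2 * B * C\<close>.\<close>
  proof (rule that[of F K "C + 4 * B * C"])
    show "test_fun {x \<in> \<Omega>. 0 < v1 \<bullet> x \<and> 0 < v2 \<bullet> x} (F n)" for n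
    proof (rule test_funI[OF Fs])
      let ?L = "K \<inter> {x. 1 \<le> real (Suc n) * (v1 \<bullet> x)} \<inter> {x. 1 \<le> real (Suc n) * (v2 \<bullet> x)}"
      show "compact ?L"
        by (intro compact_Int_closed K closed_Collect_le continuous_intros)
      show "?L \<subseteq> {x \<in> \<Omega>. 0 < v1 \<bullet> x \<and> 0 < v2 \<bullet> x}"
      proof
        fix x assume x: "x \<in> ?L"
        then have "0 < real (Suc n) * (v1 \<bullet> x)" "0 < real (Suc n) * (v2 \<bullet> x)" by auto
        then have "0 < v1 \<bullet> x" "0 < v2 \<bullet> x" by (simp_all only: zero_less_mult_iff of_nat_0_less_iff) auto
        then show "x \<in> {x \<in> \<Omega>. 0 < v1 \<bullet> x \<and> 0 < v2 \<bullet> x}" using x K(2) by auto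
      qed
      show "F n x = 0" if "x \<notin> ?L" for x
        using that K(3)[of x] smooth_step_eq_0[of "-1 + real (Suc n) * (v1 \<bullet> x)"] smooth_step_eq_0[of "-1 + real (Suc n) * (v2 \<bullet> x)"]
        by (auto simp: F_def s_def q_def)
    qed
    show "compact K" by (rule K)
    show "F n x = 0 \<and> grad (F n) x = 0" if "x \<notin> K" for n x
      using K(3,4)[OF that] unfolding Fg by (simp add: F_def)
    show "\<bar>F n x\<bar> \<le> \<bar>f x\<bar>" for n x
      using s01[of n x] by (simp add: F_def abs_mult mult_left_le_one_le)
    show "norm (grad (F n) x) \<le> C + 4 * B * C" for n x
    proof -
      have "norm (grad (F n) x) \<le> norm (s n x *\<^sub>R grad f x) + norm (f x *\<^sub>R grad (s n) x)"
        unfolding Fg by (rule norm_triangle_ineq)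
      moreover have "norm (s n x *\<^sub>R grad f x) \<le> 1 * C"
        using s01[of n x] C(3)[of x] unfolding norm_scaleR by (intro mult_mono) auto
      moreover have "norm (f x *\<^sub>R grad (s n) x) \<le> 4 * B * C"
      proof -
        have "norm (grad (s n) x) \<le> norm (q v1 n x *\<^sub>R grad (q v2 n) x) + norm (q v2 n x *\<^sub>R grad (q v1 n) x)"
          unfolding sg by (rule norm_triangle_ineq)
        also have "\<dots> \<le> norm (grad (q v2 n) x) + norm (grad (q v1 n) x)"
          using q01[of v1 n x] q01[of v2 n x] unfolding norm_scaleR
          by (intro add_mono) (auto simp: mult_left_le_one_le)
        finally have "\<bar>f x\<bar> * norm (grad (s n) x) \<le> \<bar>f x\<bar> * (norm (grad (q v2 n) x) + norm (grad (q v1 n) x))"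
          by (intro mult_left_mono) auto
        also have "\<dots> \<le> 2 * B * C + 2 * B * C"
          unfolding distrib_left using fq[OF v(2) wall(2)] fq[OF v(1) wall(1)] by (intro add_mono)
        finally show ?thesis by simp
      qed
      ultimately show ?thesis by simp
    qed
    show "\<forall>\<^sub>F n in sequentially. F n x = f x \<and> grad (F n) x = grad f x" if x: "0 < v1 \<bullet> x" "0 < v2 \<bullet> x" for x
    proof -
      have ev: "\<forall>\<^sub>F n in sequentially. 2 \<le> real (Suc n) * t" if "t > 0" for t :: real
      proof -
        obtain N where N: "2 / t < real N" using reals_Archimedean2 by blast
        have "2 \<le> real (Suc n) * t" if "n \<ge> N" for n
        proof -
          have "2 / t \<le> real (Suc n)" using N that by simp
          then show ?thesis using \<open>t > 0\<close> by (simp add: pos_divide_le_eq)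
        qed
        then show ?thesis unfolding eventually_sequentially by blast
      qed
      from ev[OF x(1)] ev[OF x(2)] show ?thesis
      proof eventually_elim
        case (elim n)
        have "q v1 n x = 1" "q v2 n x = 1" using elim by (auto simp: q_def intro!: smooth_step_eq_1)
        moreover have "grad (q v1 n) x = 0" "grad (q v2 n) x = 0"
          using elim d(3) unfolding qg by simp_all
        ultimately show ?case by (simp add: Fg sg) (simp add: F_def s_def)
      qed
    qed
  qed
qed

text \<open>The wall cutoffs of \<open>f\<close> are admissible in the sector, and dominated
  convergence removes them: their gradients are bounded on a common compact set, and the functions
  stay below \<open>|f|\<close>. Off \<open>D\<close> both \<open>u\<close> and \<open>w\<close>
  vanish, so convergence of the cutoffs matters only inside.\<close>

lemma weak_equation_extends_to_walls:
  fixes v1 v2 :: "real^'n::finite" and \<Omega> :: "(real^'n) set"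
  defines "D \<equiv> {x \<in> \<Omega>. 0 < v1 \<bullet> x \<and> 0 < v2 \<bullet> x}"
  assumes p: "p > 2" and m [measurable]: "u \<in> borel_measurable borel" "w \<in> borel_measurable borel"
    and w2: "integrable lborel (\<lambda>x. (norm (w x))\<^sup>2)" and up: "integrable lborel (\<lambda>x. \<bar>u x\<bar> powr p)"
    and eq: "\<And>\<phi>. test_fun D \<phi> \<Longrightarrow> (\<integral>x. w x \<bullet> grad \<phi> x \<partial>lborel) = (\<integral>x. \<bar>u x\<bar> powr (p - 2) * u x * \<phi> x \<partial>lborel)"
    and out: "\<And>x. x \<notin> D \<Longrightarrow> u x = 0" "\<And>x. x \<notin> D \<Longrightarrow> w x = 0"
    and f: "test_fun \<Omega> f" and v: "norm v1 = 1" "norm v2 = 1"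
    and wall: "\<And>x. v1 \<bullet> x = 0 \<Longrightarrow> f x = 0" "\<And>x. v2 \<bullet> x = 0 \<Longrightarrow> f x = 0"
  shows "(\<integral>x. w x \<bullet> grad f x \<partial>lborel) = (\<integral>x. \<bar>u x\<bar> powr (p - 2) * u x * f x \<partial>lborel)"
proof -
  obtain F K M where F': "\<And>n::nat. test_fun {x \<in> \<Omega>. 0 < v1 \<bullet> x \<and> 0 < v2 \<bullet> x} (F n)" and
    K: "compact K" "\<And>n x. x \<notin> K \<Longrightarrow> F n x = 0 \<and> grad (F n) x = 0" and
    le: "\<And>n x. \<bar>F n x\<bar> \<le> \<bar>f x\<bar>" "\<And>n x. norm (grad (F n) x) \<le> M" and
    ev: "\<And>x. 0 < v1 \<bullet> x \<Longrightarrow> 0 < v2 \<bullet> x \<Longrightarrow> \<forall>\<^sub>F n in sequentially. F n x = f x \<and> grad (F n) x = grad f x"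
    by (rule wall_cutoff_tendsto[OF f v wall]) (assumption+, rule that)
  have F: "test_fun D (F n)" for n unfolding D_def by (rule F')
  have M: "M \<ge> 0" using le(2) norm_ge_zero order_trans by blast
  note [measurable] = test_fun_borel_measurable[OF f]
  have mF [measurable]: "F n \<in> borel_measurable borel" "grad (F n) \<in> borel_measurable borel" for n
    using test_fun_borel_measurable[OF F] by blast+
  have [measurable]: "K \<in> sets borel" using K(1) by (simp add: borel_compact)
  have lim: "(\<lambda>n. F n x) \<longlonglongrightarrow> f x" "(\<lambda>n. grad (F n) x) \<longlonglongrightarrow> grad f x" if "x \<in> D" for x
    using ev[of x] that unfolding D_def by (auto intro!: tendsto_eventually elim: eventually_mono)
  have "(\<lambda>n. \<integral>x. w x \<bullet> grad (F n) x \<partial>lborel) \<longlonglongrightarrow> (\<integral>x. w x \<bullet> grad f x \<partial>lborel)"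
  proof (rule integral_dominated_convergence)
    show "integrable lborel (\<lambda>x. M\<^sup>2 * indicator K x + (norm (w x))\<^sup>2)"
      using w2 emeasure_compact_finite[OF K(1)] by (intro Bochner_Integration.integrable_add integrable_mult_right) auto
    show "AE x in lborel. (\<lambda>n. w x \<bullet> grad (F n) x) \<longlonglongrightarrow> w x \<bullet> grad f x"
    proof (intro AE_I2)
      fix x show "(\<lambda>n. w x \<bullet> grad (F n) x) \<longlonglongrightarrow> w x \<bullet> grad f x"
        by (cases "x \<in> D") (auto simp: out intro!: tendsto_intros lim)
    qed
    show "AE x in lborel. norm (w x \<bullet> grad (F n) x) \<le> M\<^sup>2 * indicator K x + (norm (w x))\<^sup>2" for n
    proof (intro AE_I2)
      fix x
      show "norm (w x \<bullet> grad (F n) x) \<le> M\<^sup>2 * indicator K x + (norm (w x))\<^sup>2"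
      proof (cases "x \<in> K")
        case True
        have "\<bar>w x \<bullet> grad (F n) x\<bar> \<le> norm (w x) * norm (grad (F n) x)" by (rule Cauchy_Schwarz_ineq2)
        also have "\<dots> \<le> norm (w x) * M" by (intro mult_left_mono le) auto
        also have "\<dots> \<le> M\<^sup>2 + (norm (w x))\<^sup>2"
          using sum_squares_bound[of "norm (w x)" M] mult_nonneg_nonneg[OF norm_ge_zero[of "w x"] M]
          by (simp add: mult.assoc)
        finally show ?thesis using True by simp
      next
        case False then show ?thesis using K(2) by simp
      qed
    qed
  qed measurable
  moreover have "(\<lambda>n. \<integral>x. \<bar>u x\<bar> powr (p - 2) * u x * F n x \<partial>lborel) \<longlonglongrightarrow> (\<integral>x. \<bar>u x\<bar> powr (p - 2) * u x * f x \<partial>lborel)"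
  proof (rule integral_dominated_convergence)
    show "integrable lborel (\<lambda>x. \<bar>\<bar>u x\<bar> powr (p - 2) * u x * f x\<bar>)"
      using p by (intro integrable_abs integrable_powr_test_product up test_fun_integrable(3)[OF f]) auto
    show "AE x in lborel. (\<lambda>n. \<bar>u x\<bar> powr (p - 2) * u x * F n x) \<longlonglongrightarrow> \<bar>u x\<bar> powr (p - 2) * u x * f x"
    proof (intro AE_I2)
      fix x show "(\<lambda>n. \<bar>u x\<bar> powr (p - 2) * u x * F n x) \<longlonglongrightarrow> \<bar>u x\<bar> powr (p - 2) * u x * f x"
        by (cases "x \<in> D") (auto simp: out intro!: tendsto_mult tendsto_const lim)
    qed
    show "AE x in lborel. norm (\<bar>u x\<bar> powr (p - 2) * u x * F n x) \<le> \<bar>\<bar>u x\<bar> powr (p - 2) * u x * f x\<bar>" for n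
      using le(1) by (intro AE_I2) (simp add: abs_mult mult_left_mono)
  qed measurable
  ultimately show ?thesis
    unfolding eq[OF F] by (rule LIMSEQ_unique)
qed

subsection \<open>Reflection\<close>

lemma norm_sum_square_le:
  fixes f :: "'i \<Rightarrow> 'a::real_normed_vector"
  shows "(norm (\<Sum>i\<in>I. f i))\<^sup>2 \<le> real (card I) * (\<Sum>i\<in>I. (norm (f i))\<^sup>2)"
proof -
  have "(norm (\<Sum>i\<in>I. f i))\<^sup>2 \<le> (\<Sum>i\<in>I. norm (f i))\<^sup>2" by (intro power_mono norm_sum) auto
  also have "\<dots> \<le> real (card I) * (\<Sum>i\<in>I. (norm (f i))\<^sup>2)"
    using sum_squared_le_sum_of_squares[of "\<lambda>i. norm (f i)" I] by (simp add: mult.commute)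
  finally show ?thesis .
qed

text \<open>Each \<open>A i\<close> preserves distances and each \<open>T i\<close> preserves
  Lebesgue measure, so every summand has the same error. The factor \<open>card I\<close> occurs
  twice: from the square of a sum, and from adding equal integrals.\<close>

lemma L2_tendsto_symmetrized:
  fixes F :: "nat \<Rightarrow> 'a::euclidean_space \<Rightarrow> 'b::euclidean_space" and T S :: "'i \<Rightarrow> 'a \<Rightarrow> 'a"
  assumes I: "finite I" and [measurable]: "\<And>n. F n \<in> borel_measurable borel" "f \<in> borel_measurable borel"
    and T: "\<And>i. i \<in> I \<Longrightarrow> linear (T i)" "\<And>i x. i \<in> I \<Longrightarrow> norm (T i x) = norm x" "\<And>i y. i \<in> I \<Longrightarrow> T i (S i y) = y"
    and A: "\<And>i x y. i \<in> I \<Longrightarrow> norm (A i x - A i y) = norm (x - y)"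
    and lim: "(\<lambda>n. \<integral>\<^sup>+ x. ennreal ((norm (F n x - f x))\<^sup>2) \<partial>lborel) \<longlonglongrightarrow> 0"
  shows "(\<lambda>n. \<integral>\<^sup>+ x. ennreal ((norm ((\<Sum>i\<in>I. A i (F n (T i x))) - (\<Sum>i\<in>I. A i (f (T i x)))))\<^sup>2) \<partial>lborel) \<longlonglongrightarrow> 0"
proof (rule tendsto_sandwich[OF _ _ tendsto_const])
  let ?c = "real (card I)"
  let ?E = "\<lambda>n. \<integral>\<^sup>+ x. ennreal ((norm (F n x - f x))\<^sup>2) \<partial>lborel"
  have [measurable]: "T i \<in> borel_measurable borel" if "i \<in> I" for i
    using T(1)[OF that] by (intro borel_measurable_continuous_onI linear_continuous_on) (simp add: linear_conv_bounded_linear)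
  have "(\<integral>\<^sup>+ x. ennreal ((norm ((\<Sum>i\<in>I. A i (F n (T i x))) - (\<Sum>i\<in>I. A i (f (T i x)))))\<^sup>2) \<partial>lborel)
      \<le> ennreal (?c * ?c) * ?E n" for n
  proof -
    have "(norm ((\<Sum>i\<in>I. A i (F n (T i x))) - (\<Sum>i\<in>I. A i (f (T i x)))))\<^sup>2
        \<le> ?c * (\<Sum>i\<in>I. (norm (F n (T i x) - f (T i x)))\<^sup>2)" for x
      using norm_sum_square_le[of "\<lambda>i. A i (F n (T i x)) - A i (f (T i x))" I]
      by (simp add: sum_subtractf A)
    then have "(\<integral>\<^sup>+ x. ennreal ((norm ((\<Sum>i\<in>I. A i (F n (T i x))) - (\<Sum>i\<in>I. A i (f (T i x)))))\<^sup>2) \<partial>lborel)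
        \<le> (\<integral>\<^sup>+ x. ennreal ?c * (\<Sum>i\<in>I. ennreal ((norm (F n (T i x) - f (T i x)))\<^sup>2)) \<partial>lborel)"
      by (intro nn_integral_mono) (simp add: ennreal_mult'[symmetric] ennreal_leI sum_ennreal)
    also have "\<dots> = ennreal ?c * (\<integral>\<^sup>+ x. (\<Sum>i\<in>I. ennreal ((norm (F n (T i x) - f (T i x)))\<^sup>2)) \<partial>lborel)"
      by (rule nn_integral_cmult) measurable
    also have "(\<integral>\<^sup>+ x. (\<Sum>i\<in>I. ennreal ((norm (F n (T i x) - f (T i x)))\<^sup>2)) \<partial>lborel)
        = (\<Sum>i\<in>I. \<integral>\<^sup>+ x. ennreal ((norm (F n (T i x) - f (T i x)))\<^sup>2) \<partial>lborel)"
      by (rule nn_integral_sum) measurable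
    also have "(\<Sum>i\<in>I. \<integral>\<^sup>+ x. ennreal ((norm (F n (T i x) - f (T i x)))\<^sup>2) \<partial>lborel) = (\<Sum>i\<in>I. ?E n)"
    proof (intro sum.cong refl)
      fix i assume i: "i \<in> I"
      show "(\<integral>\<^sup>+ x. ennreal ((norm (F n (T i x) - f (T i x)))\<^sup>2) \<partial>lborel) = ?E n"
      proof (rule nn_integral_lborel_isometry[where T = "T i" and S = "S i" and f = "\<lambda>x. ennreal ((norm (F n x - f x))\<^sup>2)"])
        show "linear (T i)" "norm (T i x) = norm x" "T i (S i x) = x" for x using T i by blast+
      qed measurable
    qed
    also have "ennreal ?c * (\<Sum>i\<in>I. ?E n) = ennreal (?c * ?c) * ?E n"
      by (simp add: ennreal_mult' ennreal_of_nat_eq_real_of_nat mult.assoc)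
    finally show ?thesis .
  qed
  then show "\<forall>\<^sub>F n in sequentially. (\<integral>\<^sup>+ x. ennreal ((norm ((\<Sum>i\<in>I. A i (F n (T i x))) - (\<Sum>i\<in>I. A i (f (T i x)))))\<^sup>2) \<partial>lborel)
      \<le> ennreal (?c * ?c) * ?E n" by (intro always_eventually allI)
  show "(\<lambda>n. ennreal (?c * ?c) * ?E n) \<longlonglongrightarrow> 0" by (rule tendsto_cmult_ennreal_0[OF lim])
qed auto

context annular begin

lemma act_inverse:
  assumes "g \<in> Gk k" "k \<ge> 1"
  shows "act e g (act e (matrix_inv g) x) = x" "act e (matrix_inv g) (act e g x) = x"
  by (simp_all only: act_mult[symmetric] Gk_inverse[OF assms] act_1)

lemma matrix_inv_mult_Gk:
  assumes "g \<in> Gk k" "h \<in> Gk k" "k \<ge> 1"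
  shows "matrix_inv (g ** h) = matrix_inv h ** matrix_inv g"
proof -
  have "matrix_inv (g ** h) ** (g ** h) ** (matrix_inv h ** matrix_inv g) = matrix_inv h ** matrix_inv g"
    using Gk_inverse(2)[OF Gk.gen_mult[OF assms(1,2)] assms(3)] by simp
  moreover have "(g ** h) ** (matrix_inv h ** matrix_inv g) = mat 1"
  proof -
    have "(g ** h) ** (matrix_inv h ** matrix_inv g) = g ** (h ** matrix_inv h) ** matrix_inv g"
      by (simp only: matrix_mul_assoc)
    then show ?thesis by (simp add: Gk_inverse(1)[OF assms(1,3)] Gk_inverse(1)[OF assms(2,3)])
  qed
  ultimately show ?thesis by (metis matrix_mul_assoc matrix_mul_rid)
qed

lemma bij_betw_Gk_mult:
  assumes "h \<in> Gk k" "k \<ge> 1"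
  shows "bij_betw (\<lambda>g. h ** g) (Gk k) (Gk k)" "bij_betw (\<lambda>g. g ** h) (Gk k) (Gk k)"
proof -
  note i = Gk_inverse(1,2)[OF assms]
  show "bij_betw (\<lambda>g. h ** g) (Gk k) (Gk k)"
    by (rule bij_betw_byWitness[where f' = "\<lambda>g. matrix_inv h ** g"])
      (use assms i in \<open>auto simp: matrix_mul_assoc intro: Gk.gen_mult Gk.gen_inv\<close>)
  show "bij_betw (\<lambda>g. g ** h) (Gk k) (Gk k)"
    by (rule bij_betw_byWitness[where f' = "\<lambda>g. g ** matrix_inv h"])
      (use assms i in \<open>auto simp: matrix_mul_assoc[symmetric] intro: Gk.gen_mult Gk.gen_inv\<close>)
qed

text \<open>For \<open>f\<close> supported in the sector at most one summand is nonzero at each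
  point, since the images of the sector are disjoint; the sum is then the odd reflection of
  \<open>f\<close>.\<close>

definition antisymmetrize :: "nat \<Rightarrow> (real^'n \<Rightarrow> real) \<Rightarrow> real^'n \<Rightarrow> real" where
  "antisymmetrize k f x = (\<Sum>g\<in>Gk k. det g * f (act e (matrix_inv g) x))"

text \<open>Left multiplication by \<open>g\<close> permutes the group and multiplies every
  determinant by \<open>det g\<close>.\<close>

lemma antisymmetrize_symmetry:
  assumes g: "g \<in> Gk k" "k \<ge> 1"
  shows "antisymmetrize k f x = det g * antisymmetrize k f (act e (matrix_inv g) x)"
proof -
  have "antisymmetrize k f x = (\<Sum>h\<in>Gk k. det (g ** h) * f (act e (matrix_inv (g ** h)) x))"
    unfolding antisymmetrize_def by (rule sum.reindex_bij_betw[OF bij_betw_Gk_mult(1)[OF g], symmetric])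
  also have "\<dots> = (\<Sum>h\<in>Gk k. det g * (det h * f (act e (matrix_inv h) (act e (matrix_inv g) x))))"
    by (intro sum.cong refl) (simp add: matrix_inv_mult_Gk[OF g(1) _ g(2)] det_mul act_mult)
  finally show ?thesis by (simp add: antisymmetrize_def sum_distrib_left)
qed

lemma det_Gk: "g \<in> Gk k \<Longrightarrow> k \<ge> 1 \<Longrightarrow> \<bar>det g\<bar> = 1"
  using Gk_inverse(3)[of g k] by (simp add: abs_square_eq_1 power2_eq_square[symmetric])

text \<open>The dual sum, with \<open>g\<close> in place of its inverse, is the one applied to test
  functions; here right multiplication by \<open>h\<close> permutes the group.\<close>

lemma twisted_sum_symmetry:
  assumes h: "h \<in> Gk k" "k \<ge> 1"
  shows "(\<Sum>g\<in>Gk k. det g * f (act e g (act e h x))) = det h * (\<Sum>g\<in>Gk k. det g * f (act e g x))"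
proof -
  have "det h * (\<Sum>g\<in>Gk k. det g * f (act e g x)) = det h * (\<Sum>g\<in>Gk k. det (g ** h) * f (act e (g ** h) x))"
    by (subst sum.reindex_bij_betw[OF bij_betw_Gk_mult(2)[OF h], symmetric]) simp
  also have "\<dots> = (\<Sum>g\<in>Gk k. (det h * det h) * (det g * f (act e g (act e h x))))"
    unfolding sum_distrib_left by (intro sum.cong refl) (simp add: det_mul act_mult mult_ac)
  finally show ?thesis by (simp add: Gk_inverse(3)[OF h])
qed

text \<open>Conjugation fixes this wall and has determinant -1, so the sum equals its own
  negative.\<close>

lemma twisted_sum_wall1:
  assumes k: "k \<ge> 1" and x: "wall1 \<bullet> x = 0"
  shows "(\<Sum>g\<in>Gk k. det g * f (act e g x)) = 0"
proof -
  have "dihedral k (0, -1) \<in> Gk k" unfolding Gk_eq[OF k] using k by (intro imageI) auto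
  then have h: "rotm 0 (-1) \<in> Gk k" by (simp add: dihedral_def)
  have "act e (rotm 0 (-1)) x = x"
    using x by (simp add: vec_eq_iff act_nth wall_inner)
  from twisted_sum_symmetry[OF h k, of f x, unfolded this det_rotm] show ?thesis by simp
qed

text \<open>The generator \<open>refl_k k\<close> is the reflection across this wall: by the double
  angle formulas it fixes the line at angle \<open>t = pi / k\<close>. Its determinant -1 makes the
  sum its own negative.\<close>

lemma twisted_sum_wall2:
  assumes k: "k \<ge> 1" and x: "wall2 k \<bullet> x = 0"
  shows "(\<Sum>g\<in>Gk k. det g * f (act e g x)) = 0"
proof -
  define t where "t = pi / real k"
  have t2: "2 * pi / real k = 2 * t" by (simp add: t_def)
  have h: "rotm (2 * t) (-1) \<in> Gk k" using Gk.gen_beta[of k] by (simp add: rot_refl_rotm t2[symmetric])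
  have w: "sin t * x $ e 0 = cos t * x $ e 1" using x by (simp add: wall_inner t_def)
  have sq: "(sin t)\<^sup>2 + (cos t)\<^sup>2 = 1" by simp
  have "cos (2 * t) * x $ e 0 + sin (2 * t) * x $ e 1 = x $ e 0"
    unfolding cos_double sin_double using w sq by algebra
  moreover have "sin (2 * t) * x $ e 0 - cos (2 * t) * x $ e 1 = x $ e 1"
    unfolding cos_double sin_double using w sq by algebra
  ultimately have "act e (rotm (2 * t) (-1)) x = x"
    by (auto simp: vec_eq_iff act_nth)
  from twisted_sum_symmetry[OF h k, of f x, unfolded this det_rotm] show ?thesis by simp
qed

text \<open>Moving the group from the solution to the test function reduces the equation on the
  annulus to the equation on one sector. The antisymmetrized approximations \<open>\<Phi> n\<close>
  of the sector solution place the result in \<open>H10\<close>.\<close>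

theorem sector_solution:
  assumes k: "k \<ge> 3"
  obtains u where "weak_solution \<Omega> p (antisymmetrize k u)" "antisymmetrize k u \<in> borel_measurable borel"
    "(\<integral>x. \<bar>antisymmetrize k u x\<bar> powr p \<partial>lborel) = 2 * real k * cylinder.level (sector k) p powr (p / (p - 2))"
proof -
  have k1: "k \<ge> 1" and k2: "k \<ge> 2" using k by auto
  have p0: "p > 0" using p_gt_2 by simp
  interpret C: cylinder "sector k" free_dirs b p by (rule cylinder_sector[OF k2])
  obtain u w \<psi> where um [measurable]: "u \<in> borel_measurable borel" "w \<in> borel_measurable borel" and
    \<psi>: "\<And>n::nat. test_fun (sector k) (\<psi> n)" and
    lim: "(\<lambda>n. \<integral>\<^sup>+ x. ennreal ((norm (\<psi> n x - u x))\<^sup>2) \<partial>lborel) \<longlonglongrightarrow> 0"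
      "(\<lambda>n. \<integral>\<^sup>+ x. ennreal ((norm (grad (\<psi> n) x - w x))\<^sup>2) \<partial>lborel) \<longlonglongrightarrow> 0" and
    int: "integrable lborel (\<lambda>x. (u x)\<^sup>2)" "integrable lborel (\<lambda>x. (norm (w x))\<^sup>2)"
      "integrable lborel (\<lambda>x. \<bar>u x\<bar> powr p)" and
    mass: "(\<integral>x. \<bar>u x\<bar> powr p \<partial>lborel) = C.level powr (p / (p - 2))" and
    eq: "\<And>\<phi>. test_fun (sector k) \<phi> \<Longrightarrow> (\<integral>x. w x \<bullet> grad \<phi> x \<partial>lborel) = (\<integral>x. \<bar>u x\<bar> powr (p - 2) * u x * \<phi> x \<partial>lborel)" and
    out: "\<And>x. x \<notin> sector k \<Longrightarrow> u x = 0" "\<And>x. x \<notin> sector k \<Longrightarrow> w x = 0"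
    by (rule C.solution_on_cylinder) (rule that)
  define G where "G = Gk k"
  define T where "T g = act e g" for g
  define R where "R g = act e (matrix_inv g)" for g
  have fin: "finite G" unfolding G_def by (rule finite_Gk[OF k1])
  have card: "card G = 2 * k" unfolding G_def by (rule card_Gk[OF k1])
  have lin: "linear (T g)" "linear (R g)" for g unfolding T_def R_def by (rule linear_act)+
  have iso: "norm (T g x) = norm x" "norm (R g x) = norm x" if "g \<in> G" for g x
    using that norm_act[OF _ k1] Gk.gen_inv unfolding T_def R_def G_def by blast+
  have inv: "T g (R g x) = x" "R g (T g x) = x" if "g \<in> G" for g x
    using act_inverse[OF _ k1] that unfolding T_def R_def G_def by blast+
  have \<Omega>T: "T g x \<in> \<Omega>" "R g x \<in> \<Omega>" if "g \<in> G" "x \<in> \<Omega>" for g x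
    using act_in_annulus[OF _ k1] Gk.gen_inv that unfolding T_def R_def G_def by blast+
  have det1: "\<bar>det g\<bar> = 1" if "g \<in> G" for g using det_Gk[OF _ k1] that by (simp add: G_def)
  have Tm [measurable]: "T g \<in> borel_measurable borel" "R g \<in> borel_measurable borel" for g
    using lin[of g] by (auto intro!: borel_measurable_continuous_onI linear_continuous_on simp: linear_conv_bounded_linear)
  have m\<psi> [measurable]: "\<psi> n \<in> borel_measurable borel" "grad (\<psi> n) \<in> borel_measurable borel" for n
    using test_fun_borel_measurable[OF \<psi>] by blast+
  have sub: "(\<integral>x. f (T g x) \<partial>lborel) = (\<integral>x. f x \<partial>lborel)" "integrable lborel (\<lambda>x. f (T g x)) \<longleftrightarrow> integrable lborel f"
    if "g \<in> G" "f \<in> borel_measurable borel" for g and f :: "real^'n \<Rightarrow> real"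
    using lborel_isometry_integral[where T = "T g" and S = "R g" and f = f] lin iso inv that by blast+
  have subR: "(\<integral>x. f (R g x) \<partial>lborel) = (\<integral>x. f x \<partial>lborel)" "integrable lborel (\<lambda>x. f (R g x)) \<longleftrightarrow> integrable lborel f"
    if "g \<in> G" "f \<in> borel_measurable borel" for g and f :: "real^'n \<Rightarrow> real"
    using lborel_isometry_integral[where T = "R g" and S = "T g" and f = f] lin iso inv that by blast+
  define U where "U = antisymmetrize k u"
  \<comment> \<open>Gradients of compositions with \<open>R g\<close> are carried back by
    \<open>T g\<close>, as the chain rule for isometries prescribes.\<close>
  define W where "W x = (\<Sum>g\<in>G. det g *\<^sub>R T g (w (R g x)))" for x
  define \<Phi> where "\<Phi> n x = (\<Sum>g\<in>G. det g * \<psi> n (R g x))" for n x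
  have U: "U x = (\<Sum>g\<in>G. det g * u (R g x))" for x
    by (simp add: U_def antisymmetrize_def G_def R_def)
  have Um [measurable]: "U \<in> borel_measurable borel" unfolding U[abs_def] by measurable
  have Wm [measurable]: "W \<in> borel_measurable borel" unfolding W_def[abs_def] by measurable
  have t\<psi>: "test_fun \<Omega> (\<lambda>x. \<psi> n (R g x))" if g: "g \<in> G" for g n
    by (rule test_fun_comp_linear[OF \<psi> lin(2) lin(1)[of g]]) (use inv[OF g] \<Omega>T[OF g] in \<open>auto simp: sector_def\<close>)
  have \<Phi>: "test_fun \<Omega> (\<Phi> n)" for n
    unfolding \<Phi>_def[abs_def] by (intro test_fun_sum test_fun_cmult t\<psi>)
  have g\<Phi>: "grad (\<Phi> n) x = (\<Sum>g\<in>G. det g *\<^sub>R T g (grad (\<psi> n) (R g x)))" for n x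
  proof -
    have "grad (\<Phi> n) x = (\<Sum>g\<in>G. grad (\<lambda>x. det g * \<psi> n (R g x)) x)"
      unfolding \<Phi>_def[abs_def] by (intro grad_sum smooth_fun_cmult test_fun_smooth[OF t\<psi>])
    also have "\<dots> = (\<Sum>g\<in>G. det g *\<^sub>R T g (grad (\<psi> n) (R g x)))"
    proof (intro sum.cong refl)
      fix g assume g: "g \<in> G"
      have "grad (\<lambda>x. \<psi> n (R g x)) x = T g (grad (\<psi> n) (R g x))"
        by (rule grad_comp_isometry[OF test_fun_smooth[OF \<psi>] lin(2) lin(1)]) (use iso[OF g] inv[OF g] in auto)
      then show "grad (\<lambda>x. det g * \<psi> n (R g x)) x = det g *\<^sub>R T g (grad (\<psi> n) (R g x))"
        by (simp add: grad_cmult[OF test_fun_smooth[OF t\<psi>[OF g]]])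
    qed
    finally show ?thesis .
  qed
  have limU: "(\<lambda>n. \<integral>\<^sup>+ x. ennreal ((norm (\<Phi> n x - U x))\<^sup>2) \<partial>lborel) \<longlonglongrightarrow> 0"
    unfolding \<Phi>_def U
    by (rule L2_tendsto_symmetrized[where A = "\<lambda>g t. det g * t" and T = R and S = T, OF fin _ _ _ _ _ _ lim(1)])
      (use lin iso inv det1 in \<open>auto simp: right_diff_distrib[symmetric] abs_mult\<close>)
  have limW: "(\<lambda>n. \<integral>\<^sup>+ x. ennreal ((norm (grad (\<Phi> n) x - W x))\<^sup>2) \<partial>lborel) \<longlonglongrightarrow> 0"
    unfolding g\<Phi> W_def
    by (rule L2_tendsto_symmetrized[where A = "\<lambda>g t. det g *\<^sub>R T g t" and T = R and S = T, OF fin _ _ _ _ _ _ lim(2)])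
      (use lin iso inv det1 in \<open>auto simp: scaleR_diff_right[symmetric] linear_diff[OF lin(1), symmetric]\<close>)
  obtain n1 where n1: "(\<integral>\<^sup>+ x. ennreal ((norm (\<Phi> n1 x - U x))\<^sup>2) \<partial>lborel) < \<infinity>"
    using ennreal_tendsto_0_finite[OF limU] by blast
  obtain n2 where n2: "(\<integral>\<^sup>+ x. ennreal ((norm (grad (\<Phi> n2) x - W x))\<^sup>2) \<partial>lborel) < \<infinity>"
    using ennreal_tendsto_0_finite[OF limW] by blast
  have m\<Phi> [measurable]: "\<Phi> n \<in> borel_measurable borel" "grad (\<Phi> n) \<in> borel_measurable borel" for n
    using test_fun_borel_measurable[OF \<Phi>] by blast+
  have U2: "integrable lborel (\<lambda>x. (U x)\<^sup>2)"
    using integrable_square_norm_limit(2)[OF _ _ _ n1] test_fun_integrable(1)[OF \<Phi>] by simp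
  have W2: "integrable lborel (\<lambda>x. (norm (W x))\<^sup>2)"
    using integrable_square_norm_limit(2)[OF _ _ _ n2] test_fun_integrable(2)[OF \<Phi>] by simp
  have disjoint: "g = h" if "g \<in> G" "h \<in> G" "R g x \<in> sector k" "R h x \<in> sector k" for g h x
    using sector_disjoint[OF k2] that unfolding G_def R_def by blast
  \<comment> \<open>At each point at most one term of the sum survives, so the nonlinear expressions
    in \<open>U\<close> split into sums over the group; the sign disappears inside absolute
    values.\<close>
  have collapse: "\<bar>U x\<bar> powr p = (\<Sum>g\<in>G. \<bar>u (R g x)\<bar> powr p) \<and>
      \<bar>U x\<bar> powr (p - 2) * U x = (\<Sum>g\<in>G. det g * (\<bar>u (R g x)\<bar> powr (p - 2) * u (R g x)))" for x
  proof (cases "\<exists>h\<in>G. R h x \<in> sector k")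
    case True
    then obtain h where h: "h \<in> G" "R h x \<in> sector k" by blast
    have 0: "u (R g x) = 0" if "g \<in> G - {h}" for g
      using that disjoint[of g h x] h by (intro out(1)) blast
    have one: "(\<Sum>g\<in>G. F g) = F h" if "\<And>g. g \<in> G - {h} \<Longrightarrow> F g = 0" for F :: "real^2^2 \<Rightarrow> real"
      using that by (simp add: sum.remove[OF fin h(1)])
    have Uh: "U x = det h * u (R h x)" unfolding U by (rule one) (simp add: 0)
    have "(\<Sum>g\<in>G. \<bar>u (R g x)\<bar> powr p) = \<bar>u (R h x)\<bar> powr p" by (rule one) (simp add: 0)
    moreover have "(\<Sum>g\<in>G. det g * (\<bar>u (R g x)\<bar> powr (p - 2) * u (R g x))) = det h * (\<bar>u (R h x)\<bar> powr (p - 2) * u (R h x))"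
      by (rule one) (simp add: 0)
    ultimately show ?thesis by (simp add: Uh abs_mult det1[OF h(1)])
  next
    case False
    then have 0: "u (R g x) = 0" if "g \<in> G" for g using that by (intro out(1)) blast
    then show ?thesis by (simp add: U)
  qed
  have Up_int: "integrable lborel (\<lambda>x. \<bar>U x\<bar> powr p)"
    using subR(2)[of _ "\<lambda>x. \<bar>u x\<bar> powr p"] int(3) by (simp add: collapse)
  have "(\<integral>x. \<bar>U x\<bar> powr p \<partial>lborel) = (\<integral>x. (\<Sum>g\<in>G. \<bar>u (R g x)\<bar> powr p) \<partial>lborel)"
    by (simp add: collapse)
  also have "\<dots> = (\<Sum>g\<in>G. \<integral>x. \<bar>u (R g x)\<bar> powr p \<partial>lborel)"
    using subR(2)[of _ "\<lambda>x. \<bar>u x\<bar> powr p"] int(3) by (intro Bochner_Integration.integral_sum) simp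
  also have "\<dots> = (\<Sum>g\<in>G. C.level powr (p / (p - 2)))"
    using subR(1)[of _ "\<lambda>x. \<bar>u x\<bar> powr p"] mass by (intro sum.cong) auto
  finally have Umass: "(\<integral>x. \<bar>U x\<bar> powr p \<partial>lborel) = 2 * real k * C.level powr (p / (p - 2))"
    by (simp add: card)
  have weak: "(\<integral>x. W x \<bullet> grad \<phi> x \<partial>lborel) = (\<integral>x. \<bar>U x\<bar> powr (p - 2) * U x * \<phi> x \<partial>lborel)"
    if \<phi>: "test_fun \<Omega> \<phi>" for \<phi>
  proof -
    note [measurable] = test_fun_borel_measurable[OF \<phi>]
    \<comment> \<open>This test function collects the group action transferred from \<open>W\<close>
      by the changes of variables \<open>x \<mapsto> T g x\<close>.\<close>
    define f where "f x = (\<Sum>g\<in>G. det g * \<phi> (T g x))" for x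
    have tg: "test_fun \<Omega> (\<lambda>x. \<phi> (T g x))" if g: "g \<in> G" for g
      by (rule test_fun_comp_linear[OF \<phi> lin(1) lin(2)[of g]]) (use inv[OF g] \<Omega>T[OF g] in auto)
    have f: "test_fun \<Omega> f" unfolding f_def[abs_def] by (intro test_fun_sum test_fun_cmult tg)
    have gf: "grad f x = (\<Sum>g\<in>G. det g *\<^sub>R grad (\<lambda>x. \<phi> (T g x)) x)" for x
    proof -
      have "grad f x = (\<Sum>g\<in>G. grad (\<lambda>x. det g * \<phi> (T g x)) x)"
        unfolding f_def[abs_def] by (intro grad_sum smooth_fun_cmult test_fun_smooth[OF tg])
      then show ?thesis by (simp add: grad_cmult[OF test_fun_smooth[OF tg]])
    qed
    define P where "P g x = T g (w (R g x)) \<bullet> grad \<phi> x" for g x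
    have Pm [measurable]: "P g \<in> borel_measurable borel" for g unfolding P_def[abs_def] by measurable
    have PT: "P g (T g x) = w x \<bullet> grad (\<lambda>x. \<phi> (T g x)) x" if g: "g \<in> G" for g x
      using grad_comp_linear_inner[OF test_fun_smooth[OF \<phi>] lin(1), of g x "w x"] inv(2)[OF g]
      by (simp add: P_def inner_commute)
    have wi: "integrable lborel (\<lambda>x. w x \<bullet> grad (\<lambda>x. \<phi> (T g x)) x)" if g: "g \<in> G" for g
      using test_fun_borel_measurable(2)[OF tg[OF g]]
      by (intro integrable_inner_square int test_fun_integrable(2)[OF tg[OF g]]) auto
    have Pi: "integrable lborel (P g)" if g: "g \<in> G" for g
      using wi[OF g] sub(2)[OF g Pm, of g] by (simp only: PT[OF g])
    have PE: "(\<integral>x. P g x \<partial>lborel) = (\<integral>x. w x \<bullet> grad (\<lambda>x. \<phi> (T g x)) x \<partial>lborel)" if g: "g \<in> G" for g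
      using sub(1)[OF g Pm, of g] by (simp only: PT[OF g])
    have "(\<integral>x. W x \<bullet> grad \<phi> x \<partial>lborel) = (\<integral>x. (\<Sum>g\<in>G. det g * P g x) \<partial>lborel)"
      by (simp add: W_def P_def inner_sum_left)
    also have "\<dots> = (\<Sum>g\<in>G. \<integral>x. det g * P g x \<partial>lborel)"
      using Pi by (intro Bochner_Integration.integral_sum integrable_mult_right)
    also have "\<dots> = (\<Sum>g\<in>G. \<integral>x. det g * (w x \<bullet> grad (\<lambda>x. \<phi> (T g x)) x) \<partial>lborel)"
      by (intro sum.cong) (simp_all add: PE)
    also have "\<dots> = (\<integral>x. (\<Sum>g\<in>G. det g * (w x \<bullet> grad (\<lambda>x. \<phi> (T g x)) x)) \<partial>lborel)"
      using wi by (intro Bochner_Integration.integral_sum[symmetric] integrable_mult_right)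
    also have "\<dots> = (\<integral>x. w x \<bullet> grad f x \<partial>lborel)"
      by (simp add: gf inner_sum_right)
    also have "\<dots> = (\<integral>x. \<bar>u x\<bar> powr (p - 2) * u x * f x \<partial>lborel)"
    proof (rule weak_equation_extends_to_walls[where \<Omega> = \<Omega> and ?v1.0 = wall1 and ?v2.0 = "wall2 k"])
      show "(\<integral>x. w x \<bullet> grad \<phi> x \<partial>lborel) = (\<integral>x. \<bar>u x\<bar> powr (p - 2) * u x * \<phi> x \<partial>lborel)"
        if "test_fun {x \<in> \<Omega>. 0 < wall1 \<bullet> x \<and> 0 < wall2 k \<bullet> x} \<phi>" for \<phi>
        using eq that unfolding sector_def by blast
      show "u x = 0" "w x = 0" if "x \<notin> {x \<in> \<Omega>. 0 < wall1 \<bullet> x \<and> 0 < wall2 k \<bullet> x}" for x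
        using out that unfolding sector_def by blast+
      show "f x = 0" if "wall1 \<bullet> x = 0" for x
        using twisted_sum_wall1[OF k1 that] by (simp add: f_def G_def T_def)
      show "f x = 0" if "wall2 k \<bullet> x = 0" for x
        using twisted_sum_wall2[OF k1 that] by (simp add: f_def G_def T_def)
    qed (use p_gt_2 int f norm_wall in auto)
    also have "\<dots> = (\<integral>x. (\<Sum>g\<in>G. det g * (\<bar>u x\<bar> powr (p - 2) * u x * \<phi> (T g x))) \<partial>lborel)"
      by (simp add: f_def sum_distrib_left mult_ac)
    also have "\<dots> = (\<Sum>g\<in>G. \<integral>x. det g * (\<bar>u x\<bar> powr (p - 2) * u x * \<phi> (T g x)) \<partial>lborel)"
    proof (intro Bochner_Integration.integral_sum integrable_mult_right)
      show "integrable lborel (\<lambda>x. \<bar>u x\<bar> powr (p - 2) * u x * \<phi> (T g x))" if g: "g \<in> G" for g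
        using p0 p_gt_2 by (intro integrable_powr_test_product int test_fun_integrable(3)[OF tg[OF g]]) auto
    qed
    \<comment> \<open>The change of variables in the opposite direction returns the group from the
      test function to \<open>u\<close>.\<close>
    also have "\<dots> = (\<Sum>g\<in>G. \<integral>x. det g * (\<bar>u (R g x)\<bar> powr (p - 2) * u (R g x)) * \<phi> x \<partial>lborel)"
    proof (intro sum.cong refl)
      fix g assume g: "g \<in> G"
      show "(\<integral>x. det g * (\<bar>u x\<bar> powr (p - 2) * u x * \<phi> (T g x)) \<partial>lborel)
         = (\<integral>x. det g * (\<bar>u (R g x)\<bar> powr (p - 2) * u (R g x)) * \<phi> x \<partial>lborel)"
        using sub(1)[OF g, of "\<lambda>x. det g * (\<bar>u (R g x)\<bar> powr (p - 2) * u (R g x)) * \<phi> x"]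
        by (simp add: inv(2)[OF g] mult.assoc)
    qed
    also have "\<dots> = (\<integral>x. (\<Sum>g\<in>G. det g * (\<bar>u (R g x)\<bar> powr (p - 2) * u (R g x)) * \<phi> x) \<partial>lborel)"
    proof (intro Bochner_Integration.integral_sum[symmetric])
      fix g assume g: "g \<in> G"
      have "integrable lborel (\<lambda>x. \<bar>u (R g x)\<bar> powr (p - 2) * u (R g x) * \<phi> x)"
        using p0 p_gt_2 subR(2)[OF g, of "\<lambda>x. \<bar>u x\<bar> powr p"] int(3)
        by (intro integrable_powr_test_product test_fun_integrable(3)[OF \<phi>]) auto
      from integrable_mult_right[OF this, of "det g"]
      show "integrable lborel (\<lambda>x. det g * (\<bar>u (R g x)\<bar> powr (p - 2) * u (R g x)) * \<phi> x)"
        by (simp add: mult.assoc)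
    qed
    also have "\<dots> = (\<integral>x. \<bar>U x\<bar> powr (p - 2) * U x * \<phi> x \<partial>lborel)"
      by (simp add: collapse sum_distrib_right)
    finally show ?thesis .
  qed
  have "H10 \<Omega> U W"
    unfolding H10_def nn_integral_completion
  proof (intro conjI)
    show "U \<in> borel_measurable lebesgue" "W \<in> borel_measurable lebesgue"
      by (auto intro!: measurable_completion)
    show "(\<integral>\<^sup>+ x. ennreal ((U x)\<^sup>2) \<partial>lborel) < \<infinity>" "(\<integral>\<^sup>+ x. ennreal ((norm (W x))\<^sup>2) \<partial>lborel) < \<infinity>"
      using nn_integral_eq_integral[OF U2] nn_integral_eq_integral[OF W2] by simp_all
    show "\<exists>\<phi>. (\<forall>k. test_fun \<Omega> (\<phi> k)) \<and> (\<lambda>k. \<integral>\<^sup>+ x. ennreal ((\<phi> k x - U x)\<^sup>2) \<partial>lborel) \<longlonglongrightarrow> 0 \<and>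
        (\<lambda>k. \<integral>\<^sup>+ x. ennreal ((norm (grad (\<phi> k) x - W x))\<^sup>2) \<partial>lborel) \<longlonglongrightarrow> 0"
      using \<Phi> limU limW by (intro exI[of _ \<Phi>]) simp
  qed
  moreover have "(\<integral>x. W x \<bullet> grad \<phi> x \<partial>lebesgue) = (\<integral>x. \<bar>U x\<bar> powr (p - 2) * U x * \<phi> x \<partial>lebesgue)"
    if \<phi>: "test_fun \<Omega> \<phi>" for \<phi>
  proof -
    note [measurable] = test_fun_borel_measurable[OF \<phi>]
    show ?thesis using weak[OF \<phi>] by (simp add: integral_completion)
  qed
  moreover have "integrable lebesgue (\<lambda>x. (norm (W x))\<^sup>2)" "integrable lebesgue (\<lambda>x. \<bar>U x\<bar> powr p)"
    using W2 Up_int by (simp_all add: integrable_completion)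
  ultimately have "weak_solution \<Omega> p U" unfolding weak_solution_def by blast
  with Um Umass show ?thesis using that[of u] by (simp add: U_def)
qed

section \<open>Comparison of levels and energies for different \<open>k\<close>\<close>

lemma level_sector_pos: "k \<ge> 2 \<Longrightarrow> 0 < cylinder.level (sector k) p"
  using cylinder.level_pos[OF cylinder_sector] .

text \<open>Test functions of the smaller sector are test functions of the larger one, so the
  infimum for the smaller sector runs over fewer competitors.\<close>

lemma level_sector_mono:
  assumes "2 \<le> k" "k \<le> j" shows "cylinder.level (sector k) p \<le> cylinder.level (sector j) p"
proof -
  interpret K: cylinder "sector k" free_dirs b p by (rule cylinder_sector) (use assms in simp)
  interpret J: cylinder "sector j" free_dirs b p by (rule cylinder_sector) (use assms in simp)
  show ?thesis
    unfolding J.level_def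
  proof (rule cInf_greatest)
    show "{dirichlet \<phi> |\<phi>. test_fun (sector j) \<phi> \<and> power_mass p \<phi> = 1} \<noteq> {}"
      using J.normalized_test_fun_exists by blast
  qed (auto intro!: K.level_le elim: test_fun_mono[OF _ sector_mono[OF assms]])
qed

text \<open>Monotonicity of the levels is weak; strictness comes from the factor \<open>k\<close>,
  together with positivity of the levels.\<close>

lemma energy_strict_mono:
  assumes "2 \<le> k" "k < j"
  shows "2 * real k * cylinder.level (sector k) p powr (p / (p - 2)) < 2 * real j * cylinder.level (sector j) p powr (p / (p - 2))"
proof -
  have le: "cylinder.level (sector k) p powr (p / (p - 2)) \<le> cylinder.level (sector j) p powr (p / (p - 2))"
    using assms p_gt_2 level_sector_mono[of k j] level_sector_pos[of k] by (intro powr_mono2) auto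
  have pos: "0 < cylinder.level (sector k) p powr (p / (p - 2))"
    using level_sector_pos[of k] assms by simp
  have "2 * real k < 2 * real j" "0 \<le> 2 * real k" using assms by auto
  from mult_less_le_imp_less[OF this(1) le this(2) pos] show ?thesis .
qed

end

theorem theorem4p1:
  fixes e :: "nat \<Rightarrow> 'n::finite" and N m :: nat and a b p :: real
  assumes "N = CARD('n)" and "bij_betw e {..<N} UNIV"
    and "N \<ge> 3" and "1 \<le> m" and "m \<le> N - 2"
    and "0 < a" and "a < b"
    and "2 < p" and "p < 2 * real N / (real N - 2)"
  shows "\<exists>u :: nat \<Rightarrow> real^'n \<Rightarrow> real.
     (\<forall>k\<ge>3. weak_solution (annular_dom e m a b) p (u k) \<and>
        (\<forall>g\<in>Gk k. \<forall>x\<in>annular_dom e m a b.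
            u k x = det g * u k (act e (matrix_inv g) x))) \<and>
     (\<forall>k\<ge>3. \<forall>j\<ge>3. k \<noteq> j \<longrightarrow> \<not> (AE x in lebesgue. u k x = u j x))"
proof -
  interpret annular e m a b p
    using assms by unfold_locales auto
  define E where "E k = 2 * real k * cylinder.level (sector k) p powr (p / (p - 2))" for k
  have "\<exists>v. weak_solution \<Omega> p (antisymmetrize k v) \<and> antisymmetrize k v \<in> borel_measurable borel \<and>
      (\<integral>x. \<bar>antisymmetrize k v x\<bar> powr p \<partial>lborel) = E k" if "k \<ge> 3" for k
    unfolding E_def by (rule sector_solution[OF that]) blast
  then obtain v where v: "\<And>k. k \<ge> 3 \<Longrightarrow> weak_solution \<Omega> p (antisymmetrize k (v k))"
    "\<And>k. k \<ge> 3 \<Longrightarrow> antisymmetrize k (v k) \<in> borel_measurable borel"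
    "\<And>k. k \<ge> 3 \<Longrightarrow> (\<integral>x. \<bar>antisymmetrize k (v k) x\<bar> powr p \<partial>lborel) = E k" by metis
  define u where "u k = antisymmetrize k (v k)" for k
  \<comment> \<open>The integral of \<open>|u k| powr p\<close> is \<open>E k\<close> and sees
    \<open>u k\<close> only up to null sets, so the solutions differ even as classes modulo null
    sets.\<close>
  have EE: "E k = E j" if kj: "k \<ge> 3" "j \<ge> 3" and ae: "AE x in lebesgue. u k x = u j x" for k j
  proof -
    note [measurable] = v(2)[OF kj(1), folded u_def] v(2)[OF kj(2), folded u_def]
    have "AE x in lborel. u k x = u j x" using ae by (simp add: AE_completion_iff)
    then have "(\<integral>x. \<bar>u k x\<bar> powr p \<partial>lborel) = (\<integral>x. \<bar>u j x\<bar> powr p \<partial>lborel)"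
      by (intro integral_cong_AE) auto
    then show ?thesis using v(3)[OF kj(1)] v(3)[OF kj(2)] by (simp add: u_def)
  qed
  have ne: "E k \<noteq> E j" if "k \<ge> 3" "j \<ge> 3" "k \<noteq> j" for k j
    using that energy_strict_mono[of k j] energy_strict_mono[of j k] unfolding E_def
    by (cases "k < j") auto
  show ?thesis
  proof (intro exI[of _ u] conjI allI impI ballI)
    fix k :: nat assume k: "k \<ge> 3"
    show "weak_solution \<Omega> p (u k)" using v(1)[OF k] by (simp add: u_def)
    show "u k x = det g * u k (act e (matrix_inv g) x)" if "g \<in> Gk k" for g x
      unfolding u_def by (rule antisymmetrize_symmetry[OF that]) (use k in simp)
    show "\<not> (AE x in lebesgue. u k x = u j x)" if "j \<ge> 3" "k \<noteq> j" for j
      using EE[OF k that(1)] ne[OF k that] by blast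
  qed
qed
end
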